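(* Let $3\le m\le 26$, and let $\mathbf D_n=(D_n^{(0)},D_n^{(1)},\dots,D_n^{(m)})$, where $D_n^{(k)}$ is the number of nodes of outdegree $k$ in the random $m$-ary search tree on $n$ keys. Let $$\mathbf v^*=\frac{1}{(m+1)(H_m-1)}\Bigl(\tfrac{m-1}{2},\tfrac1m,\tfrac1m,\dots,\tfrac1m\Bigr)\in\mathbb R^{m+1}.$$ Then there is a (possibly singular) covariance matrix $\boldsymbol\Sigma$ such that, as $n\to\infty$, $$\frac{\mathbf D_n-n\mathbf v^*}{\sqrt n}\ \xrightarrow{\ d\ }\ \mathcal N(\mathbf 0,\boldsymbol\Sigma),$$ a centered multivariate normal distribution.
   Context: The random $m$-ary search tree on $n$ keys is built by inserting, one at a time, the entries of a uniformly random permutation of $\{1,\dots,n\}$ into an initially empty tree: each node stores at most $m-1$ keys in sorted order; the first key creates the root; a key reaching a node holding fewer than $m-1$ keys is stored in that node; a key reaching a node holding $m-1$ keys $x_1<\dots<x_{m-1}$ is sent to the $j$-th subtree of that node ($1\le j\le m$), where $x_{j-1}<\text{key}<x_j$ with $x_0=-\infty$, $x_m=+\infty$, and inserted recursively there (creating a new node if that subtree is empty). The outdegree of a node is its number of nonempty subtrees. $H_m=\sum_{r=1}^m 1/r$. A possibly singular multivariate normal law is one whose covariance matrix may be singular. *)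

theory Defs
  imports "HOL-Probability.Probability" "HOL-Combinatorics.Multiset_Permutations"
begin

text \<open>m-ary search trees. A node stores its keys as a sorted list and has children
  indexed by 0..m-1 (child j is the (j+1)-th subtree); children at indices >= m are never used.\<close>
datatype mtree = Empty | Node "nat list" "nat \<Rightarrow> mtree"

primrec ins :: "nat \<Rightarrow> nat \<Rightarrow> mtree \<Rightarrow> mtree" where
  "ins m x Empty = Node [x] (\<lambda>_. Empty)"
| "ins m x (Node ks c) =
     (let r = ins m x \<circ> c in
      if length ks < m - 1 then Node (insort x ks) c
      else Node ks (\<lambda>i. if i = length (filter (\<lambda>k. k < x) ks) then r i else c i))"

definition build :: "nat \<Rightarrow> nat list \<Rightarrow> mtree" where
  "build m xs = foldl (\<lambda>t x. ins m x t) Empty xs"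

primrec deg_count :: "nat \<Rightarrow> nat \<Rightarrow> mtree \<Rightarrow> nat" where
  "deg_count m k Empty = 0"
| "deg_count m k (Node ks c) =
     (if card {i. i < m \<and> c i \<noteq> Empty} = k then 1 else 0) + (\<Sum>i<m. deg_count m k (c i))"

definition rand_perm :: "nat \<Rightarrow> nat list pmf" where
  "rand_perm n = pmf_of_set (permutations_of_set {1..n})"

definition vstar :: "nat \<Rightarrow> nat \<Rightarrow> real" where
  "vstar m k = (if k = 0 then (real m - 1) / 2 else 1 / real m) / ((real m + 1) * (harm m - 1))"

text \<open>Law of (D_n - n v*)/sqrt n, as a vector in R^(m+1) encoded as a function
  nat => real vanishing at indices > m.\<close>
definition scaled_law :: "nat \<Rightarrow> nat \<Rightarrow> (nat \<Rightarrow> real) measure" where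
  "scaled_law m n = measure_pmf (map_pmf
     (\<lambda>xs. \<lambda>k. if k \<le> m then (real (deg_count m k (build m xs)) - real n * vstar m k) / sqrt (real n) else 0)
     (rand_perm n))"

definition covariance_matrix :: "nat \<Rightarrow> (nat \<Rightarrow> nat \<Rightarrow> real) \<Rightarrow> bool" where
  "covariance_matrix m S \<longleftrightarrow>
     (\<forall>i\<le>m. \<forall>j\<le>m. S i j = S j i) \<and>
     (\<forall>t::nat \<Rightarrow> real. 0 \<le> (\<Sum>i\<le>m. \<Sum>j\<le>m. t i * S i j * t j))"

text \<open>mu is the centered (possibly singular) multivariate normal law N(0,S) on R^(m+1),
  characterised by its characteristic function.\<close>
definition centered_normal :: "nat \<Rightarrow> (nat \<Rightarrow> nat \<Rightarrow> real) \<Rightarrow> (nat \<Rightarrow> real) measure \<Rightarrow> bool" where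
  "centered_normal m S \<mu> \<longleftrightarrow>
     prob_space \<mu> \<and> sets \<mu> = sets borel \<and> (AE x in \<mu>. \<forall>i>m. x i = 0) \<and>
     (\<forall>t::nat \<Rightarrow> real.
        (CLINT x|\<mu>. cis (\<Sum>i\<le>m. t i * x i))
          = complex_of_real (exp (- (\<Sum>i\<le>m. \<Sum>j\<le>m. t i * S i j * t j) / 2)))"

definition conv_in_distr :: "(nat \<Rightarrow> (nat \<Rightarrow> real) measure) \<Rightarrow> (nat \<Rightarrow> real) measure \<Rightarrow> bool" where
  "conv_in_distr P \<mu> \<longleftrightarrow>
     (\<forall>f :: (nat \<Rightarrow> real) \<Rightarrow> real. continuous_on UNIV f \<and> bounded (range f) \<longrightarrow>
        (\<lambda>n. integral\<^sup>L (P n) f) \<longlonglongrightarrow> integral\<^sup>L \<mu> f)"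

end

theory Submission
  imports Defs "HOL-Computational_Algebra.Fundamental_Theorem_Algebra"
begin

text \<open>
  Fix weights \<open>t\<close> and consider the statistic \<open>X\<^sub>n = \<Sum>k. t k * D\<^sub>n\<^sup>k\<close>. Given the sizes of the \<open>m\<close> subtrees of the
  root, which are uniform among all compositions of \<open>n - m + 1\<close>, the subtrees are independent, so mean,
  variance and characteristic function of \<open>X\<^sub>n\<close> satisfy recurrences with the same linear part. In terms
  of the operator \<open>\<theta> = (1 - z) d/dz\<close> on generating functions this linear part is \<open>\<phi>(\<theta>)\<close> with
  \<open>\<phi>(x) = x (x + 1) \<cdots> (x + m - 2) - m!\<close>; solving one linear factor at a time transfers bounds on the
  inhomogeneity to the solution. For \<open>m \<le> 26\<close> every root of \<open>\<phi>\<close> except 2 has real part below \<open>3/2\<close>,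
  so for some \<open>\<alpha> < 1/2\<close> the mean is linear up to \<open>O(n\<^sup>\<alpha>)\<close>, hence the variance is linear up to
  \<open>O(n\<^bsup>2\<alpha>\<^esup>)\<close>, and the distance of the characteristic function at \<open>s\<close> to that of the normal law with the
  same mean and variance is \<open>\<bar>s\<bar>\<^sup>3 O(n\<^bsup>3\<alpha>\<^esup>)\<close>, which vanishes at \<open>s = n\<^bsup>-1/2\<^esup>\<close>.
\<close>

section \<open>Roots of the indicial polynomial\<close>

text \<open>The threshold 3/2 comes from the normalisation: a root l of \<phi> contributes order
  n^(Re l - 1) to the mean, and this must be o(sqrt n). The bound m \<le> 26 enters through this
  condition alone. The root 2 gives the linear term, and its simplicity, \<phi>'(2) = m! (H_m - 1),
  puts the factor H_m - 1 into v*. The Gaussian compared with X_n has the exact mean and variance of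
  X_n, so that at each split the terms of first and second order in s cancel and only a third-order
  error remains; its recurrence has exponent 3 \<alpha>, and \<alpha> > 1/3 puts this above the
  growth belonging to the root 2, so that a plain bound suffices there. From scalars to vectors: the
  limit variance is a quadratic form in the weights, polarisation reads off the covariance matrix,
  and convergence of the characteristic functions at every t becomes weak convergence by
  trigonometric approximation, with bounded second moments as tightness.\<close>

lemma prod_complex_polar:
  fixes a :: "nat \<Rightarrow> real"
  assumes "\<And>j. j < n \<Longrightarrow> 0 < a j"
  shows "(\<Prod>j<n. Complex (a j) b) =
    complex_of_real (\<Prod>j<n. cmod (Complex (a j) b)) * cis (\<Sum>j<n. arctan (b / a j))"
  using assms
proof (induction n)
  case (Suc n)
  have pos: "0 < a n" using Suc.prems by auto
  have "Complex (a n) b = complex_of_real (cmod (Complex (a n) b)) * cis (arctan (b / a n))"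
  proof -
    have s: "sqrt ((a n)\<^sup>2 + b\<^sup>2) = a n * sqrt (1 + (b / a n)\<^sup>2)"
    proof -
      have "(a n)\<^sup>2 + b\<^sup>2 = (a n)\<^sup>2 * (1 + (b / a n)\<^sup>2)"
        using pos by (simp add: field_simps)
      then show ?thesis using pos by (simp add: real_sqrt_mult)
    qed
    have "0 < 1 + (b / a n)\<^sup>2" by (simp add: add_pos_nonneg)
    then have "sqrt (1 + (b / a n)\<^sup>2) \<noteq> 0" by auto
    then show ?thesis using pos
      by (auto simp: complex_eq_iff s cos_arctan sin_arctan complex_norm)
  qed
  moreover have "(\<Prod>j<n. Complex (a j) b) =
    complex_of_real (\<Prod>j<n. cmod (Complex (a j) b)) * cis (\<Sum>j<n. arctan (b / a j))"
    by (rule Suc.IH) (use Suc.prems in auto)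
  moreover have "B = of_real d * cis u \<Longrightarrow> A = of_real c * cis t \<Longrightarrow>
    B * A = of_real (d * c) * cis (u + t)" for A B and c d t u :: real
    by (simp add: cis_mult[symmetric])
  ultimately show ?case unfolding prod.lessThan_Suc sum.lessThan_Suc by blast
qed simp

text \<open>The factors are 200 (z + j) at the test point z = 3/2 + (441/200) i. Clearing the
  denominators makes real and imaginary parts integers, so that signs can be decided by exact
  evaluation.\<close>

definition arg_prod :: "nat \<Rightarrow> complex" where
  "arg_prod n = (\<Prod>j<n. Complex (real (200 * j + 300)) 441)"

definition arg_step :: "nat \<Rightarrow> int \<times> int \<Rightarrow> int \<times> int" where
  "arg_step j p = ((200 * int j + 300) * fst p - 441 * snd p, (200 * int j + 300) * snd p + 441 * fst p)"

primrec arg_pair :: "nat \<Rightarrow> int \<times> int" where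
  "arg_pair 0 = (1, 0)"
| "arg_pair (Suc n) = arg_step n (arg_pair n)"

lemma arg_prod_arg_pair: "arg_prod n = Complex (of_int (fst (arg_pair n))) (of_int (snd (arg_pair n)))"
  by (induction n) (auto simp: arg_prod_def arg_step_def complex_eq_iff algebra_simps)

text \<open>For m = 26 there are 25 = m - 1 factors. The single sign change, between 5 and 6
  factors, marks the passage of the argument through pi; a second one would mark 2 pi.\<close>

lemma arg_pair_signs:
  "\<forall>n\<in>{1..25}. if n \<le> 5 then snd (arg_pair n) > 0 else snd (arg_pair n) < 0"
  by code_simp

text \<open>The argument is kept as an unreduced sum of arctangents: excluding roots depends on its
  not having completed a full turn, which a principal value would hide.\<close>

definition arg_sum :: "nat \<Rightarrow> real" where
  "arg_sum n = (\<Sum>j<n. arctan (441 / (200 * real j + 300)))"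

lemma arg_sum_Suc: "arg_sum (Suc n) = arg_sum n + arctan (441 / (200 * real n + 300))"
  by (simp add: arg_sum_def)

lemma arg_sum_step: "arg_sum (Suc n) < arg_sum n + pi / 2"
  using arctan_ubound by (simp add: arg_sum_Suc)

lemma sgn_arg_prod: "sgn (sin (arg_sum n)) = sgn (real_of_int (snd (arg_pair n)))"
proof -
  define P where "P = (\<Prod>j<n. cmod (Complex (real (200 * j + 300)) 441))"
  have "arg_prod n = complex_of_real P * cis (arg_sum n)"
    unfolding P_def arg_prod_def arg_sum_def by (subst prod_complex_polar) (auto simp: algebra_simps)
  then have "real_of_int (snd (arg_pair n)) = P * sin (arg_sum n)"
    unfolding arg_prod_arg_pair by (simp add: complex_eq_iff)
  moreover have "P > 0" unfolding P_def
    by (intro prod_pos) (auto simp: complex_eq_iff)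
  ultimately show ?thesis by (simp add: sgn_mult)
qed

text \<open>No step of the argument exceeds \<open>\<pi>/2\<close>, so it can cross \<open>\<pi>\<close> and \<open>2\<pi>\<close> only where the
  imaginary part of the partial product changes sign.\<close>

lemma arg_sum_less_pi: "n \<le> 5 \<Longrightarrow> arg_sum n < pi"
proof (induction n)
  case (Suc n)
  have "sgn (sin (arg_sum (Suc n))) = 1"
    using arg_pair_signs Suc.prems unfolding sgn_arg_prod by (simp add: Ball_def del: arg_pair.simps)
  then have s: "sin (arg_sum (Suc n)) > 0" by (simp add: sgn_1_pos)
  show ?case
  proof (rule ccontr)
    assume "\<not> ?thesis"
    then have "pi \<le> arg_sum (Suc n)" "arg_sum (Suc n) < 2 * pi"
      using arg_sum_step[of n] Suc by auto
    then show False using s sin_le_zero by fastforce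
  qed
qed (simp add: arg_sum_def)

lemma arg_sum_less_2pi: "n \<le> 25 \<Longrightarrow> arg_sum n < 2 * pi"
proof (induction n)
  case (Suc n)
  show ?case
  proof (cases "Suc n \<le> 5")
    case True then show ?thesis using arg_sum_less_pi[of "Suc n"] pi_gt_zero by linarith
  next
    case False
    have "sgn (sin (arg_sum (Suc n))) = -1"
      using arg_pair_signs False Suc.prems unfolding sgn_arg_prod by (simp add: Ball_def del: arg_pair.simps)
    then have s: "sin (arg_sum (Suc n)) < 0" by (simp add: sgn_1_neg)
    show ?thesis
    proof (rule ccontr)
      assume "\<not> ?thesis"
      then have "0 \<le> arg_sum (Suc n) - 2 * pi" "arg_sum (Suc n) - 2 * pi \<le> pi"
        using arg_sum_step[of n] Suc by auto
      then have "0 \<le> sin (arg_sum (Suc n) - 2 * pi)" by (rule sin_ge_zero)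
      then show False using s by (simp add: sin_diff)
    qed
  qed
qed (simp add: arg_sum_def)

text \<open>The height \<open>y = 441/200\<close> lies in the narrow window (for \<open>m = 26\<close>) where on the line \<open>Re = 3/2\<close>
  the modulus of \<open>\<Prod>j<m - 1. z + j\<close> already exceeds \<open>m!\<close> while its argument is still below \<open>2\<pi>\<close>.
  Both grow with the height, so no root with \<open>Re \<ge> 3/2\<close> fits on either side of it.\<close>

primrec modulus_prod :: "nat \<Rightarrow> int" where
  "modulus_prod 0 = 1"
| "modulus_prod (Suc n) = ((200 * int n + 300)\<^sup>2 + 194481) * modulus_prod n"

primrec factorial_prod :: "nat \<Rightarrow> int" where
  "factorial_prod 0 = 1"
| "factorial_prod (Suc n) = (200 * int n + 400) * factorial_prod n"

text \<open>For n = m - 1 this says that the modulus of the product exceeds m! at the test point,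
  squared and scaled by 200^(2n) to stay in the integers; 194481 is 441^2.\<close>

lemma modulus_prod_gt: "\<forall>n\<in>{2..25}. (factorial_prod n)\<^sup>2 < modulus_prod n"
  by code_simp

lemma modulus_prod_eq: "real_of_int (modulus_prod n) = (\<Prod>j<n. (200 * real j + 300)\<^sup>2 + 441\<^sup>2)"
  by (induction n) auto

lemma factorial_prod_eq: "real_of_int (factorial_prod n) = 200 ^ n * fact (n + 1)"
  by (induction n) (auto simp: algebra_simps)

lemma fact_eq_prod: "m \<ge> 1 \<Longrightarrow> fact m = (\<Prod>j<m - 1. j + 2)"
proof (induction m rule: nat_induct_at_least)
  case (Suc n)
  then obtain k where "n = Suc k" by (cases n) auto
  then show ?case using Suc by (simp add: mult.commute)
qed simp

text \<open>Moving to the right of the line Re = 3/2 raises every modulus and lowers every argument,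
  so the one test point settles the half plane: at height 441/200 or more the product is too large,
  and below it the argument lies strictly between 0 and 2 pi, while m! > 0 requires a multiple of 2
  pi.\<close>

lemma indicial_root_upper:
  fixes z :: complex
  assumes m: "3 \<le> m" "m \<le> 26" and z: "(\<Prod>j<m - 1. z + of_nat j) = fact m"
    and re: "Re z \<ge> 3 / 2"
  shows "\<not> Im z > 0"
proof
  assume im: "Im z > 0"
  show False
  proof (cases "Im z \<ge> 441 / 200")
    case True
    have "m - 1 \<in> {2..25}" using m by auto
    note gt = bspec[OF modulus_prod_gt this]
    have "(\<Prod>j<m - 1. (200 * real j + 300)\<^sup>2 + 441\<^sup>2) \<le> (\<Prod>j<m - 1. (200 * cmod (z + of_nat j))\<^sup>2)"
    proof (intro prod_mono conjI)
      fix j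
      have "(200 * real j + 300)\<^sup>2 + 441\<^sup>2 \<le> (200 * Re (z + of_nat j))\<^sup>2 + (200 * Im z)\<^sup>2"
        using re True by (intro add_mono power_mono) auto
      also have "... = (200 * cmod (z + of_nat j))\<^sup>2"
        by (simp only: cmod_power2 power_mult_distrib) (simp add: distrib_left)
      finally show "(200 * real j + 300)\<^sup>2 + 441\<^sup>2 \<le> (200 * cmod (z + of_nat j))\<^sup>2" .
    qed auto
    also have "... = (200 ^ (m - 1) * cmod (\<Prod>j<m - 1. z + of_nat j))\<^sup>2"
      by (simp only: prod_norm[symmetric] prod_power_distrib[symmetric] prod.distrib prod_constant card_lessThan)
    also have "... = real_of_int ((factorial_prod (m - 1))\<^sup>2)"
      using z m by (simp add: norm_fact factorial_prod_eq)
    also have "... < real_of_int (modulus_prod (m - 1))"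
      using gt by (simp only: of_int_less_iff)
    finally show False unfolding modulus_prod_eq by simp
  next
    case False
    define \<theta> where "\<theta> = (\<Sum>j<m - 1. arctan (Im z / (Re z + real j)))"
    have eq: "(\<Prod>j<m - 1. z + of_nat j) = (\<Prod>j<m - 1. Complex (Re z + real j) (Im z))"
      by (intro prod.cong) (auto simp: complex_eq_iff)
    define P where "P = (\<Prod>j<m - 1. cmod (Complex (Re z + real j) (Im z)))"
    have P: "P > 0" unfolding P_def using im
      by (intro prod_pos) (auto simp: complex_eq_iff)
    have f: "fact m = complex_of_real P * cis \<theta>"
      unfolding z[symmetric] eq \<theta>_def P_def using re by (subst prod_complex_polar) auto
    have "\<theta> > 0"
      unfolding \<theta>_def using m re im by (intro sum_pos) (auto simp: lessThan_empty_iff)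
    have "\<theta> \<le> arg_sum (m - 1)"
      unfolding \<theta>_def arg_sum_def
    proof (intro sum_mono)
      fix j
      have "Im z / (Re z + real j) \<le> (441 / 200) / (3 / 2 + real j)"
        using re im False by (intro frac_le) auto
      also have "... = 441 / (200 * real j + 300)" by (simp add: field_simps)
      finally show "arctan (Im z / (Re z + real j)) \<le> arctan (441 / (200 * real j + 300))"
        by (simp add: arctan_le_iff)
    qed
    also have "... < 2 * pi" using m by (intro arg_sum_less_2pi) auto
    finally have lt: "\<theta> < 2 * pi" .
    have fr: "(fact m :: complex) = of_real (fact m)" by simp
    have "fact m = P * cos \<theta>" "0 = P * sin \<theta>"
      using f unfolding fr complex_eq_iff by (simp_all add: cis.ctr Re_divide Im_divide)
    then have "sin \<theta> = 0" "cos \<theta> > 0"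
      using P by (auto, metis fact_gt_zero zero_less_mult_pos)
    then have "cos \<theta> = 1" using sin_cos_squared_add[of \<theta>] by (auto simp: power2_eq_1_iff)
    then show False using \<open>\<theta> > 0\<close> lt by (auto simp: cos_one_2pi_int zero_less_mult_iff elim!: Ints_cases)
  qed
qed

text \<open>Roots come in conjugate pairs, so the exclusion of the upper half plane leaves real
  ones; for real x \<ge> 3/2 the product is strictly increasing and takes the value m! at 2.\<close>

lemma indicial_root:
  fixes z :: complex
  assumes m: "3 \<le> m" "m \<le> 26" and z: "(\<Prod>j<m - 1. z + of_nat j) = fact m"
    and re: "Re z \<ge> 3 / 2"
  shows "z = 2"
proof -
  have "\<not> Im z > 0" using indicial_root_upper[OF assms] .
  moreover have "\<not> Im (cnj z) > 0"
  proof (rule indicial_root_upper[OF m])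
    have "(\<Prod>j<m - 1. cnj z + of_nat j) = cnj (\<Prod>j<m - 1. z + of_nat j)" by simp
    then show "(\<Prod>j<m - 1. cnj z + of_nat j) = fact m" unfolding z by simp
  qed (use re in simp)
  ultimately have im: "Im z = 0" by simp
  then obtain x where x: "z = of_real x" by (metis complex_eq_iff Re_complex_of_real Im_complex_of_real)
  have "complex_of_real (\<Prod>j<m - 1. x + real j) = of_real (fact m)"
    using z unfolding x by simp
  then have "(\<Prod>j<m - 1. x + real j) = fact m"
    by (simp only: of_real_eq_iff)
  moreover have "fact m = (\<Prod>j<m - 1. 2 + real j)"
  proof -
    have "real (fact m) = real (\<Prod>j<m - 1. j + 2)" using m by (subst fact_eq_prod) auto
    then show ?thesis by (simp add: add.commute)
  qed
  ultimately have eq: "(\<Prod>j<m - 1. x + real j) = (\<Prod>j<m - 1. 2 + real j)" by simp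
  have "x = 2"
  proof (rule ccontr)
    assume "x \<noteq> 2"
    moreover have "(\<Prod>j<m - 1. x + real j) < (\<Prod>j<m - 1. 2 + real j)" if "x < 2"
      using that re x m by (intro prod_mono_strict[of 0]) auto
    moreover have "(\<Prod>j<m - 1. 2 + real j) < (\<Prod>j<m - 1. x + real j)" if "2 < x"
      using that re x m by (intro prod_mono_strict[of 0]) auto
    ultimately show False using eq by linarith
  qed
  then show ?thesis using x by simp
qed

section \<open>Transfer of asymptotics through the splitting recurrence\<close>

unbundle no vec_syntax
unbundle fps_syntax

text \<open>The powers (1 - z)^(-l) are eigenvectors with eigenvalue l, and their coefficients grow
  like n^(l - 1); this is how a root l of the indicial polynomial turns into a growth rate.\<close>

definition theta :: "'a::comm_ring_1 fps \<Rightarrow> 'a fps" where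
  "theta A = (1 - fps_X) * fps_deriv A"

definition theta_poly :: "'a::comm_ring_1 poly \<Rightarrow> 'a fps \<Rightarrow> 'a fps" where
  "theta_poly p A = fold_coeffs (\<lambda>a B. fps_const a * A + theta B) p 0"

lemma theta_nth: "theta A $ n = of_nat (n + 1) * A $ (n + 1) - of_nat n * A $ n"
  by (cases n) (auto simp: theta_def left_diff_distrib)

lemma theta_add: "theta (A + B) = theta A + theta B"
  by (simp add: theta_def algebra_simps)

lemma theta_diff: "theta (A - B) = theta A - theta B"
  by (simp add: theta_def algebra_simps)

lemma theta_const: "theta (fps_const c * A) = fps_const c * theta A"
  by (simp add: theta_def algebra_simps)

lemma theta_poly_0 [simp]: "theta_poly 0 A = 0"
  by (simp add: theta_poly_def)

lemma theta_poly_pCons: "theta_poly (pCons a p) A = fps_const a * A + theta (theta_poly p A)"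
proof -
  have t0: "theta (0 :: 'a fps) = 0" by (simp add: theta_def)
  then have "(\<lambda>a B. fps_const a * A + theta B) 0 0 = 0" by simp
  then show ?thesis unfolding theta_poly_def
    by (cases "p = 0 \<and> a = 0") (auto simp: fold_coeffs_pCons_coeff_not_0_eq fold_coeffs_pCons_not_0_0_eq t0)
qed

lemma theta_zero [simp]: "theta 0 = 0"
  by (simp add: theta_def)

lemma theta_poly_const: "theta_poly [:c:] A = fps_const c * A"
  by (simp add: theta_poly_pCons)

lemma theta_poly_add: "theta_poly (p + q) A = theta_poly p A + theta_poly q A"
  by (induction p q rule: poly_induct2)
     (auto simp: theta_poly_pCons theta_add algebra_simps simp flip: fps_const_add)

lemma theta_poly_smult: "theta_poly (smult c p) A = fps_const c * theta_poly p A"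
  by (induction p) (auto simp: theta_poly_pCons theta_const distrib_left mult.assoc simp flip: fps_const_mult)

lemma theta_poly_diff: "theta_poly (p - q) A = theta_poly p A - theta_poly q A"
  using theta_poly_add[of "p - q" q A] by (simp add: algebra_simps)

lemma theta_poly_linear_mult: "theta_poly ([:a, 1:] * p) A = theta (theta_poly p A) + fps_const a * theta_poly p A"
  by (simp add: theta_poly_add theta_poly_smult theta_poly_pCons algebra_simps)

lemma theta_poly_arg_diff: "theta_poly p (A - B) = theta_poly p A - theta_poly p B"
  by (induction p) (simp_all add: theta_poly_pCons theta_diff right_diff_distrib)

lemma theta_poly_arg_const: "theta_poly p (fps_const c * A) = fps_const c * theta_poly p A"
  by (induction p) (auto simp: theta_poly_pCons theta_const algebra_simps)

text \<open>Each application of \<open>theta\<close> looks one coefficient ahead, so coefficient j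
  of the result reads coefficients of A up to j + degree p at most.\<close>

lemma theta_poly_nth_zero:
  assumes "\<And>j. j < k \<Longrightarrow> A $ j = 0" and "j + degree p < k"
  shows "theta_poly p A $ j = 0"
  using assms(2)
proof (induction p arbitrary: j)
  case (pCons a p)
  show ?case
  proof (cases "p = 0")
    case True then show ?thesis using pCons.prems assms(1) by (simp add: theta_poly_pCons)
  next
    case False
    then show ?thesis using pCons.prems pCons.IH[of j] pCons.IH[of "Suc j"] assms(1)
      by (simp add: theta_poly_pCons theta_nth)
  qed
qed simp

text \<open>The summand k in the factor theta + k cancels the derivative of (1 - z)^k. Thus the
  Euler-type operator (1 - z)^k D^k, which arises from the split, becomes a polynomial in
  \<open>theta\<close>.\<close>

lemma theta_poly_rising:
  "theta_poly (\<Prod>j<k. [:of_nat j, 1:]) A = (1 - fps_X) ^ k * (fps_deriv ^^ k) A"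
proof (induction k)
  case (Suc k)
  define B where "B = (fps_deriv ^^ k) A"
  have d: "fps_deriv ((1 - fps_X) ^ k * B) =
      (1 - fps_X) ^ k * fps_deriv B - of_nat k * (1 - fps_X) ^ (k - 1) * B"
    by (simp add: fps_deriv_power algebra_simps fps_of_nat)
  have "theta_poly (\<Prod>j<Suc k. [:of_nat j, 1:]) A =
      (1 - fps_X) * fps_deriv ((1 - fps_X) ^ k * B) + of_nat k * ((1 - fps_X) ^ k * B)"
    unfolding prod.lessThan_Suc mult.commute[of _ "[:of_nat k, 1:]"] theta_poly_linear_mult Suc theta_def B_def
    by (simp add: fps_of_nat)
  also have "... = (1 - fps_X) ^ Suc k * fps_deriv B"
    unfolding d by (cases k) (simp_all add: algebra_simps)
  finally show ?case by (simp add: B_def)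
qed (simp add: theta_poly_const one_pCons)

text \<open>This is (1 - z)^(-2), the eigenvector for the eigenvalue 2, on which p(theta) acts as
  the scalar p(2).\<close>

definition linear_fps :: "complex fps" where "linear_fps = Abs_fps (\<lambda>n. of_nat (n + 1))"

lemma theta_linear_fps: "theta linear_fps = fps_const 2 * linear_fps"
  by (rule fps_ext) (simp add: theta_nth linear_fps_def algebra_simps)

lemma theta_poly_linear_fps: "theta_poly p linear_fps = fps_const (poly p 2) * linear_fps"
proof (induction p)
  case (pCons a p)
  then show ?case
    by (simp only: theta_poly_pCons theta_const theta_linear_fps poly_pCons fps_const_add[symmetric]
        fps_const_mult[symmetric]) (simp add: algebra_simps del: fps_const_add fps_const_mult)
qed simp

section \<open>Growth of solutions of first-order recurrences\<close>

lemma bernoulli_powr: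
  fixes g :: real assumes "g \<ge> 0"
  shows "(real n + 1) powr g * (1 + g / (real n + 2)) \<le> (real n + 2) powr g"
proof -
  \<comment> \<open>The inequalities x / (1 + x) \<le> ln (1 + x) and 1 + u \<le> exp u give a
    Bernoulli inequality for every g \<ge> 0, including g < 1, at the price of the denominator n + 2
    in place of n + 1.\<close>
  define x where "x = 1 / (real n + 1)"
  have x: "x > 0" by (simp add: x_def)
  have "1 / (real n + 2) = x / (1 + x)" by (simp add: x_def field_simps)
  also have "... \<le> ln (1 + x)"
    using x ln_le_minus_one[of "1 / (1 + x)"] by (simp add: ln_div field_simps)
  finally have "g * (1 / (real n + 2)) \<le> g * ln (1 + x)" using assms by (rule mult_left_mono)
  also have "1 + g * ln (1 + x) \<le> exp (g * ln (1 + x))" by (rule exp_ge_add_one_self)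
  also have "exp (g * ln (1 + x)) = (1 + x) powr g" using x by (simp add: powr_def)
  finally have *: "1 + g / (real n + 2) \<le> (1 + x) powr g" by simp
  have "(real n + 1) powr g * (1 + g / (real n + 2)) \<le> (real n + 1) powr g * (1 + x) powr g"
    by (rule mult_left_mono[OF *]) simp
  also have "... = ((real n + 1) * (1 + x)) powr g"
    using x by (simp add: powr_mult)
  also have "(real n + 1) * (1 + x) = real n + 2" by (simp add: x_def field_simps)
  finally show ?thesis .
qed

text \<open>After division by n + 1 the homogeneous factor is about 1 + (Re l - 1) / n and the input
  has order n^(g - 1). Since g exceeds both 0 and Re l - 1, a large multiple of (n + 1) powr g is a
  supersolution for large n.\<close>

lemma first_order_bound:
  fixes y z :: "nat \<Rightarrow> complex"
  assumes rec: "\<And>n. of_nat (n + 1) * y (n + 1) = (of_nat n + l) * y n + z n"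
    and z: "\<And>n. cmod (z n) \<le> K * (real n + 1) powr g"
    and g: "0 < g" "Re l - 1 < g"
  obtains K' where "\<And>n. cmod (y n) \<le> K' * (real n + 1) powr g"
proof -
  \<comment> \<open>Three margins between max 0 (Re l - 1) and g: \<open>s\<close> bounds the
    modulus of n + l by n + 1 + s, the gap s' - s absorbs the input, and the gap g - s' pays for the
    denominator n + 2 in \<open>bernoulli_powr\<close>.\<close>
  define s where "s = (max 0 (Re l - 1) + g) / 2"
  define s' where "s' = (s + g) / 2"
  have s: "0 < s" "Re l - 1 < s" "s < s'" "s' < g"
    using g by (auto simp: s_def s'_def max_def field_simps)
  have "eventually (\<lambda>n. cmod (of_nat n + l) \<le> real n + 1 + s) sequentially"
  proof -
    define d where "d = s - (Re l - 1)"
    have d: "d > 0" using s by (simp add: d_def)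
    have "eventually (\<lambda>n. (Im l)\<^sup>2 / d + \<bar>Re l\<bar> \<le> real n) sequentially"
      using eventually_ge_at_top[of "nat \<lceil>(Im l)\<^sup>2 / d + \<bar>Re l\<bar>\<rceil>"] by eventually_elim linarith
    then show ?thesis
    proof eventually_elim
      case (elim n)
      have "(Im l)\<^sup>2 / d \<ge> 0" using d by simp
      then have r: "(Im l)\<^sup>2 / d \<le> real n + Re l" "0 \<le> real n + Re l"
        using elim by linarith+
      have i: "(Im l)\<^sup>2 \<le> d * (real n + Re l)"
        using r d by (simp add: pos_divide_le_eq mult.commute)
      have "(cmod (of_nat n + l))\<^sup>2 = (real n + Re l)\<^sup>2 + (Im l)\<^sup>2"
        by (simp add: cmod_power2)
      also have "... \<le> (real n + Re l + d)\<^sup>2"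
      proof -
        have "0 \<le> d * (real n + Re l)" "0 \<le> d\<^sup>2" using r d by auto
        moreover have "(real n + Re l + d)\<^sup>2 = (real n + Re l)\<^sup>2 + 2 * (d * (real n + Re l)) + d\<^sup>2"
          by (simp add: power2_eq_square algebra_simps)
        ultimately show ?thesis using i by linarith
      qed
      finally have "(cmod (of_nat n + l))\<^sup>2 \<le> (real n + Re l + d)\<^sup>2" .
      then have "cmod (of_nat n + l) \<le> real n + Re l + d"
        by (rule power2_le_imp_le) (use r d in simp)
      then show ?case by (simp add: d_def)
    qed
  qed
  moreover have "eventually (\<lambda>n. s' / (real n + 1) \<le> g / (real n + 2)) sequentially"
  proof -
    have "eventually (\<lambda>n. s' / (g - s') \<le> real n) sequentially"
      using eventually_ge_at_top[of "nat \<lceil>s' / (g - s')\<rceil>"] by eventually_elim linarith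
    then show ?thesis
    proof eventually_elim
      case (elim n)
      then have "s' \<le> real n * (g - s')" using s by (simp add: pos_divide_le_eq)
      then have "s' * (real n + 2) \<le> g * (real n + 1)" using s by (simp add: algebra_simps)
      then show ?case by (simp add: field_simps)
    qed
  qed
  ultimately have "eventually (\<lambda>n. cmod (of_nat n + l) \<le> real n + 1 + s \<and>
      s' / (real n + 1) \<le> g / (real n + 2)) sequentially"
    by eventually_elim auto
  then obtain n0 where n0: "\<And>n. n \<ge> n0 \<Longrightarrow> cmod (of_nat n + l) \<le> real n + 1 + s \<and>
      s' / (real n + 1) \<le> g / (real n + 2)"
    unfolding eventually_sequentially by blast
  have K0: "K \<ge> 0" using order_trans[OF norm_ge_zero z[of 0]] by simp
  \<comment> \<open>The maximum covers the finitely many n where the asymptotic inequalities may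
    fail; K / (s' - s) makes the input fit into the gap s' - s.\<close>
  define K' where "K' = Max (insert (K / (s' - s)) ((\<lambda>n. cmod (y n)) ` {..n0}))"
  have K'1: "K / (s' - s) \<le> K'" and K'2: "\<And>n. n \<le> n0 \<Longrightarrow> cmod (y n) \<le> K'"
    unfolding K'_def by (rule Max_ge; simp)+
  have K'0: "K' \<ge> 0" using K'2[of n0] norm_ge_zero[of "y n0"] by linarith
  have KK: "K \<le> K' * (s' - s)" using K'1 s by (simp add: pos_divide_le_eq)
  have "cmod (y n) \<le> K' * (real n + 1) powr g" for n
  proof (induction n)
    case 0 then show ?case using K'2[of 0] by simp
  next
    case (Suc n)
    show ?case
    proof (cases "Suc n \<le> n0")
      case True
      have "1 \<le> (real (Suc n) + 1) powr g" using g by (intro ge_one_powr_ge_zero) auto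
      then have "K' * 1 \<le> K' * (real (Suc n) + 1) powr g" by (intro mult_left_mono K'0)
      then show ?thesis using K'2[OF True] by simp
    next
      case False
      define p where "p = (real n + 1) powr g"
      have p: "p \<ge> 0" by (simp add: p_def)
      have zz: "cmod (z n) \<le> (K' * (s' - s)) * p"
        using z[of n] mult_right_mono[OF KK p] unfolding p_def by linarith
      have "(real n + 1) * cmod (y (Suc n)) = cmod (of_nat (n + 1) * y (n + 1))"
        by (simp add: norm_mult del: of_nat_Suc)
      also have "... \<le> cmod (of_nat n + l) * cmod (y n) + cmod (z n)"
        unfolding rec by (metis norm_mult norm_triangle_ineq)
      also have "... \<le> (real n + 1 + s) * (K' * p) + (K' * (s' - s)) * p"
        using n0[of n] False Suc.IH s
        by (intro add_mono mult_mono zz) (auto simp: p_def)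
      also have "... = K' * p * (real n + 1) * (1 + s' / (real n + 1))"
        by (simp add: field_simps)
      also have "... \<le> K' * p * (real n + 1) * (1 + g / (real n + 2))"
        using n0[of n] False K'0 p by (intro mult_left_mono) auto
      also have "... = (real n + 1) * (K' * (p * (1 + g / (real n + 2))))" by simp
      also have "... \<le> (real n + 1) * (K' * (real n + 2) powr g)"
        unfolding p_def using g K'0 by (intro mult_left_mono bernoulli_powr) auto
      finally have "cmod (y (Suc n)) \<le> K' * (real n + 2) powr g"
        by (subst (asm) mult_le_cancel_left_pos) auto
      then show ?thesis by (simp add: add.commute)
    qed
  qed
  then show ?thesis by (rule that)
qed

text \<open>Inverting theta - l costs no growth as long as g > Re l - 1: the exponent survives all
  factors and only the constant changes.\<close>

lemma theta_poly_roots_bound: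
  fixes A :: "complex fps"
  assumes "\<And>l. l \<in> set ls \<Longrightarrow> Re l - 1 < g" and g: "0 < g"
    and "\<And>n. cmod (theta_poly (\<Prod>l\<leftarrow>ls. [:-l, 1:]) A $ n) \<le> K * (real n + 1) powr g"
  shows "\<exists>K'. \<forall>n. cmod (A $ n) \<le> K' * (real n + 1) powr g"
  using assms(1,3)
proof (induction ls arbitrary: K)
  case Nil
  have "theta_poly (\<Prod>l\<leftarrow>[]. [:-l, 1:]) A = A" by (simp add: theta_poly_const one_pCons)
  then show ?case using Nil(2) by metis
next
  case (Cons l ls)
  define Y where "Y = theta_poly (\<Prod>l\<leftarrow>ls. [:-l, 1:]) A"
  define Z where "Z = theta_poly (\<Prod>l\<leftarrow>l # ls. [:-l, 1:]) A"
  have eq: "Z = theta Y - fps_const l * Y"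
    unfolding list.map prod_list.Cons theta_poly_linear_mult Y_def Z_def by (simp flip: fps_const_neg)
  have rec: "of_nat (n + 1) * (Y $ (n + 1)) = (of_nat n + l) * Y $ n + Z $ n" for n
    unfolding eq by (simp add: theta_nth algebra_simps)
  have "cmod (Z $ n) \<le> K * (real n + 1) powr g" for n
    using Cons.prems(2) unfolding Z_def .
  moreover have "Re l - 1 < g" using Cons.prems(1) by simp
  ultimately obtain K1 where "\<And>n. cmod (Y $ n) \<le> K1 * (real n + 1) powr g"
    using first_order_bound[of "\<lambda>n. Y $ n" l "\<lambda>n. Z $ n", OF rec _ g] by blast
  then show ?case unfolding Y_def
    by (intro Cons.IH) (use Cons.prems(1) in auto)
qed

text \<open>A telescoping majorant for terms of order n^(-1 - h), so that tails of the series are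
  bounded by an explicit power without comparing with integrals.\<close>

lemma sum_tail_bound_term:
  fixes h :: real assumes "0 < h" "h < 1"
  shows "(real n + 1) powr (1 - h) / ((real n + 1) * (real n + 2))
    \<le> 2 / h * ((real n + 1) powr - h - (real (Suc n) + 1) powr - h)"
proof -
  define a where "a = (real n + 1) powr h"
  define b where "b = (real n + 2) powr h"
  have a: "a > 0" and b: "b > 0" by (auto simp: a_def b_def)
  have ab: "a * (1 + h / (real n + 2)) \<le> b"
    unfolding a_def b_def using assms by (intro bernoulli_powr) auto
  have "1 / b \<le> 1 / (a * (1 + h / (real n + 2)))"
    using ab a b assms by (intro divide_left_mono mult_pos_pos add_pos_nonneg) auto
  also have "... \<le> 1 / a * (1 - h / (2 * (real n + 2)))"
  proof -
    define x where "x = h / (real n + 2)"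
    have x: "0 < x" "x < 1" using assms by (auto simp: x_def divide_simps)
    have "1 / (1 + x) \<le> 1 - x / 2"
    proof -
      have "x * x \<le> x * 1" using x by (intro mult_left_mono) auto
      then have "1 \<le> (1 - x / 2) * (1 + x)" by (simp add: algebra_simps)
      then show ?thesis using x by (simp add: pos_divide_le_eq)
    qed
    then have "1 / a * (1 / (1 + x)) \<le> 1 / a * (1 - x / 2)"
      using a by (intro mult_left_mono) auto
    then show ?thesis by (simp add: x_def mult.commute)
  qed
  finally have "1 / a * (h / (2 * (real n + 2))) \<le> 1 / a - 1 / b" by (simp add: algebra_simps)
  then have "2 / h * (1 / a * (h / (2 * (real n + 2)))) \<le> 2 / h * (1 / a - 1 / b)"
    using assms by (intro mult_left_mono) auto
  moreover have "2 / h * (1 / a * (h / (2 * (real n + 2)))) = 1 / a / (real n + 2)"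
  proof -
    have "2 / h * (1 / a * (h / (2 * X))) = 1 / a / X" for X
      using assms a by (cases "X = 0") (auto simp: field_simps)
    then show ?thesis .
  qed
  moreover have "(real n + 1) powr (1 - h) / ((real n + 1) * (real n + 2)) = 1 / a / (real n + 2)"
    by (simp add: a_def powr_diff)
  moreover have "(real n + 1) powr - h - (real (Suc n) + 1) powr - h = 1 / a - 1 / b"
    by (simp add: a_def b_def powr_minus_divide add.commute)
  ultimately show ?thesis by simp
qed

text \<open>The case l = 2 can be solved exactly: y n / (n + 1) has increments \<open>q n\<close>,
  so y n is n + 1 times a partial sum of q. The full sum is the slope, and the tail of order n^(g -
  1) gives the error.\<close>

lemma second_order_limit:
  fixes y z :: "nat \<Rightarrow> complex"
  assumes rec: "\<And>n. of_nat (n + 1) * y (n + 1) = (of_nat n + 2) * y n + z n" and y0: "y 0 = 0"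
    and z: "\<And>n. cmod (z n) \<le> K * (real n + 1) powr g"
    and g: "0 < g" "g < 1"
  defines "q \<equiv> \<lambda>n. z n / of_nat ((n + 1) * (n + 2))"
  shows "summable q" "\<exists>K'. \<forall>n. cmod (y n - suminf q * of_nat (n + 1)) \<le> K' * (real n + 1) powr g"
proof -
  define h where "h = 1 - g"
  have h: "0 < h" "h < 1" using g by (auto simp: h_def)
  define u where "u = (\<lambda>n. (real n + 1) powr - h)"
  have K0: "K \<ge> 0" using order_trans[OF norm_ge_zero z[of 0]] by simp
  define C where "C = K * (2 / h)"
  have q_le: "cmod (q n) \<le> C * (u n - u (Suc n))" for n
  proof -
    have "cmod (q n) = cmod (z n) / ((real n + 1) * (real n + 2))"
      unfolding q_def norm_divide norm_of_nat by (simp add: algebra_simps)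
    also have "... \<le> (K * (real n + 1) powr g) / ((real n + 1) * (real n + 2))"
      by (intro divide_right_mono z) auto
    also have "... = K * ((real n + 1) powr (1 - h) / ((real n + 1) * (real n + 2)))"
      by (simp add: h_def)
    also have "... \<le> K * (2 / h * (u n - u (Suc n)))"
      unfolding u_def by (intro mult_left_mono[OF _ K0] sum_tail_bound_term h)
    finally show ?thesis unfolding C_def by (simp only: mult.assoc)
  qed
  have u0: "u \<longlonglongrightarrow> 0" unfolding u_def using h by real_asymp
  have ushift: "(\<lambda>n. C * (u (n + k) - u (Suc (n + k)))) sums (C * u k)" for k
    using sums_mult[OF telescope_sums'[OF LIMSEQ_ignore_initial_segment[OF u0, of k]], of C]
    by simp
  show sq: "summable q"
  proof (rule summable_comparison_test')
    show "summable (\<lambda>n. C * (u n - u (Suc n)))" using ushift[of 0] by (simp add: sums_iff)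
  qed (use q_le in auto)
  have ysum: "y n = of_nat (n + 1) * (\<Sum>i<n. q i)" for n
  proof (induction n)
    case (Suc n)
    have n0: "of_nat (n + 1) \<noteq> (0 :: complex)" by (metis Suc_eq_plus1 of_nat_neq_0)
    have n1: "of_nat n + 2 \<noteq> (0 :: complex)" by (metis of_nat_neq_0 of_nat_add of_nat_numeral add_2_eq_Suc')
    have "of_nat (n + 1) * y (n + 1) = (of_nat n + 2) * (of_nat (n + 1) * (\<Sum>i<n. q i)) + z n"
      by (simp only: rec Suc)
    also have "z n = of_nat (n + 1) * ((of_nat n + 2) * q n)"
      using n0 n1 unfolding q_def of_nat_mult by (simp add: add.commute)
    finally have "of_nat (n + 1) * y (n + 1) = of_nat (n + 1) * ((of_nat n + 2) * (\<Sum>i<Suc n. q i))"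
      by (simp add: algebra_simps)
    then have "y (n + 1) = (of_nat n + 2) * (\<Sum>i<Suc n. q i)"
      using n0 by (simp only: mult_cancel_left) simp
    then show ?case by (simp add: algebra_simps)
  qed (use y0 in simp)
  have "cmod (y n - suminf q * of_nat (n + 1)) \<le> C * (real n + 1) powr g" for n
  proof -
    have "y n - suminf q * of_nat (n + 1) = - of_nat (n + 1) * (\<Sum>i. q (i + n))"
      using suminf_split_initial_segment[OF sq, of n] by (simp add: ysum algebra_simps)
    then have "cmod (y n - suminf q * of_nat (n + 1)) = (real n + 1) * cmod (\<Sum>i. q (i + n))"
      by (simp only: norm_mult norm_minus_cancel norm_of_nat) simp
    also have "cmod (\<Sum>i. q (i + n)) \<le> (\<Sum>i. C * (u (i + n) - u (Suc (i + n))))"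
      using ushift[of n] q_le by (intro norm_suminf_le) (auto simp: sums_iff)
    also have "... = C * u n" using ushift[of n] by (simp add: sums_iff)
    also have "(real n + 1) * (C * u n) = C * (real n + 1) powr g"
      unfolding u_def h_def by (simp add: powr_diff)
    finally show ?thesis by simp
  qed
  then show "\<exists>K'. \<forall>n. cmod (y n - suminf q * of_nat (n + 1)) \<le> K' * (real n + 1) powr g" by blast
qed

section \<open>The indicial polynomial and its root 2\<close>

definition indicial :: "nat \<Rightarrow> complex poly" where
  "indicial m = (\<Prod>j<m - 1. [:of_nat j, 1:]) - [:fact m:]"

lemma poly_indicial: "poly (indicial m) z = (\<Prod>j<m - 1. z + of_nat j) - fact m"
  by (simp add: indicial_def poly_prod add.commute)

lemma indicial_degree:
  assumes "m \<ge> 3" shows "degree (indicial m) = m - 1" "lead_coeff (indicial m) = 1"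
proof -
  define p :: "complex poly" where "p = (\<Prod>j<m - 1. [:of_nat j, 1:])"
  have d: "degree p = m - 1" unfolding p_def by (subst degree_prod_sum_eq) auto
  have l: "lead_coeff p = 1" unfolding p_def by (subst lead_coeff_prod) auto
  have e: "indicial m = [:- fact m:] + p" by (simp add: indicial_def p_def)
  show "degree (indicial m) = m - 1" unfolding e using d assms by (subst degree_add_eq_right) auto
  show "lead_coeff (indicial m) = 1" unfolding e using d assms l by (subst lead_coeff_add_le) auto
qed

lemma prod_shift_2: "(\<Prod>j<k. (2 :: 'a :: {semidom,semiring_char_0}) + of_nat j) = fact (k + 1)"
  by (induction k) (auto simp: algebra_simps mult_2 mult_2_right)

text \<open>The logarithmic derivative of x (x + 1) ... (x + m - 2) at 2 is 1/2 + ... + 1/m. This is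
  the origin of H_m - 1 in v*.\<close>

lemma pderiv_indicial_2:
  assumes "m \<ge> 1" shows "poly (pderiv (indicial m)) 2 = fact m * (harm m - 1)"
proof -
  have "poly (pderiv (indicial m)) 2 =
    (\<Sum>a<m - 1. \<Prod>j\<in>{..<m - 1} - {a}. 2 + of_nat j)"
    by (simp add: indicial_def pderiv_diff pderiv_prod poly_sum poly_prod pderiv_pCons add.commute)
  also have "... = (\<Sum>a<m - 1. fact m * (1 / (2 + of_nat a)))"
  proof (intro sum.cong refl)
    fix a assume a: "a \<in> {..<m - 1}"
    have "(\<Prod>j<m - 1. 2 + of_nat j) = (2 + of_nat a) * (\<Prod>j\<in>{..<m - 1} - {a}. (2 :: complex) + of_nat j)"
      using a by (subst prod.remove[of _ a]) auto
    moreover have "(2 + of_nat a :: complex) \<noteq> 0"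
      by (metis of_nat_neq_0 of_nat_add of_nat_numeral add_2_eq_Suc)
    ultimately show "(\<Prod>j\<in>{..<m - 1} - {a}. (2 :: complex) + of_nat j) = fact m * (1 / (2 + of_nat a))"
      using assms unfolding prod_shift_2 by (simp add: field_simps)
  qed
  also have "... = fact m * (\<Sum>a<m - 1. 1 / (2 + of_nat a))" by (simp add: sum_distrib_left)
  also have "(\<Sum>a<m - 1. 1 / (2 + of_nat a)) = (harm m - 1 :: complex)"
    using assms
  proof (induction m rule: nat_induct_at_least)
    case (Suc n)
    then obtain k where "n = Suc k" by (cases n) auto
    then show ?case using Suc by (simp add: harm_Suc field_simps)
  qed (simp add: harm_def)
  finally show ?thesis .
qed

lemma harm_gt_1: "m \<ge> 2 \<Longrightarrow> harm m > (1 :: real)"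
proof (induction m rule: nat_induct_at_least)
  case (Suc n) then show ?case using inverse_positive_iff_positive[of "real (Suc n)"]
    by (simp add: harm_Suc del: inverse_positive_iff_positive)
qed (simp add: harm_def numeral_2_eq_2)

lemma of_real_harm: "of_real (harm m) = (harm m :: complex)"
  by (simp add: harm_def)

text \<open>The cofactor of the root 2 takes at 2 the value of the derivative there, which is
  nonzero because H_m > 1; hence 2 is a simple root and does not occur in \<open>ls\<close>.\<close>

lemma indicial_factor:
  assumes m: "m \<ge> 3"
  obtains ls where "indicial m = [:-2, 1:] * (\<Prod>l\<leftarrow>ls. [:-l, 1:])" "length ls = m - 2"
    "\<And>l. l \<in> set ls \<Longrightarrow> l \<noteq> 2 \<and> (\<Prod>j<m - 1. l + of_nat j) = fact m"
    "poly (\<Prod>l\<leftarrow>ls. [:-l, 1:]) 2 = fact m * (harm m - 1)"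
proof -
  have nz: "indicial m \<noteq> 0" using indicial_degree[OF m] by auto
  have "poly (indicial m) 2 = 0"
    using m unfolding poly_indicial prod_shift_2 by simp
  then have "2 \<in># proots (indicial m)" using nz by simp
  then obtain M where M: "proots (indicial m) = add_mset 2 M" by (meson mset_add)
  obtain ls where ls: "mset ls = M" using ex_mset by blast
  define P where "P = (\<Prod>l\<leftarrow>ls. [:-l, 1:])"
  have f: "indicial m = [:-2, 1:] * P"
    using complex_poly_decompose_multiset[of "indicial m"] indicial_degree(2)[OF m]
    unfolding M P_def by (simp add: prod_mset_prod_list[symmetric] flip: ls mset_map)
  have len: "length ls = m - 2"
    using size_proots_complex[of "indicial m"] indicial_degree(1)[OF m] m
    unfolding M by (simp flip: ls)
  have "poly (pderiv (indicial m)) 2 = poly P 2"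
    unfolding f pderiv_mult by (simp add: pderiv_pCons)
  then have P2: "poly P 2 = fact m * (harm m - 1)"
    using pderiv_indicial_2[of m] m by simp
  have "complex_of_real (harm m) \<noteq> of_real 1" unfolding of_real_eq_iff using harm_gt_1[of m] m by simp
  then have "poly P 2 \<noteq> 0" unfolding P2 of_real_harm by simp
  have "l \<noteq> 2 \<and> (\<Prod>j<m - 1. l + of_nat j) = fact m" if l: "l \<in> set ls" for l
  proof
    have "poly P l = 0" unfolding P_def using l by (induction ls) auto
    then show "l \<noteq> 2" using \<open>poly P 2 \<noteq> 0\<close> by auto
    show "(\<Prod>j<m - 1. l + of_nat j) = fact m"
      using \<open>poly P l = 0\<close> poly_indicial[of m l] unfolding f by simp
  qed
  then show ?thesis using that[of ls] f len P2 unfolding P_def by auto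
qed

section \<open>Recurrences over compositions\<close>

lemma fps_deriv_funpow_nth:
  "(fps_deriv ^^ k) A $ n = of_nat (fact k * ((n + k) choose k)) * (A $ (n + k))"
proof (induction k arbitrary: n)
  case (Suc k)
  have "(n + 1) * (fact k * ((n + 1 + k) choose k)) = fact (Suc k) * ((n + Suc k) choose Suc k)"
  proof -
    have "fact n * fact (Suc k) * ((n + Suc k) choose Suc k) = fact (n + Suc k)"
      using binomial_fact_lemma[of "Suc k" "n + Suc k"] by (simp add: algebra_simps)
    moreover have "fact (n + 1) * fact k * ((n + 1 + k) choose k) = fact (n + 1 + k)"
      using binomial_fact_lemma[of k "n + 1 + k"] by (simp add: algebra_simps)
    ultimately have "fact n * ((n + 1) * (fact k * ((n + 1 + k) choose k)))
        = fact n * (fact (Suc k) * ((n + Suc k) choose Suc k))"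
      by (simp add: algebra_simps)
    then show ?thesis by (simp only: mult_cancel_left) simp
  qed
  then have "of_nat (n + 1) * of_nat (fact k * ((n + 1 + k) choose k)) =
      (of_nat (fact (Suc k) * ((n + Suc k) choose Suc k)) :: 'a)"
    by (metis of_nat_mult)
  then show ?case by (simp only: funpow.simps o_apply fps_deriv_nth Suc mult.assoc[symmetric]) simp
qed simp

text \<open>One coordinate of the composition carries the weight a and each of the other m - 1
  carries the geometric series 1 / (1 - z); by symmetry the m coordinates contribute
  equally.\<close>

lemma natpermute_sum_marginal:
  fixes a :: "nat \<Rightarrow> 'a::comm_ring_1"
  assumes "m \<ge> 1"
  shows "(\<Sum>N\<in>natpermute k m. \<Sum>j<m. a (N ! j)) =
    of_nat m * (Abs_fps a * Abs_fps (\<lambda>_. 1) ^ (m - 1)) $ k"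
proof -
  obtain p where p: "m = Suc p" using assms by (cases m) auto
  have set: "{0..p} = {..<m}" using p by auto
  have "(\<Sum>N\<in>natpermute k m. a (N ! i)) = (Abs_fps a * Abs_fps (\<lambda>_. 1) ^ (m - 1)) $ k"
    if i: "i < m" for i
  proof -
    define F where "F = (\<lambda>j. if j = i then Abs_fps a else Abs_fps (\<lambda>_. 1 :: 'a))"
    have "(\<Sum>N\<in>natpermute k m. a (N ! i)) = (\<Sum>N\<in>natpermute k (p + 1). \<Prod>j\<in>{0..p}. F j $ (N ! j))"
    proof (intro sum.cong)
      fix N :: "nat list"
      have "(\<Prod>j\<in>{0..p}. F j $ (N ! j)) = (\<Prod>j\<in>{0..p}. if j = i then a (N ! j) else 1)"
        by (intro prod.cong) (auto simp: F_def)
      then show "a (N ! i) = (\<Prod>j\<in>{0..p}. F j $ (N ! j))" using i p by (simp add: less_Suc_eq_le)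
    qed (simp add: p)
    also have "... = (\<Prod>j\<in>{0..p}. F j) $ k" by (rule fps_prod_nth[symmetric])
    also have "(\<Prod>j\<in>{0..p}. F j) = F i * (\<Prod>j\<in>{..<m} - {i}. F j)"
      unfolding set using i by (intro prod.remove) auto
    also have "(\<Prod>j\<in>{..<m} - {i}. F j) = (\<Prod>j\<in>{..<m} - {i}. Abs_fps (\<lambda>_. 1))"
      by (intro prod.cong) (auto simp: F_def)
    also have "... = Abs_fps (\<lambda>_. 1) ^ (m - 1)" using i by simp
    finally show ?thesis by (simp add: F_def)
  qed
  then show ?thesis by (subst sum.swap) simp
qed

text \<open>The size vectors of the m subtrees once m - 1 keys stay in the root. For n \<ge> m - 1
  there are n choose (m - 1) of them, which is the denominator used throughout.\<close>

abbreviation splits :: "nat \<Rightarrow> nat \<Rightarrow> nat list set" where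
  "splits m n \<equiv> natpermute (n - (m - 1)) m"

text \<open>The initial condition \<open>a n = b n\<close> makes \<open>a - b\<close> vanish to order \<open>m - 1\<close>, so that no homogeneous
  solution has to be identified.\<close>

definition split_rec :: "nat \<Rightarrow> (nat \<Rightarrow> 'a::real_normed_field) \<Rightarrow> (nat \<Rightarrow> 'a) \<Rightarrow> bool" where
  "split_rec m a b \<longleftrightarrow> (\<forall>n<m - 1. a n = b n) \<and>
    (\<forall>n\<ge>m - 1. a n = b n + (\<Sum>N\<in>splits m n. \<Sum>j<m. a (N ! j)) / of_nat (n choose (m - 1)))"

text \<open>The m - 1 derivatives reproduce the factor n choose (m - 1), and the powers of 1 - z
  cancel the geometric series. Working with a - b instead of a leaves the plain inhomogeneity m! b,
  with no operator applied to b.\<close>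

lemma split_rec_indicial:
  fixes a b :: "nat \<Rightarrow> complex"
  assumes m: "m \<ge> 3" and rec: "split_rec m a b"
  defines "R \<equiv> Abs_fps (\<lambda>n. a n - b n)"
  shows "theta_poly (indicial m) R = fps_const (fact m) * Abs_fps b" "\<And>j. j < m - 1 \<Longrightarrow> R $ j = 0"
proof -
  define E where "E = (Abs_fps (\<lambda>_. 1) :: complex fps)"
  have E: "(1 - fps_X) * E = 1"
    unfolding E_def by (rule fps_ext) (auto simp: left_diff_distrib)
  have "(fps_deriv ^^ (m - 1)) R = fps_const (fact m) * (Abs_fps a * E ^ (m - 1))"
  proof (rule fps_ext)
    fix n
    have ch: "of_nat ((n + (m - 1)) choose (m - 1)) \<noteq> (0 :: complex)" by simp
    have "(fps_deriv ^^ (m - 1)) R $ n = fact (m - 1) * (of_nat ((n + (m - 1)) choose (m - 1)) *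
       (a (n + (m - 1)) - b (n + (m - 1))))"
      by (simp add: fps_deriv_funpow_nth R_def mult.assoc)
    also have "of_nat ((n + (m - 1)) choose (m - 1)) * (a (n + (m - 1)) - b (n + (m - 1))) =
        (\<Sum>N\<in>natpermute n m. \<Sum>j<m. a (N ! j))"
      using rec ch unfolding split_rec_def by (simp del: of_nat_eq_0_iff)
    also have "... = of_nat m * (Abs_fps a * E ^ (m - 1)) $ n"
      unfolding E_def using m by (intro natpermute_sum_marginal) auto
    also have "fact (m - 1) * ... = fact m * (Abs_fps a * E ^ (m - 1)) $ n"
      using m fact_reduce[of m, where 'a = complex] by (simp add: mult_ac)
    finally show "(fps_deriv ^^ (m - 1)) R $ n = (fps_const (fact m) * (Abs_fps a * E ^ (m - 1))) $ n"
      by simp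
  qed
  then have "(1 - fps_X) ^ (m - 1) * (fps_deriv ^^ (m - 1)) R =
      fps_const (fact m) * Abs_fps a * ((1 - fps_X) * E) ^ (m - 1)"
    by (simp add: power_mult_distrib mult_ac)
  then have "theta_poly (indicial m) R = fps_const (fact m) * Abs_fps a - fps_const (fact m) * R"
    unfolding indicial_def theta_poly_diff theta_poly_rising theta_poly_const E by simp
  also have "... = fps_const (fact m) * Abs_fps b"
    by (rule fps_ext) (simp add: R_def algebra_simps)
  finally show "theta_poly (indicial m) R = fps_const (fact m) * Abs_fps b" .
  show "R $ j = 0" if "j < m - 1" for j
    using that rec by (simp add: R_def split_rec_def)
qed

text \<open>Exponents above the growth Re l - 1 of every homogeneous solution except the linear
  one.\<close>

definition rate :: "nat \<Rightarrow> real \<Rightarrow> bool" where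
  "rate m g \<longleftrightarrow> 0 < g \<and> (\<forall>l. (\<Prod>j<m - 1. l + of_nat j) = fact m \<longrightarrow> l \<noteq> 2 \<longrightarrow> Re l - 1 < g)"

text \<open>For g > 1 the root 2 is dominated as well, so all linear factors are inverted in the
  same way and no leading constant has to be extracted.\<close>

lemma split_rec_bound_complex:
  fixes a b :: "nat \<Rightarrow> complex"
  assumes m: "m \<ge> 3" and rec: "split_rec m a b" and g: "rate m g" "1 < g"
    and b: "\<And>n. cmod (b n) \<le> K * (real n + 1) powr g"
  shows "\<exists>K'. \<forall>n. cmod (a n) \<le> K' * (real n + 1) powr g"
proof -
  define R where "R = Abs_fps (\<lambda>n. a n - b n)"
  obtain ls where ls: "indicial m = [:-2, 1:] * (\<Prod>l\<leftarrow>ls. [:-l, 1:])"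
    "\<And>l. l \<in> set ls \<Longrightarrow> l \<noteq> 2 \<and> (\<Prod>j<m - 1. l + of_nat j) = fact m"
    using indicial_factor[OF m] by metis
  have "\<exists>K'. \<forall>n. cmod (R $ n) \<le> K' * (real n + 1) powr g"
  proof (rule theta_poly_roots_bound)
    show "Re l - 1 < g" if "l \<in> set (2 # ls)" for l
      using that ls(2) g unfolding rate_def by auto
    show "cmod (theta_poly (\<Prod>l\<leftarrow>2 # ls. [:-l, 1:]) R $ n) \<le> (fact m * K) * (real n + 1) powr g" for n
    proof -
      have "theta_poly (\<Prod>l\<leftarrow>2 # ls. [:-l, 1:]) R = fps_const (fact m) * Abs_fps b"
        using split_rec_indicial(1)[OF m rec] ls(1) unfolding R_def by simp
      then show ?thesis using mult_left_mono[OF b[of n], of "fact m"]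
        by (simp add: norm_mult norm_fact mult_ac)
    qed
  qed (use g in simp)
  then obtain K' where K': "\<And>n. cmod (a n - b n) \<le> K' * (real n + 1) powr g" by (auto simp: R_def)
  have "cmod (a n) \<le> (K' + K) * (real n + 1) powr g" for n
    using K'[of n] b[of n] norm_triangle_ineq[of "a n - b n" "b n"] by (simp add: distrib_right)
  then show ?thesis by blast
qed

text \<open>For g < 1 the root 2 dominates. Its factor is solved first and yields a slope L; since
  the cofactor multiplies (1 - z)^(-2) by its value m! (H_m - 1) at 2, dividing by this value, with
  m! cancelling against the inhomogeneity m! b, gives the coefficient c.\<close>

lemma split_rec_linear_complex:
  fixes a b :: "nat \<Rightarrow> complex"
  assumes m: "m \<ge> 3" and rec: "split_rec m a b" and g: "rate m g" "g < 1"
    and b: "\<And>n. cmod (b n) \<le> K * (real n + 1) powr g"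
  defines "c \<equiv> (\<Sum>n. b n / of_nat ((n + 1) * (n + 2))) / (harm m - 1)"
  shows "summable (\<lambda>n. b n / of_nat ((n + 1) * (n + 2)))"
    and "\<exists>K'. \<forall>n. cmod (a n - c * of_nat n) \<le> K' * (real n + 1) powr g"
proof -
  have g0: "0 < g" using g by (simp add: rate_def)
  define R where "R = Abs_fps (\<lambda>n. a n - b n)"
  note R = split_rec_indicial[OF m rec, folded R_def]
  obtain ls where ls: "indicial m = [:-2, 1:] * (\<Prod>l\<leftarrow>ls. [:-l, 1:])" "length ls = m - 2"
    "\<And>l. l \<in> set ls \<Longrightarrow> l \<noteq> 2 \<and> (\<Prod>j<m - 1. l + of_nat j) = fact m"
    "poly (\<Prod>l\<leftarrow>ls. [:-l, 1:]) 2 = fact m * (harm m - 1)"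
    using indicial_factor[OF m] by metis
  define P where "P = (\<Prod>l\<leftarrow>ls. [:-l, 1:])"
  define Y where "Y = theta_poly P R"
  have "degree P \<le> length ls" unfolding P_def
  proof (induction ls)
    case (Cons l ls)
    then show ?case
      using degree_mult_le[of "[:-l, 1:]" "\<Prod>l\<leftarrow>ls. [:-l, 1:]"] by (simp del: mult_pCons_left)
  qed simp
  \<comment> \<open>P has degree at most m - 2, so this coefficient involves only coefficients of R
    below m - 1, all of which vanish.\<close>
  then have Y0: "Y $ 0 = 0"
    unfolding Y_def using m ls(2) by (intro theta_poly_nth_zero[where k = "m - 1"] R(2)) auto
  define z where "z = (\<lambda>n. fact m * b n)"
  have "theta Y - fps_const 2 * Y = fps_const (fact m) * Abs_fps b"
    using R(1) unfolding ls(1) P_def[symmetric] theta_poly_linear_mult Y_def by (simp flip: fps_const_neg)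
  then have "(theta Y - fps_const 2 * Y) $ n = z n" for n
    by (simp add: z_def)
  then have rec2: "of_nat (n + 1) * Y $ (n + 1) = (of_nat n + 2) * Y $ n + z n" for n
    by (simp add: theta_nth algebra_simps)
  have zb: "cmod (z n) \<le> (fact m * K) * (real n + 1) powr g" for n
    using mult_left_mono[OF b[of n], of "fact m"] by (simp add: z_def norm_mult norm_fact mult_ac)
  note lim = second_order_limit[of "\<lambda>n. Y $ n", OF rec2 Y0 zb g0 g(2)]
  have sm: "summable (\<lambda>n. fact m * (b n / of_nat ((n + 1) * (n + 2))))"
    using lim(1) by (simp add: z_def)
  then show sb: "summable (\<lambda>n. b n / of_nat ((n + 1) * (n + 2)))"
    using summable_mult_D[OF sm] by simp
  define L where "L = (\<Sum>n. z n / of_nat ((n + 1) * (n + 2)))"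
  have "complex_of_real (harm m) \<noteq> of_real 1"
    unfolding of_real_eq_iff using harm_gt_1[of m] m by simp
  then have h1: "harm m - 1 \<noteq> (0 :: complex)" by (simp add: of_real_harm)
  have "L = fact m * (\<Sum>n. b n / of_nat ((n + 1) * (n + 2)))"
    unfolding L_def z_def using suminf_mult[OF sb, of "fact m"] by simp
  then have Lc: "L = c * poly P 2"
    unfolding c_def P_def ls(4) using h1 by simp
  obtain K1 where K1: "\<And>n. cmod (Y $ n - L * of_nat (n + 1)) \<le> K1 * (real n + 1) powr g"
    using lim(2) unfolding L_def by blast
  \<comment> \<open>Removing the linear part of R first makes P(theta) U small, and the remaining
    roots all lie in the range where \<open>theta_poly_roots_bound\<close> applies.\<close>
  define U where "U = R - fps_const c * linear_fps"
  have "theta_poly P U = Y - fps_const L * linear_fps"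
    unfolding U_def theta_poly_arg_diff theta_poly_arg_const theta_poly_linear_fps Lc Y_def by (simp add: mult.assoc)
  then have "cmod (theta_poly P U $ n) \<le> K1 * (real n + 1) powr g" for n
    using K1[of n] by (simp add: linear_fps_def)
  then have "\<exists>K'. \<forall>n. cmod (U $ n) \<le> K' * (real n + 1) powr g"
    unfolding P_def using ls(3) g unfolding rate_def by (intro theta_poly_roots_bound) auto
  then obtain K2 where K2: "\<And>n. cmod (a n - b n - c * of_nat (n + 1)) \<le> K2 * (real n + 1) powr g"
    by (auto simp: U_def R_def linear_fps_def)
  have "cmod (a n - c * of_nat n) \<le> (K2 + K + cmod c) * (real n + 1) powr g" for n
  proof -
    have "1 \<le> (real n + 1) powr g" using g0 by (intro ge_one_powr_ge_zero) auto
    then have 1: "cmod c * 1 \<le> cmod c * (real n + 1) powr g" by (intro mult_left_mono) auto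
    have "a n - c * of_nat n = (a n - b n - c * of_nat (n + 1)) + (b n + c)" by (simp add: algebra_simps)
    then have "cmod (a n - c * of_nat n) \<le> cmod (a n - b n - c * of_nat (n + 1)) + (cmod (b n) + cmod c)"
      by (metis norm_triangle_ineq norm_triangle_le add_left_mono order_trans)
    then show ?thesis using K2[of n] b[of n] 1 by (simp add: distrib_right)
  qed
  then show "\<exists>K'. \<forall>n. cmod (a n - c * of_nat n) \<le> K' * (real n + 1) powr g" by blast
qed

lemma rate_mono: "rate m g \<Longrightarrow> g \<le> g' \<Longrightarrow> rate m g'"
  by (fastforce simp: rate_def)

text \<open>There are finitely many roots, so the strict bound Re l < 3/2 leaves a gap below
  3/2.\<close>

lemma rate_exists:
  assumes m: "3 \<le> m" "m \<le> 26"
  obtains \<alpha> where "1 / 3 < \<alpha>" "\<alpha> < 1 / 2" "rate m \<alpha>"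
proof -
  define S where "S = {l :: complex. (\<Prod>j<m - 1. l + of_nat j) = fact m \<and> l \<noteq> 2}"
  have "indicial m \<noteq> 0" using indicial_degree[of m] m by auto
  then have "finite {l. poly (indicial m) l = 0}" by (rule poly_roots_finite)
  then have fin: "finite S" unfolding S_def by (rule rev_finite_subset) (auto simp: poly_indicial)
  \<comment> \<open>The entry 4/3 forces M - 1 \<ge> 1/3 and hence \<alpha> > 1/3, whatever the
    roots are.\<close>
  define M where "M = Max (insert (4 / 3) (Re ` S))"
  have fin': "finite (insert (4 / 3) (Re ` S))" using fin by simp
  have M: "4 / 3 \<le> M" "\<And>l. l \<in> S \<Longrightarrow> Re l \<le> M"
    unfolding M_def by (rule Max_ge[OF fin']; simp)+
  have "M \<in> insert (4 / 3) (Re ` S)" unfolding M_def using fin by (intro Max_in) auto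
  moreover have "Re l < 3 / 2" if "l \<in> S" for l
    using that indicial_root[OF m, of l] unfolding S_def by force
  ultimately have "M < 3 / 2" by auto
  define \<alpha> where "\<alpha> = ((M - 1) + 1 / 2) / 2"
  have 1: "1 / 3 < \<alpha>" "\<alpha> < 1 / 2" "M - 1 < \<alpha>" using M(1) \<open>M < 3 / 2\<close> by (auto simp: \<alpha>_def)
  moreover have "rate m \<alpha>" unfolding rate_def
  proof (intro conjI allI impI)
    fix l :: complex assume "(\<Prod>j<m - 1. l + of_nat j) = fact m" "l \<noteq> 2"
    then show "Re l - 1 < \<alpha>" using M(2)[of l] 1 by (simp add: S_def)
  qed (use 1 in auto)
  ultimately show ?thesis using that by blast
qed

lemma split_rec_of_real:
  "split_rec m a b \<Longrightarrow> split_rec m (\<lambda>n. complex_of_real (a n)) (\<lambda>n. complex_of_real (b n))"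
  unfolding split_rec_def by simp

lemma split_rec_bound:
  fixes a b :: "nat \<Rightarrow> real"
  assumes m: "m \<ge> 3" and rec: "split_rec m a b" and g: "rate m g" "1 < g"
    and b: "\<And>n. \<bar>b n\<bar> \<le> K * (real n + 1) powr g"
  shows "\<exists>K'. \<forall>n. \<bar>a n\<bar> \<le> K' * (real n + 1) powr g"
  using split_rec_bound_complex[OF m split_rec_of_real[OF rec] g, of K] b by simp

lemma split_rec_linear:
  fixes a b :: "nat \<Rightarrow> real"
  assumes m: "m \<ge> 3" and rec: "split_rec m a b" and g: "rate m g" "g < 1"
    and b: "\<And>n. \<bar>b n\<bar> \<le> K * (real n + 1) powr g"
  defines "c \<equiv> (\<Sum>n. b n / real ((n + 1) * (n + 2))) / (harm m - 1)"
  shows "\<exists>K'. \<forall>n. \<bar>a n - c * real n\<bar> \<le> K' * (real n + 1) powr g"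
proof -
  have b': "cmod (complex_of_real (b n)) \<le> K * (real n + 1) powr g" for n using b by simp
  note lim = split_rec_linear_complex[OF m split_rec_of_real[OF rec] g b']
  have eq: "(\<lambda>n. complex_of_real (b n) / of_nat ((n + 1) * (n + 2))) =
      (\<lambda>n. complex_of_real (b n / real ((n + 1) * (n + 2))))" by simp
  have "summable (\<lambda>n. complex_of_real (b n / real ((n + 1) * (n + 2))))"
    using lim(1) unfolding eq .
  then have "summable (\<lambda>n. Re (complex_of_real (b n / real ((n + 1) * (n + 2)))))"
    by (rule summable_Re)
  then have "summable (\<lambda>n. b n / real ((n + 1) * (n + 2)))" by simp
  then have "(\<Sum>n. complex_of_real (b n / real ((n + 1) * (n + 2)))) =
      complex_of_real (\<Sum>n. b n / real ((n + 1) * (n + 2)))"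
    by (intro suminf_of_real[symmetric])
  then have c: "(\<Sum>n. complex_of_real (b n) / of_nat ((n + 1) * (n + 2))) / (harm m - 1) = complex_of_real c"
    unfolding eq c_def by (simp add: of_real_harm)
  have "\<bar>a n - c * real n\<bar> = cmod (complex_of_real (a n) - complex_of_real c * of_nat n)" for n
    by (metis norm_of_real of_real_diff of_real_mult of_real_of_nat_eq)
  then show ?thesis using lim(2) unfolding c by simp
qed

lemma natpermute_nth_le: "N \<in> natpermute k m \<Longrightarrow> j < m \<Longrightarrow> N ! j \<le> k"
  using elem_le_sum_list[of j N] by (auto simp: natpermute_def)

text \<open>An exact solution for a given b, wanted as a majorant because the error of the
  characteristic function obeys only an inequality. The guard \<open>m < 2\<close> secures
  termination: for m = 1 a subtree could be as large as the whole tree.\<close>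

function split_sol :: "nat \<Rightarrow> (nat \<Rightarrow> real) \<Rightarrow> nat \<Rightarrow> real" where
  "split_sol m b n = (if m < 2 \<or> n < m - 1 then b n else
    b n + (\<Sum>N\<in>splits m n. \<Sum>j<m. split_sol m b (N ! j)) / real (n choose (m - 1)))"
  by auto
termination
  by (relation "Wellfounded.measure (\<lambda>(m, b, n). n)") (fastforce dest: natpermute_nth_le)+

declare split_sol.simps [simp del]

lemma split_rec_split_sol: "m \<ge> 2 \<Longrightarrow> split_rec m (split_sol m b) b"
  unfolding split_rec_def by (auto simp: split_sol.simps[of m b])

section \<open>Splitting a random permutation at the root\<close>

text \<open>Expectation over a uniform permutation of S, as a finite sum in an arbitrary field of
  characteristic 0, so that real moments and complex characteristic functions share the same
  identities.\<close>

definition avg :: "nat set \<Rightarrow> (nat list \<Rightarrow> 'a::field_char_0) \<Rightarrow> 'a" where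
  "avg S F = (\<Sum>xs\<in>permutations_of_set S. F xs) / fact (card S)"

lemma avg_cong: "(\<And>xs. set xs = S \<Longrightarrow> distinct xs \<Longrightarrow> F xs = G xs) \<Longrightarrow> avg S F = avg S G"
  unfolding avg_def by (intro arg_cong2[of _ _ _ _ "(/)"] sum.cong) (auto simp: permutations_of_set_def)

text \<open>Restricting a permutation to A and to B has the shuffles of the two restrictions as
  fibres, all of the same size. This is the source of independence: restrictions of a uniform
  permutation to disjoint sets are independent and uniform.\<close>

lemma sum_permutations_Un:
  fixes F G :: "nat list \<Rightarrow> 'a::field_char_0"
  assumes "finite A" "finite B" "A \<inter> B = {}"
  shows "(\<Sum>xs\<in>permutations_of_set (A \<union> B). F (filter (\<lambda>x. x \<in> A) xs) * G (filter (\<lambda>x. x \<in> B) xs)) =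
    of_nat ((card A + card B) choose card A) *
    ((\<Sum>ys\<in>permutations_of_set A. F ys) * (\<Sum>zs\<in>permutations_of_set B. G zs))"
proof -
  define g where "g = (\<lambda>xs. (filter (\<lambda>x. x \<in> A) xs, filter (\<lambda>x. x \<in> B) xs))"
  define P where "P = permutations_of_set (A \<union> B)"
  define Q where "Q = permutations_of_set A \<times> permutations_of_set B"
  have fib: "{xs \<in> P. g xs = q} = shuffles (fst q) (snd q)" if "q \<in> Q" for q
  proof -
    obtain ys zs where q: "q = (ys, zs)" by force
    have yz: "set ys = A" "distinct ys" "set zs = B" "distinct zs"
      using that by (auto simp: q Q_def permutations_of_set_def)
    have pt: "partition (\<lambda>x. x \<in> A) -` {(ys, zs)} = shuffles ys zs"
      by (rule inv_image_partition) (use yz assms in auto)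
    have "xs \<in> P \<and> g xs = q \<longleftrightarrow> xs \<in> shuffles ys zs" for xs
    proof
      assume "xs \<in> P \<and> g xs = q"
      then have xs: "set xs = A \<union> B" "filter (\<lambda>x. x \<in> A) xs = ys" "filter (\<lambda>x. x \<in> B) xs = zs"
        by (auto simp: P_def permutations_of_set_def g_def q)
      have "filter (\<lambda>x. x \<notin> A) xs = filter (\<lambda>x. x \<in> B) xs"
        by (rule filter_cong) (use xs(1) assms in auto)
      then have "partition (\<lambda>x. x \<in> A) xs = (ys, zs)" using xs by (simp add: o_def)
      then show "xs \<in> shuffles ys zs" using pt by blast
    next
      assume s: "xs \<in> shuffles ys zs"
      then have "partition (\<lambda>x. x \<in> A) xs = (ys, zs)" using pt by blast
      then have f: "filter (\<lambda>x. x \<in> A) xs = ys" "filter (\<lambda>x. x \<notin> A) xs = zs" by (auto simp: o_def)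
      have set: "set xs = A \<union> B" using set_shuffles[OF s] yz by simp
      have "distinct xs" using distinct_disjoint_shuffles[OF yz(2,4) _ s] yz assms by simp
      moreover have "filter (\<lambda>x. x \<notin> A) xs = filter (\<lambda>x. x \<in> B) xs"
        by (rule filter_cong) (use set assms in auto)
      ultimately show "xs \<in> P \<and> g xs = q" using set f by (auto simp: P_def g_def q)
    qed
    then show ?thesis by (auto simp: q)
  qed
  have card: "card (shuffles (fst q) (snd q)) = (card A + card B) choose card A" if "q \<in> Q" for q
    using that assms by (subst card_disjoint_shuffles)
      (auto simp: Q_def permutations_of_set_def distinct_card)
  have "(\<Sum>xs\<in>P. F (filter (\<lambda>x. x \<in> A) xs) * G (filter (\<lambda>x. x \<in> B) xs)) =
      (\<Sum>xs\<in>P. F (fst (g xs)) * G (snd (g xs)))" by (simp add: g_def)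
  also have "... = (\<Sum>q\<in>Q. \<Sum>xs\<in>{xs \<in> P. g xs = q}. F (fst (g xs)) * G (snd (g xs)))"
  proof (rule sum.group[symmetric])
    show "finite P" "finite Q" by (simp_all add: P_def Q_def)
    show "g ` P \<subseteq> Q" by (auto simp: P_def Q_def g_def permutations_of_set_def)
  qed
  also have "... = (\<Sum>q\<in>Q. of_nat ((card A + card B) choose card A) * (F (fst q) * G (snd q)))"
  proof (intro sum.cong refl)
    fix q assume q: "q \<in> Q"
    have "(\<Sum>xs\<in>{xs \<in> P. g xs = q}. F (fst (g xs)) * G (snd (g xs))) =
        (\<Sum>xs\<in>{xs \<in> P. g xs = q}. F (fst q) * G (snd q))" by (intro sum.cong) auto
    then show "(\<Sum>xs\<in>{xs \<in> P. g xs = q}. F (fst (g xs)) * G (snd (g xs))) =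
        of_nat ((card A + card B) choose card A) * (F (fst q) * G (snd q))"
      unfolding fib[OF q] using card[OF q] by simp
  qed
  also have "... = of_nat ((card A + card B) choose card A) *
      ((\<Sum>ys\<in>permutations_of_set A. F ys) * (\<Sum>zs\<in>permutations_of_set B. G zs))"
  proof -
    have "(\<Sum>q\<in>Q. F (fst q) * G (snd q)) =
        (\<Sum>ys\<in>permutations_of_set A. F ys) * (\<Sum>zs\<in>permutations_of_set B. G zs)"
      unfolding Q_def sum_product sum.cartesian_product by (simp add: case_prod_beta)
    then show ?thesis by (simp add: sum_distrib_left[symmetric])
  qed
  finally show ?thesis unfolding P_def .
qed

lemma avg_Un:
  assumes "finite A" "finite B" "A \<inter> B = {}"
  shows "avg (A \<union> B) (\<lambda>xs. F (filter (\<lambda>x. x \<in> A) xs) * G (filter (\<lambda>x. x \<in> B) xs)) = avg A F * avg B G"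
proof -
  have "fact (card A) * fact (card B) * ((card A + card B) choose card A) = fact (card A + card B)"
    using binomial_fact_lemma[of "card A" "card A + card B"] by simp
  then have "of_nat (fact (card A) * fact (card B) * ((card A + card B) choose card A)) =
      (of_nat (fact (card A + card B)) :: 'a)" by (simp only:)
  then have "fact (card A) * fact (card B) * of_nat ((card A + card B) choose card A) =
      (fact (card A + card B) :: 'a)" by simp
  then show ?thesis
    unfolding avg_def sum_permutations_Un[OF assms] card_Un_disjoint[OF assms]
    by (simp add: divide_simps) (simp add: mult_ac)
qed

text \<open>Here \<open>gap_index\<close> is a variable standing for an arbitrary labelling of S by
  labels below k; the constant of that name is introduced only later. Induction on k splits off the
  class with the largest label.\<close>

lemma avg_blocks:
  fixes k :: nat
  assumes "finite S" "\<And>x. x \<in> S \<Longrightarrow> gap_index x < k"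
  shows "avg S (\<lambda>xs. \<Prod>j<k. G j (filter (\<lambda>x. gap_index x = j) xs)) = (\<Prod>j<k. avg {x\<in>S. gap_index x = j} (G j))"
  using assms
proof (induction k arbitrary: S)
  case 0
  then have "S = {}" by auto
  then show ?case by (simp add: avg_def)
next
  case (Suc k)
  define A where "A = {x\<in>S. gap_index x < k}"
  define B where "B = {x\<in>S. gap_index x = k}"
  have AB: "S = A \<union> B" "A \<inter> B = {}" "finite A" "finite B"
    using Suc.prems by (auto simp: A_def B_def less_Suc_eq)
  have "avg S (\<lambda>xs. \<Prod>j<Suc k. G j (filter (\<lambda>x. gap_index x = j) xs)) =
      avg S (\<lambda>xs. (\<Prod>j<k. G j (filter (\<lambda>x. gap_index x = j) (filter (\<lambda>x. x \<in> A) xs))) *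
        G k (filter (\<lambda>x. x \<in> B) xs))"
  proof (rule avg_cong)
    fix xs assume xs: "set xs = S" "distinct xs"
    have "filter (\<lambda>x. gap_index x = j) xs = filter (\<lambda>x. gap_index x = j) (filter (\<lambda>x. x \<in> A) xs)" if "j < k" for j
      unfolding filter_filter by (rule filter_cong) (use xs that in \<open>auto simp: A_def\<close>)
    moreover have "filter (\<lambda>x. gap_index x = k) xs = filter (\<lambda>x. x \<in> B) xs"
      by (rule filter_cong) (use xs in \<open>auto simp: B_def\<close>)
    ultimately show "(\<Prod>j<Suc k. G j (filter (\<lambda>x. gap_index x = j) xs)) =
      (\<Prod>j<k. G j (filter (\<lambda>x. gap_index x = j) (filter (\<lambda>x. x \<in> A) xs))) * G k (filter (\<lambda>x. x \<in> B) xs)"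
      by simp
  qed
  moreover have "... = avg A (\<lambda>xs. \<Prod>j<k. G j (filter (\<lambda>x. gap_index x = j) xs)) * avg B (G k)"
    unfolding AB(1)
    using avg_Un[OF AB(3,4,2), of "\<lambda>xs. \<Prod>j<k. G j (filter (\<lambda>x. gap_index x = j) xs)" "G k"] .
  moreover have "avg A (\<lambda>xs. \<Prod>j<k. G j (filter (\<lambda>x. gap_index x = j) xs)) =
      (\<Prod>j<k. avg {x\<in>A. gap_index x = j} (G j))"
  proof (rule Suc.IH)
    show "finite A" by (rule AB(3))
    show "gap_index x < k" if "x \<in> A" for x using that by (simp add: A_def)
  qed
  moreover have "... = (\<Prod>j<k. avg {x\<in>S. gap_index x = j} (G j))"
    by (intro prod.cong refl arg_cong2[of _ _ _ _ avg]) (auto simp: A_def)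
  ultimately show ?case by (simp add: B_def)
qed

lemma sum_permutations_prefix:
  assumes "finite S" "r \<le> card S"
  shows "(\<Sum>xs\<in>permutations_of_set S. F xs) =
    (\<Sum>R | R \<subseteq> S \<and> card R = r. \<Sum>ys\<in>permutations_of_set R. \<Sum>zs\<in>permutations_of_set (S - R). F (ys @ zs))"
proof -
  define I where "I = {R. R \<subseteq> S \<and> card R = r}"
  have fI: "finite I" unfolding I_def using assms by simp
  have "(\<Sum>R\<in>I. \<Sum>ys\<in>permutations_of_set R. \<Sum>zs\<in>permutations_of_set (S - R). F (ys @ zs)) =
      (\<Sum>(R, ys, zs)\<in>(SIGMA R:I. permutations_of_set R \<times> permutations_of_set (S - R)). F (ys @ zs))"
    using fI by (simp add: sum.cartesian_product sum.Sigma)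
  also have "... = (\<Sum>xs\<in>permutations_of_set S. F xs)"
  proof (rule sum.reindex_bij_witness[where i = "\<lambda>xs. (set (take r xs), take r xs, drop r xs)"
        and j = "\<lambda>(R, ys, zs). ys @ zs"])
    fix xs assume "xs \<in> permutations_of_set S"
    then have xs: "set xs = S" "distinct xs" by (auto simp: permutations_of_set_def)
    then have len: "length xs = card S" using distinct_card by metis
    have un: "set (take r xs) \<union> set (drop r xs) = S" using xs by (metis append_take_drop_id set_append)
    have dj: "set (take r xs) \<inter> set (drop r xs) = {}" using xs(2) by (intro set_take_disj_set_drop_if_distinct) auto
    have "card (set (take r xs)) = r" using xs len assms by (subst distinct_card) auto
    then show "(set (take r xs), take r xs, drop r xs) \<in>
        (SIGMA R:I. permutations_of_set R \<times> permutations_of_set (S - R))"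
      using un dj xs by (auto simp: I_def permutations_of_set_def)
  next
    fix a assume "a \<in> (SIGMA R:I. permutations_of_set R \<times> permutations_of_set (S - R))"
    then obtain R ys zs where a: "a = (R, ys, zs)" and 1: "R \<subseteq> S" "card R = r"
      "set ys = R" "distinct ys" "set zs = S - R" "distinct zs"
      by (auto simp: I_def permutations_of_set_def)
    then have "length ys = r" using distinct_card by metis
    then show "(\<lambda>xs. (set (take r xs), take r xs, drop r xs)) (case a of (R, ys, zs) \<Rightarrow> ys @ zs) = a"
      using 1 by (simp add: a)
    show "(case a of (R, ys, zs) \<Rightarrow> ys @ zs) \<in> permutations_of_set S"
      using 1 by (auto simp: a permutations_of_set_def)
    show "F (case a of (R, ys, zs) \<Rightarrow> ys @ zs) = (case a of (R, ys, zs) \<Rightarrow> F (ys @ zs))"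
      by (simp add: a)
  qed auto
  finally show ?thesis unfolding I_def by simp
qed

text \<open>For R the keys of the root and x another key, this is the index, counted from 0, of the
  subtree that x enters.\<close>

definition gap_index :: "nat set \<Rightarrow> nat \<Rightarrow> nat" where
  "gap_index R x = card {r\<in>R. r < x}"

section \<open>Insertion below a full root\<close>

abbreviation foldins :: "nat \<Rightarrow> mtree \<Rightarrow> nat list \<Rightarrow> mtree" where
  "foldins m \<equiv> foldl (\<lambda>t x. ins m x t)"

lemma foldins_fill:
  "length ks + length ys \<le> m - 1 \<Longrightarrow>
    \<exists>ks'. foldins m (Node ks c) ys = Node ks' c \<and> mset ks' = mset (ks @ ys)"
proof (induction ys arbitrary: ks)
  case (Cons y ys)
  obtain ks' where "foldins m (Node (insort y ks) c) ys = Node ks' c" "mset ks' = mset (insort y ks @ ys)"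
    using Cons.IH[of "insort y ks"] Cons.prems by auto
  then show ?case using Cons.prems by (auto simp: Let_def)
qed auto

lemma build_small:
  assumes "ys \<noteq> []" "length ys \<le> m - 1"
  shows "\<exists>ks. build m ys = Node ks (\<lambda>_. Empty) \<and> mset ks = mset ys"
proof -
  obtain y ys' where y: "ys = y # ys'" using assms by (cases ys) auto
  show ?thesis using foldins_fill[of "[y]" ys' m "\<lambda>_. Empty"] assms(2)
    by (auto simp: y build_def)
qed

text \<open>A full root only routes keys, so each child evolves alone on the subsequence sent to it.
  The children c are arbitrary because the induction on the list changes them.\<close>

lemma foldins_full:
  assumes "length ks \<ge> m - 1"
  shows "foldins m (Node ks c) zs =
    Node ks (\<lambda>i. foldins m (c i) (filter (\<lambda>z. length (filter (\<lambda>k. k < z) ks) = i) zs))"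
proof (induction zs arbitrary: c)
  case (Cons z zs)
  show ?case using assms by (auto simp: Let_def Cons.IH fun_eq_iff)
qed simp

lemma build_append:
  assumes "distinct (ys @ zs)" "length ys = m - 1" "m \<ge> 2"
  shows "\<exists>ks. build m (ys @ zs) = Node ks (\<lambda>i. build m (filter (\<lambda>z. gap_index (set ys) z = i) zs))"
proof -
  obtain ks where ks: "build m ys = Node ks (\<lambda>_. Empty)" "mset ks = mset ys"
    using build_small[of ys m] assms by fastforce
  have dk: "distinct ks" "set ks = set ys" "length ks = m - 1"
    using mset_eq_imp_distinct_iff[OF ks(2)] mset_eq_setD[OF ks(2)] mset_eq_length[OF ks(2)] assms
    by simp_all
  have c: "length (filter (\<lambda>k. k < z) ks) = gap_index (set ys) z" for z
    unfolding gap_index_def using dk by (subst distinct_card[symmetric]) auto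
  have "build m (ys @ zs) = foldins m (Node ks (\<lambda>_. Empty)) zs"
    using ks(1) by (simp add: build_def)
  then show ?thesis using foldins_full[of m ks "\<lambda>_. Empty" zs] dk(3)
    by (auto simp: c build_def)
qed

lemma ins_nonempty: "ins m x t \<noteq> Empty"
  by (cases t) (auto simp: Let_def)

lemma build_Empty_iff: "build m xs = Empty \<longleftrightarrow> xs = []"
  by (cases xs rule: rev_cases) (auto simp: build_def ins_nonempty)

definition stat :: "nat \<Rightarrow> (nat \<Rightarrow> real) \<Rightarrow> nat list \<Rightarrow> real" where
  "stat m t xs = (\<Sum>k\<le>m. t k * real (deg_count m k (build m xs)))"

lemma stat_Nil [simp]: "stat m t [] = 0"
  by (simp add: stat_def build_def)

lemma stat_small:
  assumes "ys \<noteq> []" "length ys \<le> m - 1" shows "stat m t ys = t 0"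
proof -
  obtain ks where "build m ys = Node ks (\<lambda>_. Empty)" using build_small[OF assms] by auto
  then have "deg_count m k (build m ys) = (if k = 0 then 1 else 0)" for k by auto
  then have "stat m t ys = (\<Sum>k\<le>m. if k = 0 then t k else 0)"
    unfolding stat_def by (intro sum.cong) auto
  then show ?thesis by simp
qed

definition parts :: "nat \<Rightarrow> nat list \<Rightarrow> nat list list" where
  "parts m xs = map (\<lambda>j. filter (\<lambda>z. gap_index (set (take (m - 1) xs)) z = j) (drop (m - 1) xs)) [0..<m]"

definition nonzeros :: "nat \<Rightarrow> nat list \<Rightarrow> nat" where
  "nonzeros m N = card {i. i < m \<and> N ! i \<noteq> 0}"

lemma nonzeros_le: "nonzeros m N \<le> m"
  unfolding nonzeros_def by (rule order_trans[OF card_mono[of "{..<m}"]]) auto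

text \<open>The root's own contribution depends on the sizes of the subtrees alone, so that
  conditionally on these sizes it is a constant.\<close>

lemma stat_parts:
  assumes "distinct xs" "length xs \<ge> m - 1" "m \<ge> 2"
  shows "stat m t xs = t (nonzeros m (map length (parts m xs))) + (\<Sum>j<m. stat m t (parts m xs ! j))"
proof -
  define ys zs where "ys = take (m - 1) xs" and "zs = drop (m - 1) xs"
  have xs: "xs = ys @ zs" "length ys = m - 1" using assms by (auto simp: ys_def zs_def)
  have pj: "parts m xs ! j = filter (\<lambda>z. gap_index (set ys) z = j) zs" if "j < m" for j
    using that by (simp add: parts_def ys_def zs_def)
  obtain ks where b: "build m xs = Node ks (\<lambda>i. build m (filter (\<lambda>z. gap_index (set ys) z = i) zs))"
    using build_append[of ys zs m] assms unfolding xs by blast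
  have nz: "{i. i < m \<and> build m (filter (\<lambda>z. gap_index (set ys) z = i) zs) \<noteq> Empty} =
      {i. i < m \<and> map length (parts m xs) ! i \<noteq> 0}"
    unfolding build_Empty_iff using pj by (auto simp: parts_def)
  have dc: "deg_count m k (build m xs) = (if nonzeros m (map length (parts m xs)) = k then 1 else 0) +
      (\<Sum>i<m. deg_count m k (build m (parts m xs ! i)))" for k
    unfolding b deg_count.simps nz nonzeros_def[symmetric] using pj by simp
  have "stat m t xs = (\<Sum>k\<le>m. (if nonzeros m (map length (parts m xs)) = k then t k else 0) +
      (\<Sum>i<m. t k * real (deg_count m k (build m (parts m xs ! i)))))"
    unfolding stat_def dc by (intro sum.cong) (auto simp: distrib_left sum_distrib_left)
  also have "... = t (nonzeros m (map length (parts m xs))) +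
      (\<Sum>i<m. \<Sum>k\<le>m. t k * real (deg_count m k (build m (parts m xs ! i))))"
    using nonzeros_le[of m "map length (parts m xs)"]
    by (simp add: sum.distrib sum.swap[of _ "{..m}" "{..<m}"])
  finally show ?thesis by (simp add: stat_def)
qed

text \<open>The keys of a subtree form an interval of consecutive integers. Since outdegrees do not
  change under translation, such a subtree can be compared with one built on {1..k}.\<close>

primrec tree_shift :: "nat \<Rightarrow> mtree \<Rightarrow> mtree" where
  "tree_shift a Empty = Empty"
| "tree_shift a (Node ks c) = Node (map (\<lambda>x. x + a) ks) (\<lambda>i. (tree_shift a \<circ> c) i)"

lemma insort_shift: "insort (x + a) (map (\<lambda>x. x + a) ks) = map (\<lambda>x. x + a) (insort (x :: nat) ks)"
  by (induction ks) auto

lemma ins_shift: "ins m (x + a) (tree_shift a t) = tree_shift a (ins m x t)"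
proof (induction t)
  case (Node ks c)
  have f: "filter ((\<lambda>k. k < x + a) \<circ> (\<lambda>x. x + a)) ks = filter (\<lambda>k. k < x) ks"
    by (simp add: o_def)
  show ?case using Node by (auto simp: Let_def insort_shift filter_map f fun_eq_iff)
qed simp

lemma build_shift: "build m (map (\<lambda>x. x + a) xs) = tree_shift a (build m xs)"
  unfolding build_def by (induction xs rule: rev_induct) (auto simp: ins_shift)

lemma shift_Empty_iff: "tree_shift a t = Empty \<longleftrightarrow> t = Empty"
  by (cases t) auto

lemma deg_count_shift: "deg_count m k (tree_shift a t) = deg_count m k t"
  by (induction t) (auto simp: shift_Empty_iff)

lemma stat_shift: "stat m t (map (\<lambda>x. x + a) xs) = stat m t xs"
  by (simp add: stat_def build_shift deg_count_shift)

lemma avg_shift: "avg {a<..a + n} (\<lambda>xs. G (stat m t xs)) = avg {1..n} (\<lambda>xs. G (stat m t xs))"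
proof -
  have im: "{a<..a + n} = (\<lambda>x. x + a) ` {1..n}"
  proof (intro set_eqI iffI)
    fix x assume "x \<in> {a<..a + n}"
    then have "x = (x - a) + a" "x - a \<in> {1..n}" by auto
    then show "x \<in> (\<lambda>x. x + a) ` {1..n}" by blast
  qed auto
  have inj: "inj_on (\<lambda>x. x + a) {1..n}" by (auto simp: inj_on_def)
  have inj': "inj_on (map (\<lambda>x. x + a)) (permutations_of_set {1..n})"
    by (rule inj_on_subset[OF _ subset_UNIV]) (simp add: inj_on_def)
  show ?thesis unfolding avg_def im permutations_of_set_image_inj[OF inj] card_image[OF inj]
    by (subst sum.reindex[OF inj']) (simp add: stat_shift)
qed

section \<open>Gaps of the root keys and compositions\<close>

definition blocks :: "nat \<Rightarrow> nat \<Rightarrow> nat \<Rightarrow> nat set \<Rightarrow> nat set list" where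
  "blocks k a b R = map (\<lambda>j. {x\<in>{a<..b} - R. gap_index R x = j}) [0..<k]"

text \<open>The gaps reconstructed from their lengths alone; the \<open>+ 1\<close> skips the root
  key that separates two neighbouring gaps.\<close>

primrec gap_intervals :: "nat \<Rightarrow> nat list \<Rightarrow> nat set list" where
  "gap_intervals a [] = []"
| "gap_intervals a (i # N) = {a<..a + i} # gap_intervals (a + i + 1) N"

lemma natpermute_Suc: "natpermute n (Suc k) = (\<Union>i\<le>n. (#) i ` natpermute (n - i) k)"
proof (intro set_eqI iffI)
  fix N assume "N \<in> natpermute n (Suc k)"
  then show "N \<in> (\<Union>i\<le>n. (#) i ` natpermute (n - i) k)"
  proof (cases N)
    case (Cons a M)
    then have "a \<le> n" "M \<in> natpermute (n - a) k"
      using \<open>N \<in> natpermute n (Suc k)\<close> by (auto simp: natpermute_def)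
    then show ?thesis using Cons by blast
  qed (simp add: natpermute_def)
qed (auto simp: natpermute_def)

lemma sum_natpermute_Suc:
  "(\<Sum>N\<in>natpermute n (Suc k). F N) = (\<Sum>i\<le>n. \<Sum>N\<in>natpermute (n - i) k. F (i # N))"
  unfolding natpermute_Suc
  by (subst sum.UNION_disjoint) (auto simp: natpermute_finite sum.reindex)

lemma sum_subsets_Min:
  fixes a b :: nat
  shows "(\<Sum>R | R \<subseteq> {a<..b} \<and> card R = Suc k. F R) =
    (\<Sum>r\<in>{a<..b}. \<Sum>R | R \<subseteq> {r<..b} \<and> card R = k. F (insert r R))"
proof -
  define I where "I = (\<lambda>r. {R. R \<subseteq> {r<..b} \<and> card R = k})"
  have fI: "finite (I r)" for r unfolding I_def by simp
  have "(\<Sum>r\<in>{a<..b}. \<Sum>R\<in>I r. F (insert r R)) = (\<Sum>(r, R)\<in>(SIGMA r:{a<..b}. I r). F (insert r R))"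
    using fI by (simp add: sum.Sigma)
  also have "... = (\<Sum>R | R \<subseteq> {a<..b} \<and> card R = Suc k. F R)"
  proof (rule sum.reindex_bij_witness[where i = "\<lambda>R. (Min R, R - {Min R})" and j = "\<lambda>(r, R). insert r R"])
    fix R assume "R \<in> {R. R \<subseteq> {a<..b} \<and> card R = Suc k}"
    then have R: "R \<subseteq> {a<..b}" "card R = Suc k" by auto
    then have ne: "R \<noteq> {}" "finite R" using card.infinite by fastforce+
    then have mn: "Min R \<in> R" "\<And>x. x \<in> R \<Longrightarrow> Min R \<le> x" by auto
    have "R - {Min R} \<subseteq> {Min R<..b}"
    proof
      fix x assume x: "x \<in> R - {Min R}"
      then have "x \<noteq> Min R" "Min R \<le> x" using mn(2)[of x] by simp_all
      then show "x \<in> {Min R<..b}" using x R(1) by auto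
    qed
    moreover have "card (R - {Min R}) = k" using mn(1) R(2) by simp
    moreover have "Min R \<in> {a<..b}" using mn(1) R(1) by blast
    ultimately show "(Min R, R - {Min R}) \<in> (SIGMA r:{a<..b}. I r)"
      by (simp add: I_def)
    show "(\<lambda>(r, R). insert r R) (Min R, R - {Min R}) = R"
      using mn(1) by (simp add: insert_absorb)
  next
    fix p assume "p \<in> (SIGMA r:{a<..b}. I r)"
    then obtain r R where p: "p = (r, R)" "r \<in> {a<..b}" "R \<subseteq> {r<..b}" "card R = k" by (auto simp: I_def)
    have fR: "finite R" using p(3) finite_subset by blast
    have "Min (insert r R) = r" using p(3) fR by (intro Min_eqI) auto
    moreover have "r \<notin> R" using p(3) by auto
    ultimately show "(\<lambda>R. (Min R, R - {Min R})) (case p of (r, R) \<Rightarrow> insert r R) = p"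
      by (simp add: p(1))
    show "(case p of (r, R) \<Rightarrow> insert r R) \<in> {R. R \<subseteq> {a<..b} \<and> card R = Suc k}"
      using p fR \<open>r \<notin> R\<close> by auto
    show "F (case p of (r, R) \<Rightarrow> insert r R) = (case p of (r, R) \<Rightarrow> F (insert r R))"
      by (simp add: p(1))
  qed
  finally show ?thesis unfolding I_def by simp
qed

lemma blocks_insert:
  assumes "r \<in> {a<..b}" "R \<subseteq> {r<..b}"
  shows "blocks (Suc k) a b (insert r R) = {a<..<r} # blocks k r b R"
proof -
  have fR: "finite R" using assms finite_subset by blast
  have low: "gap_index (insert r R) x = 0" if "x \<le> r" for x
  proof -
    have "{y \<in> insert r R. y < x} = {}" using that assms(2) by fastforce
    then show ?thesis by (simp add: gap_index_def)
  qed
  have high: "gap_index (insert r R) x = Suc (gap_index R x)" if "x > r" for x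
  proof -
    have "{y \<in> insert r R. y < x} = insert r {y \<in> R. y < x}" using that by auto
    then have "gap_index (insert r R) x = card (insert r {y \<in> R. y < x})" by (simp only: gap_index_def)
    also have "... = Suc (card {y \<in> R. y < x})"
      using fR assms(2) by (intro card_insert_disjoint) auto
    finally show ?thesis by (simp only: gap_index_def)
  qed
  have "{x \<in> {a<..b} - insert r R. gap_index (insert r R) x = 0} = {a<..<r}"
  proof (intro set_eqI iffI)
    fix x assume "x \<in> {x \<in> {a<..b} - insert r R. gap_index (insert r R) x = 0}"
    then show "x \<in> {a<..<r}" using high[of x] by (cases "x > r") auto
  next
    fix x assume "x \<in> {a<..<r}"
    then show "x \<in> {x \<in> {a<..b} - insert r R. gap_index (insert r R) x = 0}"
      using low[of x] assms by auto
  qed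
  moreover have "{x \<in> {a<..b} - insert r R. gap_index (insert r R) x = Suc j} = {x \<in> {r<..b} - R. gap_index R x = j}" for j
  proof (intro set_eqI iffI)
    fix x assume "x \<in> {x \<in> {a<..b} - insert r R. gap_index (insert r R) x = Suc j}"
    then show "x \<in> {x \<in> {r<..b} - R. gap_index R x = j}"
      using high[of x] low[of x] by (cases "x > r") auto
  next
    fix x assume "x \<in> {x \<in> {r<..b} - R. gap_index R x = j}"
    then show "x \<in> {x \<in> {a<..b} - insert r R. gap_index (insert r R) x = Suc j}"
      using high[of x] assms by auto
  qed
  ultimately show ?thesis
    unfolding blocks_def by (simp add: upt_conv_Cons map_Suc_upt[symmetric] del: upt_Suc)
qed

text \<open>A set of k root keys is the same thing as the composition formed by its k + 1 gap
  lengths, which is why the sizes are uniform over compositions. With \<Phi> and the left end a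
  arbitrary, the induction can peel off the least key.\<close>

lemma sum_subsets_blocks:
  fixes \<Phi> :: "nat set list \<Rightarrow> 'a::comm_monoid_add"
  assumes "a \<le> b" "k \<le> b - a"
  shows "(\<Sum>R | R \<subseteq> {a<..b} \<and> card R = k. \<Phi> (blocks (Suc k) a b R)) =
    (\<Sum>N\<in>natpermute (b - a - k) (Suc k). \<Phi> (gap_intervals a N))"
  using assms
proof (induction k arbitrary: a \<Phi>)
  case 0
  have "{R. R \<subseteq> {a<..b} \<and> card R = 0} = {{}}" by (auto dest: finite_subset)
  moreover have "{x. a < x \<and> x \<le> b} = {a<..b}" by auto
  ultimately show ?case using 0 by (simp add: blocks_def gap_index_def)
next
  case (Suc k)
  have "(\<Sum>R | R \<subseteq> {a<..b} \<and> card R = Suc k. \<Phi> (blocks (Suc (Suc k)) a b R)) =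
    (\<Sum>r\<in>{a<..b}. \<Sum>R | R \<subseteq> {r<..b} \<and> card R = k. \<Phi> ({a<..<r} # blocks (Suc k) r b R))"
    unfolding sum_subsets_Min using blocks_insert by (intro sum.cong refl) auto
  \<comment> \<open>A least key above b - k leaves no room for k further keys, so these terms are
    empty sums.\<close>
  also have "... = (\<Sum>r\<in>{a<..b - k}. \<Sum>R | R \<subseteq> {r<..b} \<and> card R = k. \<Phi> ({a<..<r} # blocks (Suc k) r b R))"
  proof (rule sum.mono_neutral_right)
    show "\<forall>r\<in>{a<..b} - {a<..b - k}. (\<Sum>R | R \<subseteq> {r<..b} \<and> card R = k. \<Phi> ({a<..<r} # blocks (Suc k) r b R)) = 0"
    proof
      fix r assume r: "r \<in> {a<..b} - {a<..b - k}"
      have False if "R \<subseteq> {r<..b}" "card R = k" for R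
        using card_mono[OF _ that(1)] that(2) r by auto
      then have "{R. R \<subseteq> {r<..b} \<and> card R = k} = {}" by blast
      then show "(\<Sum>R | R \<subseteq> {r<..b} \<and> card R = k. \<Phi> ({a<..<r} # blocks (Suc k) r b R)) = 0"
        by (simp only: sum.empty)
    qed
  qed auto
  also have "... = (\<Sum>r\<in>{a<..b - k}. \<Sum>N\<in>natpermute (b - r - k) (Suc k). \<Phi> ({a<..<r} # gap_intervals r N))"
    by (intro sum.cong refl Suc.IH) auto
  also have "... = (\<Sum>i\<le>b - a - Suc k. \<Sum>N\<in>natpermute (b - a - Suc k - i) (Suc k). \<Phi> (gap_intervals a (i # N)))"
  proof (rule sum.reindex_bij_witness[where i = "\<lambda>i. a + i + 1" and j = "\<lambda>r. r - a - 1"])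
    fix r assume r: "r \<in> {a<..b - k}"
    have "{a<..a + (r - a - 1)} = {a<..<r}" using r by auto
    moreover have "b - a - Suc k - (r - a - 1) = b - r - k" "a + (r - a - 1) + 1 = r" using r by auto
    ultimately show "(\<Sum>N\<in>natpermute (b - a - Suc k - (r - a - 1)) (Suc k). \<Phi> (gap_intervals a ((r - a - 1) # N))) =
        (\<Sum>N\<in>natpermute (b - r - k) (Suc k). \<Phi> ({a<..<r} # gap_intervals r N))"
      by (simp only: gap_intervals.simps)
  qed (use Suc.prems in auto)
  finally show ?case by (simp only: sum_natpermute_Suc[of _ _ "Suc k"])
qed

lemma gap_intervals_nth: "j < length N \<Longrightarrow> \<exists>c. gap_intervals a N ! j = {c<..c + N ! j}"
proof (induction N arbitrary: a j)
  case (Cons i N)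
  then show ?case by (cases j) auto
qed simp

lemma map_card_gap_intervals: "map card (gap_intervals a N) = N"
  by (induction N arbitrary: a) auto

text \<open>Conditioning on the set of root keys makes the gaps independent, and summing over such
  sets is summing over compositions. H and G may depend on the sizes, and G also on the child, so
  one identity serves the mean, the cross terms of the variance and the characteristic
  function.\<close>

theorem avg_split:
  fixes H :: "nat list \<Rightarrow> 'a::field_char_0" and G :: "nat list \<Rightarrow> nat \<Rightarrow> real \<Rightarrow> 'a"
  assumes m: "m \<ge> 2" and n: "m - 1 \<le> n"
  shows "avg {1..n} (\<lambda>xs. H (map length (parts m xs)) *
      (\<Prod>j<m. G (map length (parts m xs)) j (stat m t (parts m xs ! j)))) =
    (\<Sum>N\<in>splits m n. H N * (\<Prod>j<m. avg {1..N ! j} (\<lambda>xs. G N j (stat m t xs)))) /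
      of_nat (n choose (m - 1))"
proof -
  define S where "S = {0<..n}"
  have S: "S = {1..n}" "finite S" "card S = n" by (auto simp: S_def)
  define \<Phi> where "\<Phi> = (\<lambda>Bs. H (map card Bs) * (\<Prod>j<m. avg (Bs ! j) (\<lambda>xs. G (map card Bs) j (stat m t xs))))"
  define F where "F = (\<lambda>xs. H (map length (parts m xs)) *
      (\<Prod>j<m. G (map length (parts m xs)) j (stat m t (parts m xs ! j))))"
  have inner: "(\<Sum>ys\<in>permutations_of_set R. \<Sum>zs\<in>permutations_of_set (S - R). F (ys @ zs)) =
      fact (m - 1) * (fact (n - (m - 1)) * \<Phi> (blocks m 0 n R))" if R: "R \<subseteq> S" "card R = m - 1" for R
  proof -
    have fR: "finite R" using R(1) S(2) finite_subset by blast
    have cSR: "card (S - R) = n - (m - 1)" using R S fR by (simp add: card_Diff_subset)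
    \<comment> \<open>The size vector depends on the set R only and not on the order of the
      remaining keys, so H and G are frozen inside the inner sum.\<close>
    define N where "N = map card (blocks m 0 n R)"
    have bl: "blocks m 0 n R ! j = {x\<in>S - R. gap_index R x = j}" if "j < m" for j
      using that by (simp add: blocks_def S_def)
    have clsm: "gap_index R x < m" if "x \<in> S - R" for x
    proof -
      have "gap_index R x \<le> card R" unfolding gap_index_def using fR by (intro card_mono) auto
      then show ?thesis using R m by auto
    qed
    have step: "(\<Sum>zs\<in>permutations_of_set (S - R). F (ys @ zs)) =
        fact (n - (m - 1)) * \<Phi> (blocks m 0 n R)" if ys: "ys \<in> permutations_of_set R" for ys
    proof -
      have y: "set ys = R" "length ys = m - 1"
        using ys R(2) by (auto simp: permutations_of_set_def distinct_card[symmetric])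
      have pr: "parts m (ys @ zs) = map (\<lambda>j. filter (\<lambda>z. gap_index R z = j) zs) [0..<m]" for zs
        by (simp add: parts_def y)
      have len: "map length (parts m (ys @ zs)) = N" if "zs \<in> permutations_of_set (S - R)" for zs
      proof -
        have "length (filter (\<lambda>z. gap_index R z = j) zs) = card {x\<in>S - R. gap_index R x = j}" for j
          using that by (subst distinct_card[symmetric]) (auto simp: permutations_of_set_def)
        then show ?thesis by (simp add: pr N_def blocks_def S_def)
      qed
      have "(\<Sum>zs\<in>permutations_of_set (S - R). F (ys @ zs)) =
          (\<Sum>zs\<in>permutations_of_set (S - R). H N * (\<Prod>j<m. G N j (stat m t (filter (\<lambda>z. gap_index R z = j) zs))))"
      proof (intro sum.cong refl)
        fix zs assume "zs \<in> permutations_of_set (S - R)"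
        note l = len[OF this]
        show "F (ys @ zs) = H N * (\<Prod>j<m. G N j (stat m t (filter (\<lambda>z. gap_index R z = j) zs)))"
          unfolding F_def l by (simp add: pr)
      qed
      also have "... = H N * (fact (n - (m - 1)) *
          avg (S - R) (\<lambda>zs. \<Prod>j<m. G N j (stat m t (filter (\<lambda>z. gap_index R z = j) zs))))"
        unfolding avg_def cSR sum_distrib_left[symmetric] by simp
      also have "avg (S - R) (\<lambda>zs. \<Prod>j<m. G N j (stat m t (filter (\<lambda>z. gap_index R z = j) zs))) =
          (\<Prod>j<m. avg {x\<in>S - R. gap_index R x = j} (\<lambda>xs. G N j (stat m t xs)))"
        by (rule avg_blocks) (use S clsm in auto)
      also have "H N * (fact (n - (m - 1)) * ...) = fact (n - (m - 1)) * \<Phi> (blocks m 0 n R)"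
        unfolding \<Phi>_def N_def using bl by simp
      finally show ?thesis .
    qed
    show ?thesis using step R(2) fR by simp
  qed
  have "(\<Sum>xs\<in>permutations_of_set S. F xs) =
      (\<Sum>R | R \<subseteq> S \<and> card R = m - 1. fact (m - 1) * (fact (n - (m - 1)) * \<Phi> (blocks m 0 n R)))"
    using n S inner by (subst sum_permutations_prefix[of S "m - 1"]) (auto intro!: sum.cong)
  also have "... = fact (m - 1) * fact (n - (m - 1)) * (\<Sum>R | R \<subseteq> S \<and> card R = m - 1. \<Phi> (blocks m 0 n R))"
    by (simp add: sum_distrib_left mult.assoc)
  also have "(\<Sum>R | R \<subseteq> S \<and> card R = m - 1. \<Phi> (blocks m 0 n R)) =
      (\<Sum>N\<in>splits m n. \<Phi> (gap_intervals 0 N))"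
    using sum_subsets_blocks[of 0 n "m - 1" \<Phi>] m n unfolding S_def by simp
  also have "... = (\<Sum>N\<in>splits m n. H N * (\<Prod>j<m. avg {1..N ! j} (\<lambda>xs. G N j (stat m t xs))))"
  proof (intro sum.cong refl)
    fix N assume "N \<in> splits m n"
    then have len: "length N = m" by (simp add: natpermute_def)
    have "avg (gap_intervals 0 N ! j) (\<lambda>xs. G N j (stat m t xs)) = avg {1..N ! j} (\<lambda>xs. G N j (stat m t xs))" if j: "j < m" for j
    proof -
      obtain c where "gap_intervals 0 N ! j = {c<..c + N ! j}" using gap_intervals_nth[of j N 0] j len by auto
      then show ?thesis by (simp add: avg_shift)
    qed
    then show "\<Phi> (gap_intervals 0 N) = H N * (\<Prod>j<m. avg {1..N ! j} (\<lambda>xs. G N j (stat m t xs)))"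
      by (simp add: \<Phi>_def map_card_gap_intervals)
  qed
  finally have main: "(\<Sum>xs\<in>permutations_of_set S. F xs) = fact (m - 1) * fact (n - (m - 1)) *
      (\<Sum>N\<in>splits m n. H N * (\<Prod>j<m. avg {1..N ! j} (\<lambda>xs. G N j (stat m t xs))))" .
  have "of_nat (fact (m - 1) * fact (n - (m - 1)) * (n choose (m - 1))) = (of_nat (fact n) :: 'a)"
    unfolding binomial_fact_lemma[OF n] ..
  then have bn: "fact (m - 1) * fact (n - (m - 1)) * of_nat (n choose (m - 1)) = (fact n :: 'a)"
    by simp
  have Y: "fact (m - 1) * fact (n - (m - 1)) * Y / fact n = Y / of_nat (n choose (m - 1))" for Y :: 'a
    unfolding bn[symmetric] by simp
  have "avg S F = (\<Sum>N\<in>splits m n. H N * (\<Prod>j<m. avg {1..N ! j} (\<lambda>xs. G N j (stat m t xs)))) /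
      of_nat (n choose (m - 1))"
    unfolding avg_def[of S F] main S(3) by (rule Y)
  then show ?thesis unfolding F_def S(1) .
qed

section \<open>Mean, variance and characteristic function\<close>

lemma avg_add: "avg S (\<lambda>xs. F xs + G xs) = avg S F + avg S G"
  by (simp add: avg_def sum.distrib add_divide_distrib)

lemma avg_cmult: "avg S (\<lambda>xs. c * F xs) = c * avg S F"
  by (simp add: avg_def sum_distrib_left)

lemma avg_diff: "avg S (\<lambda>xs. F xs - G xs) = avg S F - avg S G"
  by (simp add: avg_def sum_subtractf diff_divide_distrib)

lemma avg_sum: "avg S (\<lambda>xs. \<Sum>i\<in>I. F i xs) = (\<Sum>i\<in>I. avg S (F i))"
  unfolding avg_def sum_divide_distrib[symmetric] by (subst sum.swap) simp

lemma avg_const [simp]: "finite S \<Longrightarrow> avg S (\<lambda>_. c) = c"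
  by (simp add: avg_def)

lemma avg_norm_le:
  fixes F :: "nat list \<Rightarrow> 'a::{real_normed_field}"
  assumes "finite S" "\<And>xs. norm (F xs) \<le> C"
  shows "norm (avg S F) \<le> C"
proof -
  have "norm (avg S F) \<le> (\<Sum>xs\<in>permutations_of_set S. norm (F xs)) / fact (card S)"
    unfolding avg_def norm_divide norm_fact by (intro divide_right_mono norm_sum) auto
  also have "... \<le> (\<Sum>xs\<in>permutations_of_set S. C) / fact (card S)"
    by (intro divide_right_mono sum_mono assms) auto
  also have "... = C" using assms(1) by simp
  finally show ?thesis .
qed

definition split_mean :: "nat \<Rightarrow> nat \<Rightarrow> (nat list \<Rightarrow> 'a::field_char_0) \<Rightarrow> 'a" where
  "split_mean m n H = (\<Sum>N\<in>splits m n. H N) / of_nat (n choose (m - 1))"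

abbreviation sizes :: "nat \<Rightarrow> nat list \<Rightarrow> nat list" where
  "sizes m xs \<equiv> map length (parts m xs)"

definition stat_mean :: "nat \<Rightarrow> (nat \<Rightarrow> real) \<Rightarrow> nat \<Rightarrow> (real \<Rightarrow> 'a::field_char_0) \<Rightarrow> 'a" where
  "stat_mean m t n F = avg {1..n} (\<lambda>xs. F (stat m t xs))"

lemma stat_mean_add: "stat_mean m t n (\<lambda>x. F x + G x) = stat_mean m t n F + stat_mean m t n G"
  and stat_mean_diff: "stat_mean m t n (\<lambda>x. F x - G x) = stat_mean m t n F - stat_mean m t n G"
  and stat_mean_cmult: "stat_mean m t n (\<lambda>x. c * F x) = c * stat_mean m t n F"
  and stat_mean_const [simp]: "stat_mean m t n (\<lambda>_. c) = c"
  by (simp_all add: stat_mean_def avg_add avg_diff avg_cmult)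

lemma split_mean_add: "split_mean m n (\<lambda>N. F N + G N) = split_mean m n F + split_mean m n G"
  by (simp add: split_mean_def sum.distrib add_divide_distrib)

lemma split_mean_diff: "split_mean m n (\<lambda>N. F N - G N) = split_mean m n F - split_mean m n G"
  by (simp add: split_mean_def sum_subtractf diff_divide_distrib)

lemma split_mean_cmult: "split_mean m n (\<lambda>N. c * F N) = c * split_mean m n F"
  by (simp add: split_mean_def sum_distrib_left)

lemma split_mean_mono:
  "(\<And>N. N \<in> splits m n \<Longrightarrow> F N \<le> G N) \<Longrightarrow> split_mean m n F \<le> (split_mean m n G :: real)"
  unfolding split_mean_def by (intro divide_right_mono sum_mono) auto

lemma split_mean_norm:
  fixes F :: "nat list \<Rightarrow> 'a::real_normed_field"
  shows "norm (split_mean m n F) \<le> split_mean m n (\<lambda>N. norm (F N))"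
  unfolding split_mean_def norm_divide norm_of_nat by (intro divide_right_mono norm_sum) auto

text \<open>The contribution of the root after centring by c n: the subtree sizes add up to n - (m -
  1), so the drift of the m - 1 root keys is left over.\<close>

definition toll :: "nat \<Rightarrow> (nat \<Rightarrow> real) \<Rightarrow> real \<Rightarrow> nat list \<Rightarrow> real" where
  "toll m t c N = t (nonzeros m N) - c * real (m - 1)"

context
  fixes m :: nat and t :: "nat \<Rightarrow> real" and n :: nat
  assumes m: "m \<ge> 2" and n: "m - 1 \<le> n"
begin

lemma avg_split_prod:
  fixes G :: "nat list \<Rightarrow> nat \<Rightarrow> real \<Rightarrow> 'a::field_char_0"
  shows "avg {1..n} (\<lambda>xs. H (sizes m xs) * (\<Prod>j<m. G (sizes m xs) j (stat m t (parts m xs ! j)))) =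
    split_mean m n (\<lambda>N. H N * (\<Prod>j<m. stat_mean m t (N ! j) (G N j)))"
  unfolding split_mean_def stat_mean_def by (rule avg_split[OF m n])

lemma avg_split_none: "avg {1..n} (\<lambda>xs. H (sizes m xs)) = split_mean m n H"
  using avg_split_prod[of H "\<lambda>_ _ _. 1"] by simp

lemma split_mean_const: "split_mean m n (\<lambda>_. c) = c"
  using avg_split_none[of "\<lambda>_. c"] by simp

lemma avg_split_one:
  fixes g :: "nat list \<Rightarrow> real \<Rightarrow> 'a::field_char_0"
  assumes i: "i < m"
  shows "avg {1..n} (\<lambda>xs. H (sizes m xs) * g (sizes m xs) (stat m t (parts m xs ! i))) =
    split_mean m n (\<lambda>N. H N * stat_mean m t (N ! i) (g N))"
proof -
  have p: "(\<Prod>j<m. if j = i then a j else 1) = (a i :: 'a)" for a using i by simp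
  have q: "(if j = i then g N else (\<lambda>_. 1)) x = (if j = i then g N x else 1)" for j N x by simp
  have r: "stat_mean m t k (if j = i then g N else (\<lambda>_. 1)) = (if j = i then stat_mean m t k (g N) else 1)" for j k N by simp
  show ?thesis using avg_split_prod[of H "\<lambda>N j. if j = i then g N else (\<lambda>_. 1)"] unfolding p q r .
qed

lemma avg_split_two:
  fixes g :: "nat list \<Rightarrow> nat \<Rightarrow> real \<Rightarrow> 'a::field_char_0"
  assumes i: "i < m" and k: "k < m" "i \<noteq> k"
  shows "avg {1..n} (\<lambda>xs. g (sizes m xs) i (stat m t (parts m xs ! i)) * g (sizes m xs) k (stat m t (parts m xs ! k))) =
    split_mean m n (\<lambda>N. stat_mean m t (N ! i) (g N i) * stat_mean m t (N ! k) (g N k))"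
proof -
  have p: "(\<Prod>j<m. if j \<in> {i, k} then a j else 1) = (a i * a k :: 'a)" for a
  proof -
    have "(\<Prod>j<m. if j \<in> {i, k} then a j else 1) = (\<Prod>j\<in>{j\<in>{..<m}. j \<in> {i, k}}. a j)"
      by (rule prod.inter_filter[symmetric]) simp
    also have "{j\<in>{..<m}. j \<in> {i, k}} = {i, k}" using i k by auto
    finally show ?thesis using k by simp
  qed
  have q: "(if j \<in> {i, k} then g N j else (\<lambda>_. 1)) x = (if j \<in> {i, k} then g N j x else 1)" for j N x by simp
  have r: "stat_mean m t l (if j \<in> {i, k} then g N j else (\<lambda>_. 1)) = (if j \<in> {i, k} then stat_mean m t l (g N j) else 1)" for j l N
    by simp
  show ?thesis using avg_split_prod[of "\<lambda>_. 1" "\<lambda>N j. if j \<in> {i, k} then g N j else (\<lambda>_. 1)"]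
    unfolding p q r by simp
qed

lemma avg_stat_parts:
  "stat_mean m t n F = avg {1..n} (\<lambda>xs. F (t (nonzeros m (sizes m xs)) + (\<Sum>j<m. stat m t (parts m xs ! j))))"
  unfolding stat_mean_def
proof (rule avg_cong)
  fix xs assume "set xs = {1..n}" "distinct xs"
  moreover from this have "length xs = n" using distinct_card by fastforce
  ultimately show "F (stat m t xs) = F (t (nonzeros m (sizes m xs)) + (\<Sum>j<m. stat m t (parts m xs ! j)))"
    using stat_parts[of xs m t] m n by simp
qed

lemma sizes_sum:
  assumes "set xs = {1..n}" "distinct xs"
  shows "(\<Sum>j<m. real (sizes m xs ! j)) = real n - real (m - 1)"
proof -
  have len: "length xs = n" using assms distinct_card by fastforce
  define R zs where "R = set (take (m - 1) xs)" and "zs = drop (m - 1) xs"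
  have R: "finite R" "card R \<le> m - 1"
    unfolding R_def by (auto intro: order_trans[OF card_length])
  have c: "gap_index R x < m" for x
    using card_mono[of R "{r\<in>R. r < x}"] R m unfolding gap_index_def by auto
  have "(\<Sum>j<m. length (filter (\<lambda>z. gap_index R z = j) ys)) = length ys" for ys
  proof (induction ys)
    case (Cons a ys)
    have "length (filter (\<lambda>z. gap_index R z = j) (a # ys)) =
        (if j = gap_index R a then 1 else 0) + length (filter (\<lambda>z. gap_index R z = j) ys)" for j by auto
    then show ?case using Cons c[of a] by (simp only: sum.distrib) simp
  qed simp
  moreover have "sizes m xs ! j = length (filter (\<lambda>z. gap_index R z = j) zs)" if "j < m" for j
    using that by (simp add: parts_def R_def zs_def)
  ultimately have "(\<Sum>j<m. sizes m xs ! j) = length zs" by simp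
  then show ?thesis using len n m unfolding zs_def by (simp flip: of_nat_sum add: of_nat_diff)
qed

lemma natpermute_sum: "N \<in> splits m n \<Longrightarrow> (\<Sum>j<m. real (N ! j)) = real n - real (m - 1)"
  using n by (auto simp: natpermute_def sum_list_sum_nth lessThan_atLeast0 simp flip: of_nat_sum of_nat_diff)

lemma avg_centered_parts:
  "stat_mean m t n (\<lambda>x. F (x - c * real n)) = avg {1..n} (\<lambda>xs. F (toll m t c (sizes m xs) +
     (\<Sum>j<m. stat m t (parts m xs ! j) - c * real (sizes m xs ! j))))"
  unfolding avg_stat_parts
proof (rule avg_cong)
  fix xs assume "set xs = {1..n}" "distinct xs"
  from sizes_sum[OF this] have "(\<Sum>j<m. c * real (sizes m xs ! j)) = c * (real n - real (m - 1))"
    unfolding sum_distrib_left[symmetric] by simp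
  then have "t (nonzeros m (sizes m xs)) + (\<Sum>j<m. stat m t (parts m xs ! j)) - c * real n =
     toll m t c (sizes m xs) + (\<Sum>j<m. stat m t (parts m xs ! j) - c * real (sizes m xs ! j))"
    by (simp only: toll_def sum_subtractf) (simp add: algebra_simps)
  then show "F (t (nonzeros m (sizes m xs)) + (\<Sum>j<m. stat m t (parts m xs ! j)) - c * real n) =
     F (toll m t c (sizes m xs) + (\<Sum>j<m. stat m t (parts m xs ! j) - c * real (sizes m xs ! j)))"
    by (rule arg_cong)
qed

lemma mean_split:
  "stat_mean m t n (\<lambda>x. x - c * real n) =
    split_mean m n (\<lambda>N. toll m t c N + (\<Sum>j<m. stat_mean m t (N ! j) (\<lambda>x. x - c * real (N ! j))))"
proof -
  have "stat_mean m t n (\<lambda>x. x - c * real n) = avg {1..n} (\<lambda>xs. toll m t c (sizes m xs)) +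
     (\<Sum>j<m. avg {1..n} (\<lambda>xs. stat m t (parts m xs ! j) - c * real (sizes m xs ! j)))"
    using avg_centered_parts[of "\<lambda>x. x" c] by (simp add: avg_add avg_sum)
  also have "(\<Sum>j<m. avg {1..n} (\<lambda>xs. stat m t (parts m xs ! j) - c * real (sizes m xs ! j))) =
     (\<Sum>j<m. split_mean m n (\<lambda>N. stat_mean m t (N ! j) (\<lambda>x. x - c * real (N ! j))))"
  proof (intro sum.cong refl)
    fix j assume "j \<in> {..<m}"
    then show "avg {1..n} (\<lambda>xs. stat m t (parts m xs ! j) - c * real (sizes m xs ! j)) =
       split_mean m n (\<lambda>N. stat_mean m t (N ! j) (\<lambda>x. x - c * real (N ! j)))"
      using avg_split_one[of j "\<lambda>_. 1" "\<lambda>N x. x - c * real (N ! j)"] by simp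
  qed
  also have "... = split_mean m n (\<lambda>N. \<Sum>j<m. stat_mean m t (N ! j) (\<lambda>x. x - c * real (N ! j)))"
    unfolding split_mean_def by (simp only: sum_divide_distrib[symmetric]) (subst sum.swap, rule refl)
  finally show ?thesis by (simp only: avg_split_none split_mean_add)
qed

lemma char_split:
  "stat_mean m t n (\<lambda>x. cis (s * (x - c * real n))) =
    split_mean m n (\<lambda>N. cis (s * toll m t c N) * (\<Prod>j<m. stat_mean m t (N ! j) (\<lambda>x. cis (s * (x - c * real (N ! j))))))"
proof -
  have "cis (s * (a + (\<Sum>j<k. b j))) = cis (s * a) * (\<Prod>j<k. cis (s * b j))" for a k and b :: "nat \<Rightarrow> real"
    by (induction k) (simp_all add: cis_mult[symmetric] distrib_left mult.assoc add.assoc[symmetric])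
  then show ?thesis
    using avg_centered_parts[of "\<lambda>x. cis (s * x)" c]
      avg_split_prod[of "\<lambda>N. cis (s * toll m t c N)" "\<lambda>N j x. cis (s * (x - c * real (N ! j)))"]
    by simp
qed

text \<open>The law of total variance. Given the sizes, the centred subtree statistics are
  independent with mean 0, so all cross terms vanish and only the squared deviation of the
  conditional mean and the subtree variances remain.\<close>

lemma variance_split:
  assumes \<nu>: "\<And>k. \<nu> k = stat_mean m t k (\<lambda>x. x - c * real k)"
  shows "stat_mean m t n (\<lambda>x. (x - c * real n - \<nu> n)\<^sup>2) =
    split_mean m n (\<lambda>N. (toll m t c N + (\<Sum>j<m. \<nu> (N ! j)) - \<nu> n)\<^sup>2 +
      (\<Sum>j<m. stat_mean m t (N ! j) (\<lambda>x. (x - c * real (N ! j) - \<nu> (N ! j))\<^sup>2)))"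
proof -
  define A where "A = (\<lambda>N. toll m t c N + (\<Sum>j<m. \<nu> (N ! j)) - \<nu> n)"
  define g where "g = (\<lambda>N j x. x - c * real (N ! j) - \<nu> (N ! j))"
  define y where "y = (\<lambda>xs j. g (sizes m xs) j (stat m t (parts m xs ! j)))"
  have g0: "stat_mean m t (N ! j) (g N j) = 0" for N j
    unfolding g_def by (subst stat_mean_diff) (simp add: \<nu>)
  have "stat_mean m t n (\<lambda>x. (x - c * real n - \<nu> n)\<^sup>2) = avg {1..n} (\<lambda>xs. (A (sizes m xs) + (\<Sum>j<m. y xs j))\<^sup>2)"
  proof -
    have "toll m t c N + (\<Sum>j<m. u j - c * real (N ! j)) - \<nu> n = A N + (\<Sum>j<m. g N j (u j))" for N u
      by (simp add: A_def g_def sum_subtractf)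
    then show ?thesis
      using avg_centered_parts[of "\<lambda>x. (x - \<nu> n)\<^sup>2" c] unfolding y_def by simp
  qed
  also have "(\<lambda>xs. (A (sizes m xs) + (\<Sum>j<m. y xs j))\<^sup>2) =
      (\<lambda>xs. (A (sizes m xs))\<^sup>2 + (\<Sum>j<m. 2 * A (sizes m xs) * y xs j) + (\<Sum>j<m. \<Sum>k<m. y xs j * y xs k))"
    by (simp add: power2_sum sum_distrib_left[symmetric] power2_eq_square[of "\<Sum>j<m. y _ j"] sum_product fun_eq_iff)
  also have "avg {1..n} ... = avg {1..n} (\<lambda>xs. (A (sizes m xs))\<^sup>2) +
      (\<Sum>j<m. avg {1..n} (\<lambda>xs. 2 * A (sizes m xs) * y xs j)) + (\<Sum>j<m. \<Sum>k<m. avg {1..n} (\<lambda>xs. y xs j * y xs k))"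
    by (simp only: avg_add avg_sum)
  also have "(\<Sum>j<m. avg {1..n} (\<lambda>xs. 2 * A (sizes m xs) * y xs j)) = 0"
  proof (intro sum.neutral ballI)
    fix j assume "j \<in> {..<m}"
    then show "avg {1..n} (\<lambda>xs. 2 * A (sizes m xs) * y xs j) = 0"
      using avg_split_one[of j "\<lambda>N. 2 * A N" "\<lambda>N. g N j"] by (simp add: y_def g0 split_mean_def)
  qed
  also have "(\<Sum>j<m. \<Sum>k<m. avg {1..n} (\<lambda>xs. y xs j * y xs k)) =
      (\<Sum>j<m. \<Sum>k<m. if k = j then split_mean m n (\<lambda>N. stat_mean m t (N ! j) (\<lambda>x. (g N j x)\<^sup>2)) else 0)"
  proof (intro sum.cong refl)
    fix j k assume jk: "j \<in> {..<m}" "k \<in> {..<m}"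
    show "avg {1..n} (\<lambda>xs. y xs j * y xs k) =
        (if k = j then split_mean m n (\<lambda>N. stat_mean m t (N ! j) (\<lambda>x. (g N j x)\<^sup>2)) else 0)"
    proof (cases "k = j")
      case True
      then show ?thesis using jk avg_split_one[of j "\<lambda>_. 1" "\<lambda>N x. (g N j x)\<^sup>2"]
        by (simp add: y_def power2_eq_square)
    next
      case False
      then show ?thesis using jk avg_split_two[of j k g]
        by (simp add: y_def g0 split_mean_def)
    qed
  qed
  also have "... = (\<Sum>j<m. split_mean m n (\<lambda>N. stat_mean m t (N ! j) (\<lambda>x. (g N j x)\<^sup>2)))" by simp
  also have "... = split_mean m n (\<lambda>N. \<Sum>j<m. stat_mean m t (N ! j) (\<lambda>x. (g N j x)\<^sup>2))"
    unfolding split_mean_def by (simp only: sum_divide_distrib[symmetric]) (subst sum.swap, rule refl)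
  also have "avg {1..n} (\<lambda>xs. (A (sizes m xs))\<^sup>2) = split_mean m n (\<lambda>N. (A N)\<^sup>2)"
    by (rule avg_split_none)
  finally show ?thesis unfolding A_def g_def by (simp add: split_mean_add)
qed

end

section \<open>The outdegree of the root and the constants of v*\<close>

lemma stat_mean_small:
  assumes "n < m"
  shows "stat_mean m t n F = F (if n = 0 then 0 else t 0)"
proof -
  have "stat_mean m t n F = avg {1..n} (\<lambda>_. F (if n = 0 then 0 else t 0))"
    unfolding stat_mean_def
  proof (rule avg_cong)
    fix xs assume "set xs = {1..n}" "distinct xs"
    moreover from this have "length xs = n" using distinct_card by fastforce
    ultimately show "F (stat m t xs) = F (if n = 0 then 0 else t 0)"
      using stat_small[of xs m t] assms by (cases "n = 0") auto
  qed
  then show ?thesis by simp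
qed

text \<open>The number of compositions of s into k positive parts. The cases s = 0 and k = 0 stand
  apart because truncated subtraction would miscount there.\<close>

definition pos_comps :: "nat \<Rightarrow> nat \<Rightarrow> nat" where
  "pos_comps s k = (if s = 0 then (if k = 0 then 1 else 0) else if k = 0 then 0 else (s - 1) choose (k - 1))"

lemma sum_pos_comps: "(\<Sum>j<s. pos_comps j k) = pos_comps s (Suc k)"
proof (induction s)
  case (Suc s)
  then show ?case by (cases s; cases k) (auto simp: pos_comps_def)
qed (simp add: pos_comps_def)

text \<open>Choose which k entries are nonzero, then distribute s over them with positive parts. The
  induction conditions on the first entry and closes with Pascal's rule.\<close>

lemma count_nonzeros:
  "(\<Sum>N\<in>natpermute s m. if length (filter (\<lambda>x. x \<noteq> 0) N) = k then 1 else 0) = (m choose k) * pos_comps s k"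
proof (induction m arbitrary: s k)
  case 0
  then show ?case by (cases k) (auto simp: natpermute_0 pos_comps_def)
next
  case (Suc m)
  have "(\<Sum>N\<in>natpermute s (Suc m). if length (filter (\<lambda>x. x \<noteq> 0) N) = k then 1 else 0) =
      (\<Sum>N\<in>natpermute s m. if length (filter (\<lambda>x. x \<noteq> 0) N) = k then 1 else 0) +
      (\<Sum>i<s. \<Sum>N\<in>natpermute (s - Suc i) m. if Suc (length (filter (\<lambda>x. x \<noteq> 0) N)) = k then 1 else (0 :: nat))"
    unfolding sum_natpermute_Suc sum.atMost_shift by simp
  also have "(\<Sum>i<s. \<Sum>N\<in>natpermute (s - Suc i) m. if Suc (length (filter (\<lambda>x. x \<noteq> 0) N)) = k then 1 else (0 :: nat)) =
      (if k = 0 then 0 else (m choose (k - 1)) * pos_comps s k)"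
  proof (cases k)
    case (Suc k')
    have "(\<Sum>i<s. \<Sum>N\<in>natpermute (s - Suc i) m. if Suc (length (filter (\<lambda>x. x \<noteq> 0) N)) = k then 1 else (0 :: nat)) =
        (\<Sum>i<s. (m choose k') * pos_comps (s - Suc i) k')"
      using Suc.IH by (simp add: Suc)
    also have "... = (m choose k') * (\<Sum>i<s. pos_comps i k')"
      unfolding sum_distrib_left[symmetric] by (subst sum.nat_diff_reindex) simp
    finally show ?thesis by (simp add: sum_pos_comps Suc)
  qed simp
  finally show ?case unfolding Suc.IH by (cases k) (auto simp: algebra_simps)
qed

lemma nonzeros_filter: "length N = m \<Longrightarrow> nonzeros m N = length (filter (\<lambda>x. x \<noteq> 0) N)"
  unfolding nonzeros_def length_filter_conv_card by auto

definition unit_weight :: "nat \<Rightarrow> nat \<Rightarrow> real" where "unit_weight k j = (if j = k then 1 else 0)"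

lemma split_mean_unit_weight:
  "split_mean m n (\<lambda>N. unit_weight k (nonzeros m N)) =
    real ((m choose k) * pos_comps (n - (m - 1)) k) / real (n choose (m - 1))"
proof -
  have "(\<Sum>N\<in>splits m n. unit_weight k (nonzeros m N)) =
      real (\<Sum>N\<in>splits m n. if length (filter (\<lambda>x. x \<noteq> 0) N) = k then 1 else 0)"
    unfolding of_nat_sum by (intro sum.cong) (auto simp: unit_weight_def natpermute_def nonzeros_filter)
  then show ?thesis unfolding split_mean_def count_nonzeros by simp
qed

text \<open>The boundary term at infinity for the summations by parts in
  \<open>sums_binomial_fact\<close>.\<close>

lemma tail_to_zero:
  "(\<lambda>i. real (i choose k) * fact (i + q) / fact (i + q + k + 1 + d)) \<longlonglongrightarrow> 0"
proof (rule tendsto_sandwich)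
  show "(\<lambda>_. 0) \<longlonglongrightarrow> (0 :: real)" "(\<lambda>i. 1 / real (Suc i)) \<longlonglongrightarrow> 0"
    using LIMSEQ_inverse_real_of_nat by (simp_all add: inverse_eq_divide)
  show "\<forall>\<^sub>F i in sequentially. 0 \<le> real (i choose k) * fact (i + q) / fact (i + q + k + 1 + d)" by simp
  show "\<forall>\<^sub>F i in sequentially. real (i choose k) * fact (i + q) / fact (i + q + k + 1 + d) \<le> 1 / real (Suc i)"
  proof (rule always_eventually, rule allI)
    fix i
    have "(i choose k) * fact (i + q) \<le> ((i + q + k) choose k) * (fact k * fact (i + q))"
      using binomial_right_mono[of i "i + q + k" k] by (intro mult_mono) auto
    also have "... = fact (i + q + k)"
      using binomial_fact_lemma[of k "i + q + k"] by (simp add: mult_ac)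
    finally have "(i choose k) * fact (i + q) * Suc i \<le> fact (i + q + k) * Suc (i + q + k)"
      by (intro mult_mono) auto
    also have "... = fact (i + q + k + 1)" by simp
    also have "... \<le> fact (i + q + k + 1 + d)" by (intro fact_mono) simp
    finally have "real ((i choose k) * fact (i + q) * Suc i) \<le> real (fact (i + q + k + 1 + d))"
      unfolding of_nat_le_iff .
    then have le: "real (i choose k) * fact (i + q) * real (Suc i) \<le> fact (i + q + k + 1 + d)"
      by (simp only: of_nat_mult of_nat_fact)
    have "a / b \<le> 1 / c" if "a * c \<le> b" "0 < b" "0 < c" for a b c :: real
      using that by (simp add: field_simps)
    from this[OF le] show "real (i choose k) * fact (i + q) / fact (i + q + k + 1 + d) \<le> 1 / real (Suc i)"
      by simp
  qed
qed

lemma fact_ratio_diff: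
  "fact (i + q) / fact (i + q + r) - fact (Suc i + q) / fact (Suc i + q + r) =
    real r * (fact (i + q) / fact (i + q + r + 1))"
proof -
  have f: "fact (i + q + r + 1) = real (i + q + r + 1) * fact (i + q + r)" by simp
  have n: "real (i + q + r + 1) \<noteq> 0" by simp
  have "fact (i + q) / fact (i + q + r) = real (i + q + r + 1) * fact (i + q) / fact (i + q + r + 1)"
    unfolding f using n by simp
  moreover have "fact (Suc i + q) / fact (Suc i + q + r) = real (i + q + 1) * fact (i + q) / fact (i + q + r + 1)"
    by simp
  ultimately show ?thesis
    by (simp only: diff_divide_distrib[symmetric] left_diff_distrib[symmetric]) simp
qed

text \<open>A discrete beta integral, by summation by parts: each step lowers the degree of the
  binomial by one and raises q by one, hence the induction over arbitrary q.\<close>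

lemma sums_binomial_fact:
  "(\<lambda>i. real (i choose k) * fact (i + q) / fact (i + q + k + 2 + d)) sums
    (fact (q + k) * fact d / (fact (k + d + 1) * fact (q + k + d + 1)))"
proof (induction k arbitrary: q)
  case 0
  define G where "G = (\<lambda>i. fact (i + q) / fact (i + q + (d + 1)) :: real)"
  have G: "G i - G (Suc i) = real (d + 1) * (fact (i + q) / fact (i + q + 2 + d))" for i
    using fact_ratio_diff[of i q "d + 1"] by (simp add: G_def add_ac)
  have "G \<longlonglongrightarrow> 0" using tail_to_zero[of 0 q d] by (simp add: G_def)
  then have "(\<lambda>i. G i - G (Suc i)) sums (G 0 - 0)" by (rule telescope_sums')
  then have "(\<lambda>i. fact (i + q) / fact (i + q + 2 + d)) sums (G 0 / real (d + 1))"
    using sums_mult_D[of "real (d + 1)" "\<lambda>i. fact (i + q) / fact (i + q + 2 + d)" "G 0"] unfolding G by simp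
  then show ?case by (simp add: G_def mult.commute add.commute)
next
  case (Suc k)
  define r where "r = real (k + d + 2)"
  define f where "f = (\<lambda>i. real (i choose Suc k))"
  define G where "G = (\<lambda>i. fact (i + q) / fact (i + q + Suc k + 1 + d) :: real)"
  have G: "G i - G (Suc i) = r * (fact (i + q) / fact (i + q + Suc k + 2 + d))" for i
    using fact_ratio_diff[of i q "Suc k + 1 + d"] by (simp add: G_def r_def add_ac)
  have fG: "f i * (G i - G (Suc i)) = (f i * G i - f (Suc i) * G (Suc i)) + real (i choose k) * G (Suc i)" for i
    by (simp add: f_def algebra_simps)
  have "(\<lambda>i. f i * G i) \<longlonglongrightarrow> 0" using tail_to_zero[of "Suc k" q d] by (simp add: f_def G_def)
  then have s1: "(\<lambda>i. f i * G i - f (Suc i) * G (Suc i)) sums (f 0 * G 0 - 0)" by (rule telescope_sums')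
  have "(\<lambda>i. real (i choose k) * G (Suc i)) sums
      (fact (Suc q + k) * fact d / (fact (k + d + 1) * fact (Suc q + k + d + 1)))"
    using Suc.IH[of "Suc q"] by (simp add: G_def)
  from sums_add[OF s1 this]
  have "(\<lambda>i. r * (f i * (fact (i + q) / fact (i + q + Suc k + 2 + d)))) sums
      (fact (Suc q + k) * fact d / (fact (k + d + 1) * fact (Suc q + k + d + 1)))"
    unfolding fG[symmetric] G by (simp add: f_def mult_ac)
  from sums_divide[OF this, of r]
  have "(\<lambda>i. f i * (fact (i + q) / fact (i + q + Suc k + 2 + d))) sums
      (fact (Suc q + k) * fact d / (fact (k + d + 1) * fact (Suc q + k + d + 1)) / r)"
    by (simp add: r_def)
  moreover have eq: "fact (Suc q + k) * fact d / (fact (k + d + 1) * fact (Suc q + k + d + 1)) / r =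
      fact (q + Suc k) * fact d / (fact (Suc k + d + 1) * fact (q + Suc k + d + 1))"
    by (simp add: r_def mult_ac)
  ultimately show ?case unfolding eq by (simp only: f_def times_divide_eq_right)
qed

lemma stat_unit_weight: "k \<le> m \<Longrightarrow> stat m (unit_weight k) xs = real (deg_count m k (build m xs))"
  unfolding stat_def unit_weight_def by (simp add: if_distrib[of "\<lambda>u. u * _"] cong: if_cong)

lemma stat_linear: "stat m t xs = (\<Sum>k\<le>m. t k * stat m (unit_weight k) xs)"
  unfolding stat_def[of m t] by (intro sum.cong) (auto simp: stat_unit_weight)

text \<open>Below m - 1 the mean itself serves as the toll, matching the initial condition of
  \<open>split_rec\<close>.\<close>

definition unit_weight_toll :: "nat \<Rightarrow> nat \<Rightarrow> nat \<Rightarrow> real" where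
  "unit_weight_toll m k n = (if n < m - 1 then stat_mean m (unit_weight k) n (\<lambda>x. x) else split_mean m n (\<lambda>N. unit_weight k (nonzeros m N)))"

lemma split_rec_unit_weight:
  assumes "m \<ge> 2"
  shows "split_rec m (\<lambda>n. stat_mean m (unit_weight k) n (\<lambda>x. x)) (unit_weight_toll m k)"
proof -
  have "stat_mean m (unit_weight k) n (\<lambda>x. x) = unit_weight_toll m k n + split_mean m n (\<lambda>N. \<Sum>j<m. stat_mean m (unit_weight k) (N ! j) (\<lambda>x. x))"
    if "m - 1 \<le> n" for n
    using mean_split[OF assms that, of "unit_weight k" 0] that
    by (simp add: unit_weight_toll_def toll_def split_mean_add)
  then show ?thesis unfolding split_rec_def by (simp add: unit_weight_toll_def split_mean_def)
qed

lemma unit_weight_toll_bound: "m \<ge> 2 \<Longrightarrow> \<bar>unit_weight_toll m k n\<bar> \<le> 1"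
proof (cases "n < m - 1")
  case True
  then show ?thesis by (simp add: unit_weight_toll_def stat_mean_small unit_weight_def)
next
  case False
  assume m: "m \<ge> 2"
  have "\<bar>split_mean m n (\<lambda>N. unit_weight k (nonzeros m N))\<bar> \<le> split_mean m n (\<lambda>N. \<bar>unit_weight k (nonzeros m N)\<bar>)"
    using split_mean_norm[of m n "\<lambda>N. unit_weight k (nonzeros m N)"] by simp
  also have "... \<le> split_mean m n (\<lambda>_. 1)" by (rule split_mean_mono) (simp add: unit_weight_def)
  also have "... = 1" using split_mean_const[OF m, of n 1] False by simp
  finally show ?thesis using False by (simp add: unit_weight_toll_def)
qed

text \<open>For n \<ge> m the root has outdegree k with probability (m choose k) (n - m choose k -
  1) / (n choose m - 1). Summed against 1 / ((n + 1) (n + 2)) this is a discrete beta value from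
  which k cancels, which is why all entries of v* with k \<ge> 1 agree.\<close>

lemma sums_unit_weight_toll_pos:
  assumes m: "m \<ge> 2" and k: "1 \<le> k" "k \<le> m"
  shows "(\<lambda>n. unit_weight_toll m k n / real ((n + 1) * (n + 2))) sums (1 / (real m * (real m + 1)))"
proof -
  define f where "f = (\<lambda>n. unit_weight_toll m k n / real ((n + 1) * (n + 2)))"
  have z: "f n = 0" if "n < m" for n
  proof (cases "n < m - 1")
    case True then show ?thesis using k by (simp add: f_def unit_weight_toll_def stat_mean_small unit_weight_def)
  next
    case False
    then have "n = m - 1" using that by simp
    then show ?thesis using k by (simp add: f_def unit_weight_toll_def split_mean_unit_weight pos_comps_def)
  qed
  obtain p where p: "k = Suc p" using k by (cases k) auto
  obtain d where d: "m = p + d + 1" using k p by (metis le_Suc_ex add.commute add_Suc plus_1_eq_Suc add_Suc_right Suc_eq_plus1)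
  have tm: "f (i + m) = real (m choose k) * fact (m - 1) * (real (i choose p) * fact (i + 1) / fact (i + 1 + p + 2 + d))" for i
  proof -
    have ch: "fact (m - 1) * fact (i + 1) * ((i + m) choose (m - 1)) = fact (i + m)"
      using binomial_fact_lemma[of "m - 1" "i + m"] m by simp
    have "fact (m - 1) * fact (i + 1) * ((i + m) choose (m - 1)) * ((i + m + 1) * (i + m + 2)) = fact (i + m + 2)"
      unfolding ch by (simp add: algebra_simps)
    then have e: "real (fact (m - 1) * fact (i + 1) * ((i + m) choose (m - 1)) * ((i + m + 1) * (i + m + 2))) =
        real (fact (i + m + 2))" by (simp only:)
    have pc: "pos_comps (i + m - (m - 1)) k = i choose p" using m by (simp add: pos_comps_def p)
    have "f (i + m) = real (m choose k) * real (i choose p) / (real ((i + m) choose (m - 1)) * real ((i + m + 1) * (i + m + 2)))"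
    proof -
      have "\<not> i + m < m - 1" by simp
      then show ?thesis
        by (simp only: f_def unit_weight_toll_def if_False split_mean_unit_weight pc of_nat_mult divide_divide_eq_left)
    qed
    also have "... = real (m choose k) * real (i choose p) * (fact (m - 1) * fact (i + 1)) / real (fact (i + m + 2))"
    proof -
      have "a / (c * y) = a * (f * g) / (f * g * c * y)" if "f \<noteq> 0" "g \<noteq> 0" for a c y f g :: real
        using that by simp
      from this[OF fact_nonzero fact_nonzero] show ?thesis
        unfolding of_nat_mult of_nat_fact e[unfolded of_nat_mult of_nat_fact, symmetric] .
    qed
    also have "fact (i + m + 2) = fact (i + 1 + p + 2 + d)" by (simp add: d add_ac)
    finally show ?thesis by (simp add: mult_ac del: fact_Suc)
  qed
  have "(\<lambda>i. f (i + m)) sums (real (m choose k) * fact (m - 1) *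
      (fact (1 + p) * fact d / (fact (p + d + 1) * fact (1 + p + d + 1))))"
    unfolding tm by (intro sums_mult sums_binomial_fact)
  also have "real (m choose k) * fact (m - 1) * (fact (1 + p) * fact d / (fact (p + d + 1) * fact (1 + p + d + 1))) =
      1 / (real m * (real m + 1))"
  proof -
    have "fact k * fact d * (m choose k) = fact m"
      using binomial_fact_lemma[of k m] k d p by simp
    then have 1: "real (fact k * fact d * (m choose k)) = real (fact m)" by (simp only:)
    have "real (m choose k) * fact (m - 1) * (fact (1 + p) * fact d / (fact (p + d + 1) * fact (1 + p + d + 1))) =
        real (fact k * fact d * (m choose k)) * fact (m - 1) / (fact m * fact (Suc m))"
      by (simp add: d p del: fact_Suc)
    also have "... = fact (m - 1) / fact (Suc m)" unfolding 1 by simp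
    also have "... = fact (m - 1) / ((real m + 1) * (real m * fact (m - 1)))"
      using m fact_reduce[of m, where 'a = real] by (simp add: algebra_simps)
    also have "... = 1 / (real m * (real m + 1))" by (simp add: mult.commute)
    finally show ?thesis .
  qed
  finally show ?thesis using sums_zero_iff_shift[of m f] z unfolding f_def by simp
qed

text \<open>The root is a leaf exactly when 1 \<le> n < m, so the series is a finite telescoping
  sum.\<close>

lemma sums_unit_weight_toll_0:
  assumes m: "m \<ge> 2"
  shows "(\<lambda>n. unit_weight_toll m 0 n / real ((n + 1) * (n + 2))) sums ((real m - 1) / (2 * (real m + 1)))"
proof -
  define f where "f = (\<lambda>n. unit_weight_toll m 0 n / real ((n + 1) * (n + 2)))"
  have val: "unit_weight_toll m 0 n = (if n \<in> {1..<m} then 1 else 0)" for n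
  proof (cases "n < m - 1")
    case True then show ?thesis by (auto simp: unit_weight_toll_def stat_mean_small unit_weight_def)
  next
    case False
    then show ?thesis using m by (cases "n = m - 1") (auto simp: unit_weight_toll_def split_mean_unit_weight pos_comps_def)
  qed
  have "f sums (\<Sum>n\<in>{1..<m}. f n)"
    by (rule sums_finite) (auto simp: f_def val)
  also have "(\<Sum>n\<in>{1..<m}. f n) = (\<Sum>n\<in>{1..<m}. 1 / (real n + 1) - 1 / (real (Suc n) + 1))"
    by (intro sum.cong) (auto simp: f_def val field_simps)
  also have "... = 1 / 2 - 1 / (real m + 1)"
    using sum_Suc_diff'[of 1 m "\<lambda>n. - (1 / (real n + 1))"] m by simp
  also have "... = (real m - 1) / (2 * (real m + 1))" by (simp add: field_simps)
  finally show ?thesis unfolding f_def .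
qed

text \<open>The slope given by the transfer is the toll series divided by H_m - 1; the two evaluated
  series identify it with the entries of v*.\<close>

lemma unit_weight_mean:
  assumes m: "m \<ge> 3" and g: "rate m g" "g < 1" and k: "k \<le> m"
  shows "\<exists>K. \<forall>n. \<bar>stat_mean m (unit_weight k) n (\<lambda>x. x) - vstar m k * real n\<bar> \<le> K * (real n + 1) powr g"
proof -
  have "0 < g" using g by (simp add: rate_def)
  then have b: "\<bar>unit_weight_toll m k n\<bar> \<le> 1 * (real n + 1) powr g" for n
    using order_trans[OF unit_weight_toll_bound[of m k n] ge_one_powr_ge_zero[of "real n + 1" g]] m by simp
  have h: "harm m - 1 \<noteq> (0 :: real)" using harm_gt_1[of m] m by simp
  have "(\<Sum>n. unit_weight_toll m k n / real ((n + 1) * (n + 2))) / (harm m - 1) = vstar m k"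
  proof (cases "k = 0")
    case True
    have "(\<Sum>n. unit_weight_toll m k n / real ((n + 1) * (n + 2))) = (real m - 1) / (2 * (real m + 1))"
      using sums_unit_weight_toll_0[of m] m True sums_unique[symmetric] by (simp only:) auto
    then show ?thesis using True by (simp add: vstar_def mult.assoc)
  next
    case False
    have "(\<Sum>n. unit_weight_toll m k n / real ((n + 1) * (n + 2))) = 1 / (real m * (real m + 1))"
      using sums_unit_weight_toll_pos[of m k] m k False by (intro sums_unique[symmetric]) auto
    then show ?thesis using False by (simp add: vstar_def mult.assoc)
  qed
  then show ?thesis
    using split_rec_linear[OF m split_rec_unit_weight g b] m by simp
qed

section \<open>Linear statistics and their Gaussian comparison\<close>

definition drift :: "nat \<Rightarrow> (nat \<Rightarrow> real) \<Rightarrow> real" where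
  "drift m t = (\<Sum>k\<le>m. t k * vstar m k)"

lemma stat_mean_linear: "stat_mean m t n (\<lambda>x. x) = (\<Sum>k\<le>m. t k * stat_mean m (unit_weight k) n (\<lambda>x. x))"
  unfolding stat_mean_def by (subst stat_linear) (simp add: avg_sum avg_cmult)

lemma mean_bound:
  assumes m: "m \<ge> 3" and g: "rate m g" "g < 1"
  shows "\<exists>K. \<forall>n. \<bar>stat_mean m t n (\<lambda>x. x - drift m t * real n)\<bar> \<le> K * (real n + 1) powr g"
proof -
  obtain K where K: "\<And>k n. k \<le> m \<Longrightarrow> \<bar>stat_mean m (unit_weight k) n (\<lambda>x. x) - vstar m k * real n\<bar> \<le> K k * (real n + 1) powr g"
    using unit_weight_mean[OF m g] by metis
  have "\<bar>stat_mean m t n (\<lambda>x. x - drift m t * real n)\<bar> \<le> (\<Sum>k\<le>m. \<bar>t k\<bar> * K k) * (real n + 1) powr g" for n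
  proof -
    have "stat_mean m t n (\<lambda>x. x - drift m t * real n) = (\<Sum>k\<le>m. t k * (stat_mean m (unit_weight k) n (\<lambda>x. x) - vstar m k * real n))"
      by (simp add: stat_mean_diff stat_mean_linear[of m t] drift_def sum_subtractf sum_distrib_right right_diff_distrib mult.assoc)
    also have "\<bar>...\<bar> \<le> (\<Sum>k\<le>m. \<bar>t k * (stat_mean m (unit_weight k) n (\<lambda>x. x) - vstar m k * real n)\<bar>)" by (rule sum_abs)
    also have "... \<le> (\<Sum>k\<le>m. \<bar>t k\<bar> * (K k * (real n + 1) powr g))"
      unfolding abs_mult using K by (intro sum_mono mult_left_mono) auto
    finally show ?thesis by (simp add: sum_distrib_right mult.assoc)
  qed
  then show ?thesis by blast
qed

text \<open>With \<alpha> < 1/2 the exponent 2 \<alpha> of the variance stays below 1, where a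
  linear term can be extracted, and 3 \<alpha> stays below 3/2, as the final limit requires;
  \<alpha> > 1/3 lifts 3 \<alpha> above 1, where the plain bound applies.\<close>

locale search_tree =
  fixes m :: nat and t :: "nat \<Rightarrow> real" and \<alpha> :: real
  assumes m: "m \<ge> 3" and \<alpha>: "1 / 3 < \<alpha>" "\<alpha> < 1 / 2" and rate: "rate m \<alpha>"
begin

definition c :: real where "c = drift m t"
definition bias :: "nat \<Rightarrow> real" where "bias n = stat_mean m t n (\<lambda>x. x - c * real n)"
definition stat_var :: "nat \<Rightarrow> real" where "stat_var n = stat_mean m t n (\<lambda>x. (x - c * real n - bias n)\<^sup>2)"
definition w :: "nat \<Rightarrow> real" where "w n = (real n + 1) powr \<alpha>"
text \<open>Given subtree sizes N, \<open>mean_shift\<close> and \<open>var_shift\<close> measure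
  how far the conditional mean and the total variance of the subtrees deviate from the mean and
  variance at n.\<close>

definition mean_shift :: "nat \<Rightarrow> nat list \<Rightarrow> real" where
  "mean_shift n N = toll m t c N + (\<Sum>j<m. bias (N ! j)) - bias n"
definition var_shift :: "nat \<Rightarrow> nat list \<Rightarrow> real" where
  "var_shift n N = (\<Sum>j<m. stat_var (N ! j)) - stat_var n"
definition stat_char :: "nat \<Rightarrow> real \<Rightarrow> complex" where
  "stat_char n s = stat_mean m t n (\<lambda>x. cis (s * (x - c * real n)))"
text \<open>The exact mean and variance at n are used, rather than their linear approximations, so
  that the two leading orders of the one-step error cancel exactly.\<close>

definition gauss_char :: "nat \<Rightarrow> real \<Rightarrow> complex" where
  "gauss_char n s = exp (Complex (- (s\<^sup>2 * stat_var n) / 2) (s * bias n))"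

abbreviation gauss_mix :: "nat \<Rightarrow> real \<Rightarrow> complex" where
  "gauss_mix n s \<equiv> split_mean m n (\<lambda>N. cis (s * toll m t c N) * (\<Prod>j<m. gauss_char (N ! j) s))"

lemma m2: "m \<ge> 2" using m by simp

lemma w_ge_1: "1 \<le> w n"
  unfolding w_def using \<alpha> by (intro ge_one_powr_ge_zero) auto

lemma w_mono: "k \<le> n \<Longrightarrow> w k \<le> w n"
  unfolding w_def using \<alpha> by (intro powr_mono2) auto

lemma w_power: "(w n) ^ k = (real n + 1) powr (real k * \<alpha>)"
  unfolding w_def by (simp add: powr_powr[symmetric] powr_realpow mult.commute[of "real k"])

lemma w_sub: "N \<in> splits m n \<Longrightarrow> j < m \<Longrightarrow> w (N ! j) \<le> w n"
  using natpermute_nth_le[of N "n - (m - 1)" m j] by (intro w_mono) auto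

lemma bias_bound: "\<exists>K\<ge>0. \<forall>n. \<bar>bias n\<bar> \<le> K * w n"
proof -
  obtain K where K: "\<And>n. \<bar>bias n\<bar> \<le> K * w n"
    using mean_bound[OF m rate, of t] \<alpha> unfolding bias_def c_def w_def by auto
  moreover have "K \<ge> 0" using order_trans[OF abs_ge_zero K[of 0]] by (simp add: w_def)
  ultimately show ?thesis by blast
qed

lemma toll_bound: "\<bar>toll m t c N\<bar> \<le> (\<Sum>k\<le>m. \<bar>t k\<bar>) + \<bar>c\<bar> * real m"
proof -
  have "\<bar>t (nonzeros m N)\<bar> \<le> (\<Sum>k\<le>m. \<bar>t k\<bar>)"
    using nonzeros_le[of m N] by (intro member_le_sum[where f = "\<lambda>k. \<bar>t k\<bar>"]) auto
  moreover have "\<bar>c * real (m - 1)\<bar> \<le> \<bar>c\<bar> * real m" unfolding abs_mult by (intro mult_left_mono) auto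
  ultimately show ?thesis unfolding toll_def by linarith
qed

lemma mean_shift_bound: "\<exists>K\<ge>0. \<forall>n. \<forall>N\<in>splits m n. \<bar>mean_shift n N\<bar> \<le> K * w n"
proof -
  obtain K where K: "K \<ge> 0" "\<And>n. \<bar>bias n\<bar> \<le> K * w n" using bias_bound by blast
  define T where "T = (\<Sum>k\<le>m. \<bar>t k\<bar>) + \<bar>c\<bar> * real m"
  have T: "T \<ge> 0" unfolding T_def by (intro add_nonneg_nonneg sum_nonneg) auto
  have "\<bar>mean_shift n N\<bar> \<le> (T + (real m + 1) * K) * w n" if N: "N \<in> splits m n" for n N
  proof -
    have "\<bar>\<Sum>j<m. bias (N ! j)\<bar> \<le> (\<Sum>j<m. \<bar>bias (N ! j)\<bar>)" by (rule sum_abs)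
    also have "... \<le> (\<Sum>j<m. K * w n)"
      by (intro sum_mono order_trans[OF K(2)] mult_left_mono K(1)) (use w_sub[OF N] in auto)
    finally have "\<bar>\<Sum>j<m. bias (N ! j)\<bar> \<le> real m * K * w n" by simp
    moreover have "\<bar>toll m t c N\<bar> \<le> T * w n"
      using order_trans[OF toll_bound[of N, folded T_def]] mult_left_mono[OF w_ge_1[of n] T] by simp
    ultimately show ?thesis unfolding mean_shift_def using K(2)[of n] by (simp add: distrib_right)
  qed
  moreover have "T + (real m + 1) * K \<ge> 0" using T K by simp
  ultimately show ?thesis by blast
qed

lemma split_mean_mean_shift:
  assumes n: "m - 1 \<le> n" shows "split_mean m n (mean_shift n) = 0"
proof -
  have "split_mean m n (mean_shift n) = split_mean m n (\<lambda>N. toll m t c N + (\<Sum>j<m. bias (N ! j))) - split_mean m n (\<lambda>_. bias n)"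
    unfolding mean_shift_def by (rule split_mean_diff)
  also have "split_mean m n (\<lambda>N. toll m t c N + (\<Sum>j<m. bias (N ! j))) = bias n"
    unfolding bias_def by (rule mean_split[OF m2 n, symmetric])
  finally show ?thesis by (simp add: split_mean_const[OF m2 n])
qed

lemma stat_var_split:
  assumes n: "m - 1 \<le> n"
  shows "stat_var n = split_mean m n (\<lambda>N. (mean_shift n N)\<^sup>2) + split_mean m n (\<lambda>N. \<Sum>j<m. stat_var (N ! j))"
  using variance_split[OF m2 n, of bias t c] unfolding stat_var_def mean_shift_def
  by (simp add: bias_def split_mean_add)

text \<open>Total variance, read as the vanishing of the average of var_shift + mean_shift^2: this
  removes the s^2 term in the comparison with the Gaussian.\<close>

lemma split_mean_var_shift:
  assumes n: "m - 1 \<le> n" shows "split_mean m n (var_shift n) = - split_mean m n (\<lambda>N. (mean_shift n N)\<^sup>2)"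
proof -
  have "split_mean m n (var_shift n) = split_mean m n (\<lambda>N. \<Sum>j<m. stat_var (N ! j)) - split_mean m n (\<lambda>_. stat_var n)"
    unfolding var_shift_def by (rule split_mean_diff)
  then show ?thesis using stat_var_split[OF n] by (simp add: split_mean_const[OF m2 n])
qed

lemma small_tree:
  assumes "n < m"
  shows "stat_var n = 0" "stat_char n s = gauss_char n s"
proof -
  have bias: "bias n = (if n = 0 then 0 else t 0) - c * real n" unfolding bias_def using assms by (subst stat_mean_small) auto
  show stat_var: "stat_var n = 0" unfolding stat_var_def using assms bias by (subst stat_mean_small) auto
  have "exp (Complex 0 x) = cis x" for x by (simp add: cis_conv_exp Complex_eq)
  then show "stat_char n s = gauss_char n s" unfolding stat_char_def gauss_char_def stat_var using assms bias
    by (subst stat_mean_small) auto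
qed

lemma stat_var_nonneg: "stat_var n \<ge> 0"
  unfolding stat_var_def stat_mean_def avg_def by (intro divide_nonneg_nonneg sum_nonneg) auto

text \<open>The variance solves the same recurrence with the second moment of
  \<open>mean_shift\<close> as toll. This is of order n^(2 \<alpha>) with 2 \<alpha> < 1, so the
  linear regime applies again.\<close>

lemma stat_var_linear: "\<exists>\<sigma> K. K \<ge> 0 \<and> (\<forall>n. \<bar>stat_var n - \<sigma> * real n\<bar> \<le> K * (w n)\<^sup>2)"
proof -
  obtain K where K: "K \<ge> 0" "\<And>n N. N \<in> splits m n \<Longrightarrow> \<bar>mean_shift n N\<bar> \<le> K * w n"
    using mean_shift_bound by blast
  define b where "b = (\<lambda>n. if n < m - 1 then 0 else split_mean m n (\<lambda>N. (mean_shift n N)\<^sup>2))"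
  have rec: "split_rec m stat_var b"
    unfolding split_rec_def b_def
    using small_tree(1) stat_var_split by (auto simp: split_mean_def[of m _ "\<lambda>N. \<Sum>j<m. stat_var (N ! j)"])
  have bb: "\<bar>b n\<bar> \<le> K\<^sup>2 * (real n + 1) powr (2 * \<alpha>)" for n
  proof (cases "n < m - 1")
    case True then show ?thesis by (simp add: b_def)
  next
    case False
    then have n: "m - 1 \<le> n" by simp
    have "\<bar>b n\<bar> \<le> split_mean m n (\<lambda>N. \<bar>(mean_shift n N)\<^sup>2\<bar>)"
      using False split_mean_norm[of m n "\<lambda>N. (mean_shift n N)\<^sup>2"] by (simp add: b_def)
    also have "... \<le> split_mean m n (\<lambda>_. (K * w n)\<^sup>2)"
    proof (rule split_mean_mono)
      fix N assume "N \<in> splits m n"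
      then have "\<bar>mean_shift n N\<bar>\<^sup>2 \<le> (K * w n)\<^sup>2" by (intro power_mono K) auto
      then show "\<bar>(mean_shift n N)\<^sup>2\<bar> \<le> (K * w n)\<^sup>2" by simp
    qed
    also have "... = K\<^sup>2 * (real n + 1) powr (2 * \<alpha>)"
      using split_mean_const[OF m2 n] w_power[of n 2] by (simp add: power_mult_distrib)
    finally show ?thesis .
  qed
  have r2: "rate m (2 * \<alpha>)" using rate_mono[OF rate, of "2 * \<alpha>"] \<alpha> by simp
  have lt1: "2 * \<alpha> < 1" using \<alpha> by simp
  define \<sigma> where "\<sigma> = (\<Sum>n. b n / real ((n + 1) * (n + 2))) / (harm m - 1)"
  obtain K' where K': "\<And>n. \<bar>stat_var n - \<sigma> * real n\<bar> \<le> K' * (real n + 1) powr (2 * \<alpha>)"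
    using split_rec_linear[OF m rec r2 lt1 bb] unfolding \<sigma>_def by blast
  have "K' \<ge> 0" using order_trans[OF abs_ge_zero K'[of 0]] by simp
  then show ?thesis using K' w_power[of _ 2] by (intro exI[of _ \<sigma>] exI[of _ K']) simp
qed

text \<open>The variances themselves may have order n, but their linear parts cancel up to a
  constant because the subtree sizes add up to n - (m - 1).\<close>

lemma var_shift_bound: "\<exists>K\<ge>0. \<forall>n\<ge>m - 1. \<forall>N\<in>splits m n. \<bar>var_shift n N\<bar> \<le> K * (w n)\<^sup>2"
proof -
  obtain \<sigma> K where K: "K \<ge> 0" "\<And>n. \<bar>stat_var n - \<sigma> * real n\<bar> \<le> K * (w n)\<^sup>2" using stat_var_linear by blast
  have "\<bar>var_shift n N\<bar> \<le> (\<bar>\<sigma>\<bar> * real m + (real m + 1) * K) * (w n)\<^sup>2"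
    if n: "m - 1 \<le> n" and N: "N \<in> splits m n" for n N
  proof -
    have s: "(\<Sum>j<m. \<sigma> * real (N ! j)) = \<sigma> * real n - \<sigma> * real (m - 1)"
      using natpermute_sum[OF m2 n N] by (simp add: sum_distrib_left[symmetric] right_diff_distrib)
    have eq: "var_shift n N = (\<Sum>j<m. stat_var (N ! j) - \<sigma> * real (N ! j)) - (stat_var n - \<sigma> * real n) - \<sigma> * real (m - 1)"
      unfolding var_shift_def sum_subtractf s by simp
    have "\<bar>\<Sum>j<m. stat_var (N ! j) - \<sigma> * real (N ! j)\<bar> \<le> (\<Sum>j<m. \<bar>stat_var (N ! j) - \<sigma> * real (N ! j)\<bar>)" by (rule sum_abs)
    also have "... \<le> (\<Sum>j<m. K * (w n)\<^sup>2)"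
    proof (rule sum_mono)
      fix j assume "j \<in> {..<m}"
      then have "(w (N ! j))\<^sup>2 \<le> (w n)\<^sup>2" using w_sub[OF N] order_trans[OF _ w_ge_1[of "N ! j"], of 0]
        by (intro power_mono) auto
      then show "\<bar>stat_var (N ! j) - \<sigma> * real (N ! j)\<bar> \<le> K * (w n)\<^sup>2"
        using K(2)[of "N ! j"] mult_left_mono[OF _ K(1)] by (meson order_trans)
    qed
    finally have 1: "\<bar>\<Sum>j<m. stat_var (N ! j) - \<sigma> * real (N ! j)\<bar> \<le> real m * K * (w n)\<^sup>2" by simp
    have "1 \<le> (w n)\<^sup>2" using w_ge_1[of n] by simp
    then have "\<bar>\<sigma>\<bar> * real m * 1 \<le> \<bar>\<sigma>\<bar> * real m * (w n)\<^sup>2" by (intro mult_left_mono) auto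
    moreover have "\<bar>\<sigma> * real (m - 1)\<bar> \<le> \<bar>\<sigma>\<bar> * real m" unfolding abs_mult by (intro mult_left_mono) auto
    moreover have "\<bar>var_shift n N\<bar> \<le> \<bar>\<Sum>j<m. stat_var (N ! j) - \<sigma> * real (N ! j)\<bar> + \<bar>stat_var n - \<sigma> * real n\<bar> +
        \<bar>\<sigma> * real (m - 1)\<bar>" unfolding eq by linarith
    moreover have "(\<bar>\<sigma>\<bar> * real m + (real m + 1) * K) * (w n)\<^sup>2 =
        \<bar>\<sigma>\<bar> * real m * (w n)\<^sup>2 + real m * K * (w n)\<^sup>2 + K * (w n)\<^sup>2" by (simp add: algebra_simps)
    ultimately show ?thesis using 1 K(2)[of n] by linarith
  qed
  moreover have "\<bar>\<sigma>\<bar> * real m + (real m + 1) * K \<ge> 0" using K by simp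
  ultimately show ?thesis by blast
qed

lemma norm_gauss_char: "cmod (gauss_char n s) \<le> 1"
  unfolding gauss_char_def using stat_var_nonneg[of n] by (simp add: norm_exp_eq_Re)

lemma norm_stat_char: "cmod (stat_char n s) \<le> 1"
  unfolding stat_char_def stat_mean_def by (rule avg_norm_le) auto

lemma gauss_char_split:
  "cis (s * toll m t c N) * (\<Prod>j<m. gauss_char (N ! j) s) = gauss_char n s * exp (Complex (- (s\<^sup>2 * var_shift n N) / 2) (s * mean_shift n N))"
proof -
  have "cis (s * toll m t c N) * (\<Prod>j<m. gauss_char (N ! j) s) =
      exp (\<i> * of_real (s * toll m t c N) + (\<Sum>j<m. Complex (- (s\<^sup>2 * stat_var (N ! j)) / 2) (s * bias (N ! j))))"
    unfolding gauss_char_def cis_conv_exp by (simp add: exp_add exp_sum)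
  also have "\<i> * of_real (s * toll m t c N) + (\<Sum>j<m. Complex (- (s\<^sup>2 * stat_var (N ! j)) / 2) (s * bias (N ! j))) =
      Complex (- (s\<^sup>2 * stat_var n) / 2) (s * bias n) + Complex (- (s\<^sup>2 * var_shift n N) / 2) (s * mean_shift n N)"
    by (simp add: complex_eq_iff mean_shift_def var_shift_def sum_divide_distrib[symmetric] sum_negf sum_distrib_left[symmetric] algebra_simps)
  finally show ?thesis unfolding gauss_char_def by (simp add: exp_add)
qed

lemma exp_taylor_2: "cmod (exp u - 1 - u - u\<^sup>2 / 2) \<le> exp (cmod u) * cmod u ^ 3"
proof -
  have "cmod (exp u - (\<Sum>k\<le>2. u ^ k / fact k)) \<le> exp \<bar>Re u\<bar> * (cmod u) ^ Suc 2 / fact 2"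
    by (rule Taylor_exp)
  also have "... \<le> exp \<bar>Re u\<bar> * (cmod u) ^ Suc 2"
    by (simp add: mult_nonneg_nonneg)
  also have "... \<le> exp (cmod u) * cmod u ^ 3"
    by (intro mult_mono) (auto simp: abs_Re_le_cmod numeral_3_eq_3)
  finally show ?thesis by (simp add: numeral_2_eq_2 algebra_simps)
qed

lemma split_mean_Complex:
  "split_mean m n (\<lambda>N. Complex (F N) (G N)) = Complex (split_mean m n F) (split_mean m n G)"
  unfolding split_mean_def by (simp add: complex_eq_iff Re_divide_of_nat Im_divide_of_nat)

text \<open>The error of one split when every subtree is replaced by its Gaussian. After factoring
  out \<open>gauss_char n s\<close> it is the average of exp U - 1, whose terms of first and second
  order in s average to 0.\<close>

lemma gauss_char_error:
  assumes M: "M > 0"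
  shows "\<exists>K\<ge>0. \<forall>n\<ge>m - 1. \<forall>s. \<bar>s\<bar> \<le> M / sqrt (real n + 1) \<longrightarrow>
    cmod (gauss_mix n s - gauss_char n s) \<le> \<bar>s\<bar> ^ 3 * (K * (w n) ^ 3)"
proof -
  obtain KA where KA: "KA \<ge> 0" "\<And>n N. N \<in> splits m n \<Longrightarrow> \<bar>mean_shift n N\<bar> \<le> KA * w n"
    using mean_shift_bound by blast
  obtain KB where KB: "KB \<ge> 0" "\<And>n N. m - 1 \<le> n \<Longrightarrow> N \<in> splits m n \<Longrightarrow> \<bar>var_shift n N\<bar> \<le> KB * (w n)\<^sup>2"
    using var_shift_bound by blast
  define K3 where "K3 = KA + M * KB"
  have K3: "K3 \<ge> 0" using KA KB M by (simp add: K3_def)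
  \<comment> \<open>The summands account for the Taylor remainder of exp, the squared variance term
    (with r^4 reduced to M r^3) and the product of mean and variance terms.\<close>
  define K where "K = exp (M * K3) * K3 ^ 3 + (M * KB\<^sup>2 + KA * KB)"
  have K: "K \<ge> 0" using KA KB K3 M by (simp add: K_def)
  have "cmod (gauss_mix n s - gauss_char n s) \<le> \<bar>s\<bar> ^ 3 * (K * (w n) ^ 3)"
    if n: "m - 1 \<le> n" and s: "\<bar>s\<bar> \<le> M / sqrt (real n + 1)" for n s
  proof -
    \<comment> \<open>The natural scale of the expansion: the imaginary part of U has order r and
      the real part order r^2. The restriction on s, with w n \<le> sqrt (n + 1), keeps r below
      M.\<close>
    define r where "r = \<bar>s\<bar> * w n"
    have w0: "0 < w n" using w_ge_1[of n] by linarith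
    have r0: "r \<ge> 0" using w0 by (simp add: r_def)
    have "w n \<le> (real n + 1) powr (1 / 2)" unfolding w_def using \<alpha> by (intro powr_mono) auto
    then have wn: "w n \<le> sqrt (real n + 1)" by (simp add: powr_half_sqrt)
    have rM: "r \<le> M"
    proof -
      have "r \<le> M / sqrt (real n + 1) * sqrt (real n + 1)"
        unfolding r_def using s wn w0 M by (intro mult_mono) auto
      also have "... = M" by simp
      finally show ?thesis .
    qed
    define U where "U = (\<lambda>N. Complex (- (s\<^sup>2 * var_shift n N) / 2) (s * mean_shift n N))"
    have sA: "\<bar>s * mean_shift n N\<bar> \<le> KA * r" if "N \<in> splits m n" for N
      using mult_left_mono[OF KA(2)[OF that], of "\<bar>s\<bar>"] by (simp add: abs_mult r_def mult_ac)
    have sB: "\<bar>s\<^sup>2 * var_shift n N\<bar> \<le> KB * r\<^sup>2" if "N \<in> splits m n" for N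
      using mult_left_mono[OF KB(2)[OF n that], of "s\<^sup>2"] by (simp add: abs_mult r_def power_mult_distrib mult_ac)
    have r2: "r\<^sup>2 \<le> M * r" unfolding power2_eq_square using rM r0 by (intro mult_right_mono) auto
    have U_le: "cmod (U N) \<le> K3 * r" if N: "N \<in> splits m n" for N
    proof -
      have "cmod (U N) \<le> \<bar>- (s\<^sup>2 * var_shift n N) / 2\<bar> + \<bar>s * mean_shift n N\<bar>"
        using cmod_le[of "U N"] by (simp add: U_def)
      also have "... \<le> KB * r\<^sup>2 + KA * r" using sA[OF N] sB[OF N] by simp
      also have "... \<le> KB * (M * r) + KA * r" using mult_left_mono[OF r2 KB(1)] by simp
      finally show ?thesis by (simp add: K3_def algebra_simps)
    qed
    have rem: "cmod (split_mean m n (\<lambda>N. exp (U N) - 1 - U N - (U N)\<^sup>2 / 2)) \<le> exp (M * K3) * K3 ^ 3 * r ^ 3"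
    proof -
      have "cmod (split_mean m n (\<lambda>N. exp (U N) - 1 - U N - (U N)\<^sup>2 / 2)) \<le>
          split_mean m n (\<lambda>N. cmod (exp (U N) - 1 - U N - (U N)\<^sup>2 / 2))" by (rule split_mean_norm)
      also have "... \<le> split_mean m n (\<lambda>_. exp (M * K3) * (K3 * r) ^ 3)"
      proof (rule split_mean_mono)
        fix N assume N: "N \<in> splits m n"
        have "K3 * r \<le> M * K3" using mult_left_mono[OF rM K3] by (simp add: mult.commute)
        then have "exp (cmod (U N)) \<le> exp (M * K3)" using U_le[OF N] by simp
        then have "exp (cmod (U N)) * cmod (U N) ^ 3 \<le> exp (M * K3) * (K3 * r) ^ 3"
          using U_le[OF N] by (intro mult_mono power_mono) auto
        then show "cmod (exp (U N) - 1 - U N - (U N)\<^sup>2 / 2) \<le> exp (M * K3) * (K3 * r) ^ 3"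
          using exp_taylor_2[of "U N"] by linarith
      qed
      finally show ?thesis by (simp add: split_mean_const[OF m2 n] power_mult_distrib mult.assoc)
    qed
    have main: "cmod (split_mean m n (\<lambda>N. U N + (U N)\<^sup>2 / 2)) \<le> (M * KB\<^sup>2 + KA * KB) * r ^ 3"
    proof -
      \<comment> \<open>Real and imaginary parts of U + U^2 / 2, grouped so that the s^2 part of F
        and the part of G linear in s average to 0; what remains has order r^4 and r^3.\<close>
      define F where "F = (\<lambda>N. - (s\<^sup>2 / 2) * (var_shift n N + (mean_shift n N)\<^sup>2) + (s\<^sup>2 * var_shift n N)\<^sup>2 / 8)"
      define G where "G = (\<lambda>N. s * mean_shift n N - (s * mean_shift n N) * (s\<^sup>2 * var_shift n N) / 2)"
      have "Complex (- x / 2) y + (Complex (- x / 2) y)\<^sup>2 / 2 =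
          Complex (- x / 2 - y\<^sup>2 / 2 + x\<^sup>2 / 8) (y - y * x / 2)" for x y
        by (simp add: complex_eq_iff power2_eq_square field_simps)
      moreover have "F N = - (s\<^sup>2 * var_shift n N) / 2 - (s * mean_shift n N)\<^sup>2 / 2 + (s\<^sup>2 * var_shift n N)\<^sup>2 / 8" for N
        by (simp add: F_def power_mult_distrib algebra_simps)
      ultimately have UF: "U N + (U N)\<^sup>2 / 2 = Complex (F N) (G N)" for N
        by (simp only: U_def G_def)
      have "split_mean m n (\<lambda>N. var_shift n N + (mean_shift n N)\<^sup>2) = 0"
        using split_mean_var_shift[OF n] by (simp add: split_mean_add)
      then have F: "split_mean m n F = split_mean m n (\<lambda>N. (s\<^sup>2 * var_shift n N)\<^sup>2 / 8)"
        unfolding F_def by (simp only: split_mean_add split_mean_cmult)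
      have "split_mean m n G = s * split_mean m n (mean_shift n) - split_mean m n (\<lambda>N. (s * mean_shift n N) * (s\<^sup>2 * var_shift n N) / 2)"
        unfolding G_def by (simp only: split_mean_diff split_mean_cmult)
      then have G: "split_mean m n G = - split_mean m n (\<lambda>N. (s * mean_shift n N) * (s\<^sup>2 * var_shift n N) / 2)"
        by (simp add: split_mean_mean_shift[OF n])
      have 1: "\<bar>split_mean m n F\<bar> \<le> M * KB\<^sup>2 * r ^ 3"
      proof -
        have "\<bar>split_mean m n F\<bar> \<le> split_mean m n (\<lambda>N. \<bar>(s\<^sup>2 * var_shift n N)\<^sup>2 / 8\<bar>)"
          unfolding F using split_mean_norm[of m n "\<lambda>N. (s\<^sup>2 * var_shift n N)\<^sup>2 / 8"] by simp
        also have "... \<le> split_mean m n (\<lambda>_. (KB * r\<^sup>2)\<^sup>2)"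
        proof (rule split_mean_mono)
          fix N assume "N \<in> splits m n"
          then have "\<bar>s\<^sup>2 * var_shift n N\<bar>\<^sup>2 \<le> (KB * r\<^sup>2)\<^sup>2" by (intro power_mono sB) auto
          moreover have "\<bar>x\<^sup>2 / 8\<bar> \<le> \<bar>x\<bar>\<^sup>2" for x :: real by simp
          ultimately show "\<bar>(s\<^sup>2 * var_shift n N)\<^sup>2 / 8\<bar> \<le> (KB * r\<^sup>2)\<^sup>2" by (rule order_trans[rotated])
        qed
        also have "... = KB\<^sup>2 * (r ^ 3 * r)"
          by (simp add: split_mean_const[OF m2 n] power_mult_distrib eval_nat_numeral)
        also have "... \<le> KB\<^sup>2 * (r ^ 3 * M)" using r0 rM by (intro mult_left_mono) auto
        finally show ?thesis by (simp add: mult_ac)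
      qed
      have 2: "\<bar>split_mean m n G\<bar> \<le> KA * KB * r ^ 3"
      proof -
        have "\<bar>split_mean m n G\<bar> \<le> split_mean m n (\<lambda>N. \<bar>(s * mean_shift n N) * (s\<^sup>2 * var_shift n N) / 2\<bar>)"
          unfolding G using split_mean_norm[of m n "\<lambda>N. (s * mean_shift n N) * (s\<^sup>2 * var_shift n N) / 2"] by simp
        also have "... \<le> split_mean m n (\<lambda>_. (KA * r) * (KB * r\<^sup>2))"
        proof (rule split_mean_mono)
          fix N assume N: "N \<in> splits m n"
          have "\<bar>s * mean_shift n N\<bar> * \<bar>s\<^sup>2 * var_shift n N\<bar> \<le> (KA * r) * (KB * r\<^sup>2)"
            using KA(1) r0 by (intro mult_mono sA sB N) auto
          then show "\<bar>(s * mean_shift n N) * (s\<^sup>2 * var_shift n N) / 2\<bar> \<le> (KA * r) * (KB * r\<^sup>2)"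
            unfolding abs_mult[symmetric] by simp
        qed
        also have "... = KA * KB * r ^ 3" by (simp add: split_mean_const[OF m2 n] eval_nat_numeral)
        finally show ?thesis .
      qed
      have "cmod (Complex (split_mean m n F) (split_mean m n G)) \<le> \<bar>split_mean m n F\<bar> + \<bar>split_mean m n G\<bar>"
        using cmod_le[of "Complex (split_mean m n F) (split_mean m n G)"] by simp
      then show ?thesis unfolding UF split_mean_Complex using 1 2 by (simp add: distrib_right)
    qed
    have "split_mean m n (\<lambda>N. exp (U N)) - 1 =
        split_mean m n (\<lambda>N. (exp (U N) - 1 - U N - (U N)\<^sup>2 / 2) + (U N + (U N)\<^sup>2 / 2))"
      using split_mean_diff[of m n "\<lambda>N. exp (U N)" "\<lambda>_. 1"] split_mean_const[OF m2 n, of "1 :: complex"] by simp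
    then have "cmod (split_mean m n (\<lambda>N. exp (U N)) - 1) \<le>
        cmod (split_mean m n (\<lambda>N. exp (U N) - 1 - U N - (U N)\<^sup>2 / 2)) + cmod (split_mean m n (\<lambda>N. U N + (U N)\<^sup>2 / 2))"
      by (simp only: split_mean_add norm_triangle_ineq)
    also have "... \<le> K * r ^ 3" using rem main by (simp add: K_def distrib_right)
    finally have e: "cmod (split_mean m n (\<lambda>N. exp (U N)) - 1) \<le> K * r ^ 3" .
    have eq: "gauss_mix n s - gauss_char n s =
        gauss_char n s * (split_mean m n (\<lambda>N. exp (U N)) - 1)"
      unfolding gauss_char_split[of s _ n] U_def split_mean_cmult by (simp add: algebra_simps)
    have "cmod (gauss_char n s) * cmod (split_mean m n (\<lambda>N. exp (U N)) - 1) \<le> 1 * (K * r ^ 3)"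
      by (intro mult_mono norm_gauss_char e) auto
    then have "cmod (gauss_mix n s - gauss_char n s) \<le> 1 * (K * r ^ 3)"
      unfolding eq norm_mult .
    then show ?thesis by (simp add: r_def power_mult_distrib mult_ac)
  qed
  then show ?thesis using K by blast
qed

text \<open>The range of \<open>s\<close> shrinks with \<open>n\<close>, so the induction hypothesis applies to all subtrees at the same \<open>s\<close>.\<close>

lemma stat_char_error:
  assumes M: "M > 0"
  shows "\<exists>K. \<forall>n s. \<bar>s\<bar> \<le> M / sqrt (real n + 1) \<longrightarrow> cmod (stat_char n s - gauss_char n s) \<le> \<bar>s\<bar> ^ 3 * (K * (w n) ^ 3)"
proof -
  obtain K where K: "K \<ge> 0" "\<And>n s. m - 1 \<le> n \<Longrightarrow> \<bar>s\<bar> \<le> M / sqrt (real n + 1) \<Longrightarrow>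
    cmod (gauss_mix n s - gauss_char n s) \<le> \<bar>s\<bar> ^ 3 * (K * (w n) ^ 3)"
    using gauss_char_error[OF M] by blast
  \<comment> \<open>Trees with fewer than m - 1 keys are deterministic and have no error, hence the
    value 0. The solution h for this toll dominates the error divided by the cube of
    \<bar>s\<bar>.\<close>
  define b where "b = (\<lambda>n. if n < m - 1 then 0 else K * (w n) ^ 3)"
  define h where "h = split_sol m b"
  have rec: "split_rec m h b" unfolding h_def by (rule split_rec_split_sol[OF m2])
  have le: "cmod (stat_char n s - gauss_char n s) \<le> \<bar>s\<bar> ^ 3 * h n" if "\<bar>s\<bar> \<le> M / sqrt (real n + 1)" for n s
    using that
  proof (induction n rule: less_induct)
    case (less n)
    show ?case
    proof (cases "n < m - 1")
      case True
      then have "h n = 0" using rec by (simp add: split_rec_def b_def)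
      then show ?thesis using small_tree(2)[of n s] True by simp
    next
      case False
      then have n: "m - 1 \<le> n" by simp
      have sub: "cmod (stat_char (N ! j) s - gauss_char (N ! j) s) \<le> \<bar>s\<bar> ^ 3 * h (N ! j)"
        if N: "N \<in> splits m n" and j: "j < m" for N j
      proof (rule less.IH)
        have Nj: "N ! j \<le> n - (m - 1)" by (rule natpermute_nth_le[OF N j])
        then show "N ! j < n" using n m by linarith
        have "N ! j \<le> n" using Nj by linarith
        then have "M / sqrt (real n + 1) \<le> M / sqrt (real (N ! j) + 1)"
          using M by (intro divide_left_mono) auto
        then show "\<bar>s\<bar> \<le> M / sqrt (real (N ! j) + 1)" using less.prems by linarith
      qed
      define P Q where "P = split_mean m n (\<lambda>N. cis (s * toll m t c N) * (\<Prod>j<m. stat_char (N ! j) s))"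
        and "Q = gauss_mix n s"
      have "stat_char n s = P" unfolding P_def stat_char_def by (rule char_split[OF m2 n])
      have "cmod (P - Q) \<le> split_mean m n (\<lambda>N. cmod (cis (s * toll m t c N) * (\<Prod>j<m. stat_char (N ! j) s) -
          cis (s * toll m t c N) * (\<Prod>j<m. gauss_char (N ! j) s)))"
        unfolding P_def Q_def split_mean_diff[symmetric] by (rule split_mean_norm)
      also have "... \<le> split_mean m n (\<lambda>N. \<bar>s\<bar> ^ 3 * (\<Sum>j<m. h (N ! j)))"
      proof (rule split_mean_mono)
        fix N assume N: "N \<in> splits m n"
        have "cmod (cis (s * toll m t c N) * (\<Prod>j<m. stat_char (N ! j) s) - cis (s * toll m t c N) * (\<Prod>j<m. gauss_char (N ! j) s)) =
            cmod ((\<Prod>j<m. stat_char (N ! j) s) - (\<Prod>j<m. gauss_char (N ! j) s))"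
          by (simp add: right_diff_distrib[symmetric] norm_mult)
        \<comment> \<open>All factors have modulus at most 1, so the difference of the products is
          bounded by the sum of the differences. This makes the error recurrence linear, with the
          same operator as for the mean.\<close>
        also have "... \<le> (\<Sum>j<m. cmod (stat_char (N ! j) s - gauss_char (N ! j) s))"
          by (intro norm_prod_diff norm_stat_char norm_gauss_char)
        also have "... \<le> (\<Sum>j<m. \<bar>s\<bar> ^ 3 * h (N ! j))" by (intro sum_mono sub N) auto
        finally show "cmod (cis (s * toll m t c N) * (\<Prod>j<m. stat_char (N ! j) s) - cis (s * toll m t c N) * (\<Prod>j<m. gauss_char (N ! j) s))
            \<le> \<bar>s\<bar> ^ 3 * (\<Sum>j<m. h (N ! j))" by (simp add: sum_distrib_left)
      qed
      also have "... = \<bar>s\<bar> ^ 3 * split_mean m n (\<lambda>N. \<Sum>j<m. h (N ! j))" by (rule split_mean_cmult)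
      finally have "cmod (stat_char n s - gauss_char n s) \<le> \<bar>s\<bar> ^ 3 * split_mean m n (\<lambda>N. \<Sum>j<m. h (N ! j)) + \<bar>s\<bar> ^ 3 * (K * (w n) ^ 3)"
        using K(2)[OF n less.prems] norm_triangle_ineq[of "P - Q" "Q - gauss_char n s"] \<open>stat_char n s = P\<close>
        unfolding Q_def by simp
      also have "... = \<bar>s\<bar> ^ 3 * h n"
        using rec n False unfolding split_rec_def b_def split_mean_def by (simp add: distrib_left)
      finally show ?thesis .
    qed
  qed
  have r3: "rate m (3 * \<alpha>)" using rate_mono[OF rate, of "3 * \<alpha>"] \<alpha> by simp
  have gt1: "1 < 3 * \<alpha>" using \<alpha> by simp
  have bb: "\<bar>b n\<bar> \<le> K * (real n + 1) powr (3 * \<alpha>)" for n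
    using K(1) w_power[of n 3] w_ge_1[of n] by (simp add: b_def)
  obtain K' where K': "\<And>n. \<bar>h n\<bar> \<le> K' * (real n + 1) powr (3 * \<alpha>)"
    using split_rec_bound[OF m rec r3 gt1 bb] by blast
  have "cmod (stat_char n s - gauss_char n s) \<le> \<bar>s\<bar> ^ 3 * (K' * (w n) ^ 3)" if "\<bar>s\<bar> \<le> M / sqrt (real n + 1)" for n s
  proof -
    have "h n \<le> K' * (w n) ^ 3" using K'[of n] w_power[of n 3] by simp
    then have "\<bar>s\<bar> ^ 3 * h n \<le> \<bar>s\<bar> ^ 3 * (K' * (w n) ^ 3)" by (intro mult_left_mono) auto
    then show ?thesis using le[OF that] by linarith
  qed
  then show ?thesis by blast
qed

lemma variance_limit:
  obtains \<sigma> where "(\<lambda>n. stat_var n / real n) \<longlonglongrightarrow> \<sigma>"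
proof -
  obtain \<sigma> K where K: "K \<ge> 0" "\<And>n. \<bar>stat_var n - \<sigma> * real n\<bar> \<le> K * (w n)\<^sup>2" using stat_var_linear by blast
  have "(\<lambda>n. stat_var n / real n - \<sigma>) \<longlonglongrightarrow> 0"
  proof (rule Lim_null_comparison)
    show "\<forall>\<^sub>F n in sequentially. norm (stat_var n / real n - \<sigma>) \<le> K * ((real n + 1) powr (2 * \<alpha>) / real n)"
      using eventually_gt_at_top[of 0]
    proof eventually_elim
      case (elim n)
      then have "stat_var n / real n - \<sigma> = (stat_var n - \<sigma> * real n) / real n" by (simp add: field_simps)
      then show ?case using divide_right_mono[OF K(2)[of n], of "real n"] w_power[of n 2] by simp
    qed
    have "(\<lambda>n. (real n + 1) powr (2 * \<alpha>) / real n) \<longlonglongrightarrow> 0" using \<alpha> by real_asymp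
    then show "(\<lambda>n. K * ((real n + 1) powr (2 * \<alpha>) / real n)) \<longlonglongrightarrow> 0" by (rule tendsto_mult_right_zero)
  qed
  then show ?thesis using that by (simp add: LIM_zero_iff)
qed

lemma bias_limit: "(\<lambda>n. bias n / sqrt (real n)) \<longlonglongrightarrow> 0"
proof -
  obtain K where K: "\<And>n. \<bar>bias n\<bar> \<le> K * w n" using bias_bound by blast
  show ?thesis
  proof (rule Lim_null_comparison)
    show "\<forall>\<^sub>F n in sequentially. norm (bias n / sqrt (real n)) \<le> K * ((real n + 1) powr \<alpha> / sqrt (real n))"
      using divide_right_mono[OF K, of "sqrt (real _)"] by (intro always_eventually) (simp add: w_def)
    have "(\<lambda>n. (real n + 1) powr \<alpha> / sqrt (real n)) \<longlonglongrightarrow> 0" using \<alpha> by real_asymp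
    then show "(\<lambda>n. K * ((real n + 1) powr \<alpha> / sqrt (real n))) \<longlonglongrightarrow> 0" by (rule tendsto_mult_right_zero)
  qed
qed

lemma second_moment: "stat_mean m t n (\<lambda>x. (x - c * real n)\<^sup>2) = stat_var n + (bias n)\<^sup>2"
proof -
  have "(x - c * real n)\<^sup>2 = (x - c * real n - bias n)\<^sup>2 + (2 * bias n * (x - c * real n) - (bias n)\<^sup>2)" for x
    by (simp add: power2_eq_square algebra_simps)
  then have "stat_mean m t n (\<lambda>x. (x - c * real n)\<^sup>2) = stat_var n + (2 * bias n * bias n - (bias n)\<^sup>2)"
    unfolding stat_var_def by (simp only: stat_mean_add stat_mean_diff[of m t n "\<lambda>x. 2 * bias n * (x - c * real n)"] stat_mean_cmult stat_mean_const bias_def[symmetric])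
  then show ?thesis by (simp add: power2_eq_square)
qed

text \<open>Applied to unit weights, this bounds the second moments of the coordinates and so
  provides tightness.\<close>

lemma second_moment_limit:
  assumes "(\<lambda>n. stat_var n / real n) \<longlonglongrightarrow> \<sigma>"
  shows "(\<lambda>n. stat_mean m t n (\<lambda>x. ((x - c * real n) / sqrt (real n))\<^sup>2)) \<longlonglongrightarrow> \<sigma>"
proof -
  have "stat_mean m t n (\<lambda>x. ((x - c * real n) / sqrt (real n))\<^sup>2) = stat_var n / real n + (bias n / sqrt (real n))\<^sup>2" for n
    using stat_mean_cmult[of m t n "1 / real n" "\<lambda>x. (x - c * real n)\<^sup>2"]
    by (simp add: power_divide second_moment add_divide_distrib)
  then show ?thesis using tendsto_add[OF assms tendsto_power[OF bias_limit, of 2]] by simp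
qed

lemma stat_char_limit:
  assumes "(\<lambda>n. stat_var n / real n) \<longlonglongrightarrow> \<sigma>"
  shows "(\<lambda>n. stat_char n (1 / sqrt (real n))) \<longlonglongrightarrow> complex_of_real (exp (- \<sigma> / 2))"
proof -
  \<comment> \<open>The constant sqrt 2 admits s = 1 / sqrt n, because n + 1 \<le> 2 n for n \<ge>
    1.\<close>
  obtain K where K: "\<And>n s. \<bar>s\<bar> \<le> sqrt 2 / sqrt (real n + 1) \<Longrightarrow> cmod (stat_char n s - gauss_char n s) \<le> \<bar>s\<bar> ^ 3 * (K * (w n) ^ 3)"
    using stat_char_error[of "sqrt 2"] by auto
  have "(\<lambda>n. stat_char n (1 / sqrt (real n)) - gauss_char n (1 / sqrt (real n))) \<longlonglongrightarrow> 0"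
  proof (rule Lim_null_comparison)
    show "\<forall>\<^sub>F n in sequentially. cmod (stat_char n (1 / sqrt (real n)) - gauss_char n (1 / sqrt (real n))) \<le>
        K * ((real n + 1) powr (3 * \<alpha>) / sqrt (real n) ^ 3)"
      using eventually_gt_at_top[of 0]
    proof eventually_elim
      case (elim n)
      then have "sqrt (real n + 1) \<le> sqrt (2 * real n)" by simp
      then have "\<bar>1 / sqrt (real n)\<bar> \<le> sqrt 2 / sqrt (real n + 1)"
        using elim by (simp add: field_simps real_sqrt_mult)
      from K[OF this] show ?case using w_power[of n 3] by (simp add: power_divide)
    qed
    have "(\<lambda>n. (real n + 1) powr (3 * \<alpha>) / sqrt (real n) ^ 3) \<longlonglongrightarrow> 0" using \<alpha> by real_asymp
    then show "(\<lambda>n. K * ((real n + 1) powr (3 * \<alpha>) / sqrt (real n) ^ 3)) \<longlonglongrightarrow> 0"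
      by (rule tendsto_mult_right_zero)
  qed
  moreover have "(\<lambda>n. gauss_char n (1 / sqrt (real n))) \<longlonglongrightarrow> complex_of_real (exp (- \<sigma> / 2))"
  proof -
    have "gauss_char n (1 / sqrt (real n)) = exp (Complex (- (stat_var n / real n) / 2) (bias n / sqrt (real n)))" for n
      by (simp add: gauss_char_def power_divide)
    moreover have "(\<lambda>n. exp (Complex (- (stat_var n / real n) / 2) (bias n / sqrt (real n)))) \<longlonglongrightarrow> exp (Complex (- \<sigma> / 2) 0)"
      by (intro tendsto_exp tendsto_Complex tendsto_divide tendsto_minus assms bias_limit tendsto_const) simp
    moreover have "exp (Complex (- \<sigma> / 2) 0) = complex_of_real (exp (- \<sigma> / 2))"
      unfolding complex_of_real_def[symmetric] by (rule exp_of_real)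
    ultimately show ?thesis by simp
  qed
  ultimately show ?thesis by (rule Lim_transform[rotated])
qed

end

section \<open>Weak convergence from characteristic functions\<close>

text \<open>The phase b provides sines as well as cosines. The set is an algebra, yet every element
  is integrated by evaluating the characteristic function at finitely many points.\<close>

inductive_set trig_sums :: "nat \<Rightarrow> ((nat \<Rightarrow> real) \<Rightarrow> real) set" for m where
  cos: "(\<lambda>x. a * cos ((\<Sum>i\<le>m. t i * x i) + b)) \<in> trig_sums m"
| add: "f \<in> trig_sums m \<Longrightarrow> g \<in> trig_sums m \<Longrightarrow> (\<lambda>x. f x + g x) \<in> trig_sums m"

lemma trig_const: "(\<lambda>_. c) \<in> trig_sums m"
  using trig_sums.cos[of c "\<lambda>_. 0" m 0] by simp

lemma trig_mult:
  assumes "f \<in> trig_sums m" "g \<in> trig_sums m"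
  shows "(\<lambda>x. f x * g x) \<in> trig_sums m"
  using assms(1)
proof induction
  case (cos a t b)
  show ?case using assms(2)
  proof induction
    case (cos a' t' b')
    have "(\<lambda>x. a * cos ((\<Sum>i\<le>m. t i * x i) + b) * (a' * cos ((\<Sum>i\<le>m. t' i * x i) + b'))) =
      (\<lambda>x. (a * a' / 2) * cos ((\<Sum>i\<le>m. (t i - t' i) * x i) + (b - b')) +
           (a * a' / 2) * cos ((\<Sum>i\<le>m. (t i + t' i) * x i) + (b + b')))"
    proof
      fix x :: "nat \<Rightarrow> real"
      define A A' where "A = (\<Sum>i\<le>m. t i * x i) + b" and "A' = (\<Sum>i\<le>m. t' i * x i) + b'"
      have eqs: "(\<Sum>i\<le>m. (t i - t' i) * x i) + (b - b') = A - A'" "(\<Sum>i\<le>m. (t i + t' i) * x i) + (b + b') = A + A'"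
        by (simp_all add: A_def A'_def algebra_simps sum.distrib sum_subtractf)
      show "a * cos ((\<Sum>i\<le>m. t i * x i) + b) * (a' * cos ((\<Sum>i\<le>m. t' i * x i) + b')) =
          (a * a' / 2) * cos ((\<Sum>i\<le>m. (t i - t' i) * x i) + (b - b')) +
          (a * a' / 2) * cos ((\<Sum>i\<le>m. (t i + t' i) * x i) + (b + b'))"
        unfolding eqs A_def[symmetric] A'_def[symmetric] by (simp add: cos_diff cos_add algebra_simps)
    qed
    then show ?case by (simp only: trig_sums.add[OF trig_sums.cos trig_sums.cos])
  next
    case (add f g)
    then show ?case by (simp add: distrib_left trig_sums.add)
  qed
next
  case (add f g)
  then show ?case by (simp add: distrib_right trig_sums.add)
qed

lemma trig_continuous: "f \<in> trig_sums m \<Longrightarrow> continuous_on UNIV f"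
  by (induction rule: trig_sums.induct) (auto intro!: continuous_intros)

lemma trig_bounded: "f \<in> trig_sums m \<Longrightarrow> \<exists>A. \<forall>x. \<bar>f x\<bar> \<le> A"
proof (induction rule: trig_sums.induct)
  case (cos a t b)
  have "\<bar>a * cos ((\<Sum>i\<le>m. t i * x i) + b)\<bar> \<le> \<bar>a\<bar>" for x
    by (simp add: abs_mult mult_left_le)
  then show ?case by blast
next
  case (add f g)
  then obtain A A' where "\<And>x. \<bar>f x\<bar> \<le> A" "\<And>x. \<bar>g x\<bar> \<le> A'" by blast
  then have "\<bar>f x + g x\<bar> \<le> A + A'" for x by (meson abs_triangle_ineq add_mono order_trans)
  then show ?case by blast
qed

lemma trig_polynomial:
  assumes "real_polynomial_function p" "g \<in> trig_sums m"
  shows "(\<lambda>x. p (g x)) \<in> trig_sums m"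
  using assms(1)
proof induction
  case (linear f)
  have "f = (\<lambda>y. f 1 * y)"
    using linear_times_of_real linear by (metis (no_types, opaque_lifting) bounded_linear.linear linear_scale mult.commute mult.right_neutral real_scaleR_def)
  then show ?case using trig_mult[OF trig_const[of "f 1"] assms(2)] by metis
qed (auto intro: trig_const trig_sums.add trig_mult)

text \<open>Because the coordinates beyond m vanish, frequencies on the first m + 1 coordinates
  separate the points.\<close>

definition coord_box :: "nat \<Rightarrow> real \<Rightarrow> (nat \<Rightarrow> real) set" where
  "coord_box m M = {x. (\<forall>i\<le>m. \<bar>x i\<bar> \<le> M) \<and> (\<forall>i>m. x i = 0)}"

lemma compact_coord_box: "compact (coord_box m M)"
proof -
  define S where "S = (\<lambda>i. if i \<le> m then {-M..M} else {0 :: real})"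
  have "coord_box m M = PiE UNIV S"
  proof (intro set_eqI iffI)
    fix x assume x: "x \<in> coord_box m M"
    show "x \<in> PiE UNIV S"
    proof (rule PiE_I)
      fix i show "x i \<in> S i" using x by (cases "i \<le> m") (auto simp: coord_box_def S_def abs_le_iff)
    qed simp
  next
    fix x assume "x \<in> PiE UNIV S"
    then have xS: "x i \<in> S i" for i by (rule PiE_mem) simp
    have "\<bar>x i\<bar> \<le> M" if "i \<le> m" for i
      using xS[of i] that by (simp add: S_def abs_le_iff)
    moreover have "x i = 0" if "i > m" for i
      using xS[of i] that by (simp add: S_def)
    ultimately show "x \<in> coord_box m M" by (simp add: coord_box_def)
  qed
  moreover have "compactin (product_topology (\<lambda>_. euclidean) UNIV) (PiE UNIV S)"
    unfolding compactin_PiE by (auto simp: S_def compact_Icc)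
  ultimately show ?thesis by (simp add: euclidean_product_topology)
qed

lemma trig_approx:
  assumes "continuous_on (coord_box m M) f" "e > 0"
  shows "\<exists>g\<in>trig_sums m. \<forall>x\<in>coord_box m M. \<bar>f x - g x\<bar> < e"
proof -
  interpret function_ring_on "trig_sums m" "coord_box m M"
  proof
    show "compact (coord_box m M)" by (rule compact_coord_box)
    show "continuous_on (coord_box m M) f" if "f \<in> trig_sums m" for f
      using trig_continuous[OF that] continuous_on_subset by blast
    show "\<exists>f\<in>trig_sums m. f x \<noteq> f y" if xy: "x \<in> coord_box m M" "y \<in> coord_box m M" "x \<noteq> y" for x y
    proof -
      obtain i where i: "x i \<noteq> y i" using xy(3) by auto
      then have im: "i \<le> m" using xy by (cases "i \<le> m") (auto simp: coord_box_def)
      define d where "d = x i - y i"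
      have d: "d \<noteq> 0" using i by (simp add: d_def)
      \<comment> \<open>This frequency puts the phases at x and y at pi and 0, where the cosine
        takes the values -1 and 1.\<close>
      define c where "c = pi / d"
      define t where "t = (\<lambda>j. if j = i then c else 0 :: real)"
      have s: "(\<Sum>j\<le>m. t j * z j) = c * z i" for z :: "nat \<Rightarrow> real"
        using im by (simp add: t_def if_distrib[of "\<lambda>u. u * _"] cong: if_cong)
      have "(\<lambda>z. 1 * cos ((\<Sum>j\<le>m. t j * z j) + (- c * y i))) \<in> trig_sums m" by (rule trig_sums.cos)
      moreover have "c * x i + (- c * y i) = c * d" by (simp add: d_def algebra_simps)
      moreover have "c * d = pi" using d by (simp add: c_def)
      ultimately show ?thesis unfolding s
        by (intro bexI[of _ "\<lambda>z. 1 * cos (c * z i + (- c * y i))"]) auto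
    qed
  qed (auto intro: trig_sums.add trig_mult trig_const)
  show ?thesis using Stone_Weierstrass_basic[OF assms] by blast
qed

text \<open>Stone-Weierstrass gives no bound outside the box; composing with a polynomial close to the clipping
  function on the range of the approximant restores one without leaving the algebra.\<close>

lemma trig_approx_clipped:
  fixes f :: "(nat \<Rightarrow> real) \<Rightarrow> real"
  assumes f: "continuous_on UNIV f" "\<And>x. \<bar>f x\<bar> \<le> B" and e: "e > 0"
  shows "\<exists>h\<in>trig_sums m. (\<forall>x\<in>coord_box m M. \<bar>f x - h x\<bar> \<le> 2 * e) \<and> (\<forall>x. \<bar>h x\<bar> \<le> B + e)"
proof -
  obtain g where g: "g \<in> trig_sums m" "\<And>x. x \<in> coord_box m M \<Longrightarrow> \<bar>f x - g x\<bar> < e"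
    using trig_approx[OF continuous_on_subset[OF f(1)] e] by blast
  obtain A where A: "\<And>x. \<bar>g x\<bar> \<le> A" using trig_bounded[OF g(1)] by blast
  have B: "B \<ge> 0" using f(2) abs_ge_zero order_trans by blast
  define cl where "cl = (\<lambda>y. max (-B) (min B y))"
  have "continuous_on {-A..A} cl" unfolding cl_def by (intro continuous_intros)
  then obtain p where p: "real_polynomial_function p" "\<And>y. y \<in> {-A..A} \<Longrightarrow> \<bar>cl y - p y\<bar> < e"
    using Stone_Weierstrass_real_polynomial_function[of "{-A..A}" cl e] e by auto
  have gA: "g x \<in> {-A..A}" for x using A[of x] by auto
  show ?thesis
  proof (intro bexI conjI ballI allI)
    show "(\<lambda>x. p (g x)) \<in> trig_sums m" by (rule trig_polynomial[OF p(1) g(1)])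
    show "\<bar>p (g x)\<bar> \<le> B + e" for x
      using p(2)[OF gA[of x]] B by (auto simp: cl_def abs_if max_def min_def split: if_splits)
    show "\<bar>f x - p (g x)\<bar> \<le> 2 * e" if "x \<in> coord_box m M" for x
      using p(2)[OF gA[of x]] g(2)[OF that] f(2)[of x] B
      by (auto simp: cl_def abs_if max_def min_def split: if_splits)
  qed
qed

text \<open>What the convergence argument asks of a measure. Measurability is phrased through
  continuous functions since the laws at finite n live on a discrete sigma-algebra and the limit on
  the Borel sets; the second moments replace tightness.\<close>

definition moment_bounded :: "nat \<Rightarrow> real \<Rightarrow> (nat \<Rightarrow> real) measure \<Rightarrow> bool" where
  "moment_bounded m C N \<longleftrightarrow> prob_space N \<and>
     (\<forall>f :: (nat \<Rightarrow> real) \<Rightarrow> real. continuous_on UNIV f \<longrightarrow> f \<in> borel_measurable N) \<and>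
     (AE x in N. \<forall>i>m. x i = 0) \<and>
     (\<forall>i\<le>m. integrable N (\<lambda>x. (x i)\<^sup>2) \<and> (\<integral>x. (x i)\<^sup>2 \<partial>N) \<le> C)"

lemma moment_bounded_integrable:
  fixes f :: "(nat \<Rightarrow> real) \<Rightarrow> real" and B :: real
  assumes "moment_bounded m C N" "continuous_on UNIV f" "\<And>x. \<bar>f x\<bar> \<le> B"
  shows "integrable N f"
proof -
  interpret prob_space N using assms(1) by (simp add: moment_bounded_def)
  show ?thesis using assms by (intro integrable_const_bound[where B = B]) (auto simp: moment_bounded_def)
qed

text \<open>Chebyshev's inequality as a pointwise bound: outside the box the sum of squares is at
  least M^2, so there the crude bound 2 B + e is dominated by a multiple of that sum.\<close>

lemma moment_bounded_diff:
  fixes f h :: "(nat \<Rightarrow> real) \<Rightarrow> real" and B :: real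
  assumes N: "moment_bounded m C N"
    and f: "continuous_on UNIV f" "\<And>x. \<bar>f x\<bar> \<le> B"
    and h: "continuous_on UNIV h" "\<And>x. \<bar>h x\<bar> \<le> B + e"
    and fh: "\<And>x. x \<in> coord_box m M \<Longrightarrow> \<bar>f x - h x\<bar> \<le> 2 * e" and e: "0 < e" and M: "0 < M"
  shows "\<bar>(\<integral>x. f x \<partial>N) - (\<integral>x. h x \<partial>N)\<bar> \<le> 2 * e + (2 * B + e) * (real (m + 1) * C) / M\<^sup>2"
proof -
  interpret prob_space N using N by (simp add: moment_bounded_def)
  have B: "B \<ge> 0" using f(2) abs_ge_zero order_trans by blast
  define D where "D = (2 * B + e) / M\<^sup>2"
  have D: "D \<ge> 0" using B e by (simp add: D_def)
  have int: "integrable N f" "integrable N h"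
    using moment_bounded_integrable[OF N f] moment_bounded_integrable[OF N h] by auto
  have int2: "integrable N (\<lambda>x. 2 * e + D * (\<Sum>i\<le>m. (x i)\<^sup>2))"
    using N by (intro Bochner_Integration.integrable_add integrable_mult_right integrable_sum)
      (auto simp: moment_bounded_def)
  have "\<bar>(\<integral>x. f x \<partial>N) - (\<integral>x. h x \<partial>N)\<bar> = \<bar>\<integral>x. f x - h x \<partial>N\<bar>" using int by simp
  also have "... \<le> (\<integral>x. \<bar>f x - h x\<bar> \<partial>N)" by (rule integral_abs_bound)
  also have "... \<le> (\<integral>x. 2 * e + D * (\<Sum>i\<le>m. (x i)\<^sup>2) \<partial>N)"
  proof (rule integral_mono_AE)
    show "integrable N (\<lambda>x. \<bar>f x - h x\<bar>)" using int by auto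
    have "AE x in N. \<forall>i>m. x i = 0" using N by (simp add: moment_bounded_def)
    then show "AE x in N. \<bar>f x - h x\<bar> \<le> 2 * e + D * (\<Sum>i\<le>m. (x i)\<^sup>2)"
    proof eventually_elim
      case (elim x)
      have s0: "0 \<le> (\<Sum>i\<le>m. (x i)\<^sup>2)" by (intro sum_nonneg) auto
      show ?case
      proof (cases "x \<in> coord_box m M")
        case True
        then show ?thesis using fh[OF True] mult_nonneg_nonneg[OF D s0] by linarith
      next
        case False
        then obtain i where i: "i \<le> m" "\<bar>x i\<bar> > M" using elim by (auto simp: coord_box_def not_le)
        have "M\<^sup>2 \<le> (x i)\<^sup>2" using i M by (metis abs_le_square_iff abs_of_pos less_imp_le)
        also have "... \<le> (\<Sum>i\<le>m. (x i)\<^sup>2)" using i by (intro member_le_sum) auto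
        finally have "D * M\<^sup>2 \<le> D * (\<Sum>i\<le>m. (x i)\<^sup>2)" using D by (rule mult_left_mono)
        moreover have "D * M\<^sup>2 = 2 * B + e" using M by (simp add: D_def)
        moreover have "\<bar>f x - h x\<bar> \<le> 2 * B + e" using f(2)[of x] h(2)[of x] by linarith
        ultimately show ?thesis using e by linarith
      qed
    qed
  qed (rule int2)
  also have "... = 2 * e + D * (\<Sum>i\<le>m. \<integral>x. (x i)\<^sup>2 \<partial>N)"
  proof -
    have iq: "integrable N (\<lambda>x. (x i)\<^sup>2)" if "i \<in> {..m}" for i
      using N that by (simp add: moment_bounded_def)
    then have "integrable N (\<lambda>x. \<Sum>i\<le>m. (x i)\<^sup>2)" by (rule Bochner_Integration.integrable_sum)
    moreover have "(\<integral>x. (\<Sum>i\<le>m. (x i)\<^sup>2) \<partial>N) = (\<Sum>i\<le>m. \<integral>x. (x i)\<^sup>2 \<partial>N)"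
      using iq by (rule Bochner_Integration.integral_sum)
    ultimately show ?thesis by (simp add: prob_space)
  qed
  also have "... \<le> 2 * e + D * (\<Sum>i\<le>m. C)"
    using N D by (intro add_left_mono mult_left_mono sum_mono) (auto simp: moment_bounded_def)
  also have "... = 2 * e + (2 * B + e) * (real (m + 1) * C) / M\<^sup>2" by (simp add: D_def)
  finally show ?thesis .
qed

lemma moment_bounded_trig:
  assumes N: "moment_bounded m C N"
  shows "(\<integral>x. a * cos ((\<Sum>i\<le>m. t i * x i) + b) \<partial>N) = a * Re (cis b * (CLINT x|N. cis (\<Sum>i\<le>m. t i * x i)))"
proof -
  interpret prob_space N using N by (simp add: moment_bounded_def)
  define s where "s = (\<lambda>x :: nat \<Rightarrow> real. \<Sum>i\<le>m. t i * x i)"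
  have "continuous_on UNIV s" unfolding s_def
    by (intro continuous_intros continuous_on_product_coordinates)
  then have s: "s \<in> borel_measurable N" using N by (simp add: moment_bounded_def)
  have "(cis :: real \<Rightarrow> complex) \<in> borel_measurable borel"
    by (intro borel_measurable_continuous_onI continuous_intros)
  then have "(\<lambda>x. cis (s x)) \<in> borel_measurable N" by (rule measurable_compose[OF s])
  then have int: "integrable N (\<lambda>x. cis (s x))" by (intro integrable_const_bound[where B = 1]) auto
  have "a * Re (cis b * (CLINT x|N. cis (s x))) = a * Re (CLINT x|N. cis b * cis (s x))"
    using int by simp
  also have "Re (CLINT x|N. cis b * cis (s x)) = (\<integral>x. Re (cis b * cis (s x)) \<partial>N)"
    using int by (intro integral_Re[symmetric]) auto
  also have "... = (\<integral>x. cos (s x + b) \<partial>N)" by (simp add: cis_mult add.commute)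
  finally have "a * Re (cis b * (CLINT x|N. cis (s x))) = (\<integral>x. a * cos (s x + b) \<partial>N)" by simp
  then show ?thesis unfolding s_def by (rule sym)
qed

text \<open>Approximation of f by one trigonometric sum h is uniform over all measures with the same
  moment bound, and for h convergence is convergence of characteristic functions.\<close>

theorem weak_conv_from_char:
  fixes P :: "nat \<Rightarrow> (nat \<Rightarrow> real) measure" and f :: "(nat \<Rightarrow> real) \<Rightarrow> real"
  assumes P: "\<forall>\<^sub>F n in sequentially. moment_bounded m C (P n)" and \<mu>: "moment_bounded m C \<mu>"
    and char: "\<And>t. (\<lambda>n. CLINT x|P n. cis (\<Sum>i\<le>m. t i * x i)) \<longlonglongrightarrow> (CLINT x|\<mu>. cis (\<Sum>i\<le>m. t i * x i))"
    and f: "continuous_on UNIV f" "bounded (range f)"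
  shows "(\<lambda>n. integral\<^sup>L (P n) f) \<longlonglongrightarrow> integral\<^sup>L \<mu> f"
proof (rule LIMSEQ_I)
  have trig_lim: "(\<lambda>n. integral\<^sup>L (P n) h) \<longlonglongrightarrow> integral\<^sup>L \<mu> h" if "h \<in> trig_sums m" for h
    using that
  proof induction
    case (cos a t b)
    have lim: "(\<lambda>n. a * Re (cis b * (CLINT x|P n. cis (\<Sum>i\<le>m. t i * x i)))) \<longlonglongrightarrow>
        a * Re (cis b * (CLINT x|\<mu>. cis (\<Sum>i\<le>m. t i * x i)))"
      by (intro tendsto_intros char)
    have ev: "\<forall>\<^sub>F n in sequentially. a * Re (cis b * (CLINT x|P n. cis (\<Sum>i\<le>m. t i * x i))) =
        (\<integral>x. a * cos ((\<Sum>i\<le>m. t i * x i) + b) \<partial>P n)"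
      using P by eventually_elim (rule moment_bounded_trig[symmetric])
    show ?case
      unfolding moment_bounded_trig[OF \<mu>] by (rule Lim_transform_eventually[OF lim ev])
  next
    case (add f g)
    obtain A A' where A: "\<And>x. \<bar>f x\<bar> \<le> A" "\<And>x. \<bar>g x\<bar> \<le> A'"
      using trig_bounded add.hyps by meson
    have i: "integrable N f \<and> integrable N g" if "moment_bounded m C N" for N
      using moment_bounded_integrable[OF that] A trig_continuous add.hyps by blast
    have ev: "\<forall>\<^sub>F n in sequentially. integral\<^sup>L (P n) f + integral\<^sup>L (P n) g = (\<integral>x. f x + g x \<partial>P n)"
      using P by eventually_elim (use i in simp)
    show ?case using Lim_transform_eventually[OF tendsto_add[OF add.IH] ev] i[OF \<mu>] by simp
  qed
  fix r :: real assume r: "r > 0"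
  obtain B where B: "\<And>x. \<bar>f x\<bar> \<le> B" using f(2) by (auto simp: bounded_iff)
  have B0: "B \<ge> 0" using B abs_ge_zero order_trans by blast
  \<comment> \<open>Replacing f by h costs at most 3 e for each of the two measures and the
    convergence for h less than e, so the total stays below 8 e. M is chosen to make the
    contribution from outside the box at most e.\<close>
  define e where "e = r / 8"
  have e: "e > 0" using r by (simp add: e_def)
  define Q where "Q = (2 * B + e) * (real (m + 1) * \<bar>C\<bar>) / e"
  define M where "M = sqrt (Q + 1)"
  have Q: "Q \<ge> 0" using B0 e by (simp add: Q_def)
  have M: "M > 0" "M\<^sup>2 = Q + 1" using Q by (auto simp: M_def)
  obtain h where h: "h \<in> trig_sums m" "\<And>x. x \<in> coord_box m M \<Longrightarrow> \<bar>f x - h x\<bar> \<le> 2 * e" "\<And>x. \<bar>h x\<bar> \<le> B + e"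
    using trig_approx_clipped[OF f(1) B e] by blast
  have small: "2 * e + (2 * B + e) * (real (m + 1) * C) / M\<^sup>2 \<le> 3 * e"
  proof -
    have "(2 * B + e) * (real (m + 1) * C) \<le> (2 * B + e) * (real (m + 1) * \<bar>C\<bar>)"
      using B0 e by (intro mult_left_mono) auto
    also have "... = e * Q" using e by (simp add: Q_def)
    also have "... \<le> e * (Q + 1)" using e by simp
    finally show ?thesis using Q by (simp add: M pos_divide_le_eq)
  qed
  have close: "\<bar>integral\<^sup>L N f - integral\<^sup>L N h\<bar> \<le> 3 * e" if "moment_bounded m C N" for N
    using moment_bounded_diff[OF that f(1) B trig_continuous[OF h(1)] h(3,2) e M(1)] small by linarith
  have "\<forall>\<^sub>F n in sequentially. dist (integral\<^sup>L (P n) h) (integral\<^sup>L \<mu> h) < e"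
    using trig_lim[OF h(1)] e by (rule tendstoD)
  then have "\<forall>\<^sub>F n in sequentially. norm (integral\<^sup>L (P n) f - integral\<^sup>L \<mu> f) < r"
    using P
  proof eventually_elim
    case (elim n)
    then show ?case using close[of "P n"] close[OF \<mu>] r unfolding e_def dist_real_def real_norm_def by linarith
  qed
  then show "\<exists>n0. \<forall>n\<ge>n0. norm (integral\<^sup>L (P n) f - integral\<^sup>L \<mu> f) < r"
    by (simp add: eventually_sequentially)
qed

section \<open>Existence of the normal law\<close>

lemma quadratic_form_zero_diag:
  fixes a b :: real
  assumes "\<And>y. 0 \<le> a + y * b"
  shows "b = 0"
proof (rule ccontr)
  assume b: "b \<noteq> 0"
  have "0 \<le> a + (- (a + 1) / b) * b" by (rule assms)
  then show False using b by simp
qed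

text \<open>Elimination of the last index by the Schur complement, including the singular case: if
  the pivot s is 0, semidefiniteness forces the whole last column to vanish.\<close>

lemma cholesky:
  fixes S :: "nat \<Rightarrow> nat \<Rightarrow> real"
  assumes sym: "\<And>i j. i < d \<Longrightarrow> j < d \<Longrightarrow> S i j = S j i"
    and psd: "\<And>t. 0 \<le> (\<Sum>i<d. \<Sum>j<d. t i * S i j * t j)"
  shows "\<exists>A. \<forall>i<d. \<forall>j<d. S i j = (\<Sum>l<d. A i l * A j l :: real)"
  using assms
proof (induction d arbitrary: S)
  case (Suc d)
  define s where "s = S d d"
  have expand: "(\<Sum>i<Suc d. \<Sum>j<Suc d. t i * S i j * t j) =
      (\<Sum>i<d. \<Sum>j<d. t i * S i j * t j) + 2 * t d * (\<Sum>i<d. t i * S i d) + t d * t d * s" for t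
  proof -
    have "(\<Sum>j<d. t d * S d j * t j) = (\<Sum>i<d. t i * S i d * t d)"
      using Suc.prems(1) by (intro sum.cong) auto
    moreover have "(\<Sum>i<d. t i * S i d * t d) = t d * (\<Sum>i<d. t i * S i d)"
      by (simp add: sum_distrib_left mult_ac)
    ultimately show ?thesis by (simp add: sum.distrib s_def)
  qed
  have s0: "s \<ge> 0"
    using Suc.prems(2)[of "\<lambda>i. if i = d then 1 else 0"] unfolding expand by simp
  define v where "v = (\<lambda>i. S i d / sqrt s)"
  have zero: "S i d = 0" if "s = 0" "i < d" for i
  proof -
    have "0 \<le> S i i + y * (2 * S i d)" for y
    proof -
      \<comment> \<open>With S d d = 0 the form at e_i + y e_d is affine in y, and an affine
        function that is never negative is constant.\<close>
      define t where "t = (\<lambda>j. if j = d then y else if j = i then 1 else 0 :: real)"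
      have 1: "(\<Sum>k<d. t k * c k) = c i" for c
      proof -
        have "(\<Sum>k<d. t k * c k) = (\<Sum>k<d. if k = i then c k else 0)"
          by (intro sum.cong) (auto simp: t_def)
        then show ?thesis using that by simp
      qed
      have "(\<Sum>k<d. \<Sum>j<d. t k * S k j * t j) = (\<Sum>k<d. t k * (\<Sum>j<d. t j * S k j))"
        by (simp add: sum_distrib_left mult_ac)
      also have "... = S i i" unfolding 1 ..
      finally have "(\<Sum>i<Suc d. \<Sum>j<Suc d. t i * S i j * t j) = S i i + 2 * y * S i d"
        unfolding expand 1 using that by (simp add: t_def)
      then show ?thesis using Suc.prems(2)[of t] by (simp add: mult_ac)
    qed
    then have "2 * S i d = 0" by (rule quadratic_form_zero_diag)
    then show ?thesis by simp
  qed
  have vd: "v i * sqrt s = S i d" if "i \<le> d" for i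
    using s0 zero[of i] that by (cases "s = 0"; cases "i = d") (auto simp: v_def s_def)
  have vdd: "v d = sqrt s" using s0 by (simp add: v_def s_def[symmetric] real_div_sqrt)
  define S' where "S' = (\<lambda>i j. S i j - v i * v j)"
  have "0 \<le> (\<Sum>i<d. \<Sum>j<d. t i * S' i j * t j)" for t
  proof -
    define q where "q = (\<Sum>i<d. t i * v i)"
    \<comment> \<open>The last coordinate completes the square, so the form of S at t' equals the
      form of S' at t. For s = 0 the division gives 0, and q is 0 too.\<close>
    define t' where "t' = (\<lambda>j. if j = d then - q / sqrt s else t j)"
    have t': "(\<Sum>k<d. t' k * c k) = (\<Sum>k<d. t k * c k)" for c
      by (intro sum.cong) (auto simp: t'_def)
    have A: "(\<Sum>k<d. \<Sum>j<d. u k * S k j * u j) = (\<Sum>k<d. u k * (\<Sum>j<d. u j * S k j))" for u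
      by (simp add: sum_distrib_left mult_ac)
    have q2: "(\<Sum>i<d. t i * S i d) = q * sqrt s"
      unfolding q_def sum_distrib_right using vd by (intro sum.cong) (auto simp: mult.assoc)
    have "0 \<le> (\<Sum>i<d. \<Sum>j<d. t' i * S i j * t' j) + 2 * t' d * (\<Sum>i<d. t' i * S i d) + t' d * t' d * s"
      using Suc.prems(2)[of t'] unfolding expand .
    also have "... = (\<Sum>i<d. \<Sum>j<d. t i * S i j * t j) + 2 * t' d * (q * sqrt s) + t' d * t' d * s"
      unfolding A t' q2 ..
    finally have "0 \<le> (\<Sum>i<d. \<Sum>j<d. t i * S i j * t j) + (2 * t' d * (q * sqrt s) + t' d * t' d * s)"
      by simp
    moreover have "2 * t' d * (q * sqrt s) + t' d * t' d * s = - q * q"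
    proof (cases "s = 0")
      case True
      then have "q = 0" by (simp add: q_def v_def)
      then show ?thesis using True by simp
    next
      case False
      then have "sqrt s \<noteq> 0" "s = sqrt s * sqrt s" using s0 by auto
      then have "t' d * (q * sqrt s) = - (q * q)" "t' d * t' d * s = q * q"
        by (simp_all add: t'_def field_simps)
      then show ?thesis by simp
    qed
    moreover have "(\<Sum>i<d. \<Sum>j<d. t i * S' i j * t j) = (\<Sum>i<d. \<Sum>j<d. t i * S i j * t j) - q * q"
      unfolding S'_def q_def sum_product by (simp add: algebra_simps sum_subtractf)
    ultimately show ?thesis by simp
  qed
  moreover have "S' i j = S' j i" if "i < d" "j < d" for i j
    using Suc.prems(1)[of i j] that by (simp add: S'_def)
  ultimately obtain A where A: "\<And>i j. i < d \<Longrightarrow> j < d \<Longrightarrow> S' i j = (\<Sum>l<d. A i l * A j l)"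
    using Suc.IH[of S'] by blast
  define A' where "A' = (\<lambda>i l. if l = d then v i else if i = d then 0 else A i l)"
  have "S i j = (\<Sum>l<Suc d. A' i l * A' j l)" if "i < Suc d" "j < Suc d" for i j
  proof -
    have sum: "(\<Sum>l<d. A' i l * A' j l) = (if i = d \<or> j = d then 0 else S' i j)"
    proof (cases "i = d \<or> j = d")
      case True then show ?thesis by (intro trans[OF sum.neutral]) (auto simp: A'_def)
    next
      case False
      then have "(\<Sum>l<d. A' i l * A' j l) = (\<Sum>l<d. A i l * A j l)"
        by (intro sum.cong) (auto simp: A'_def)
      then show ?thesis using A[of i j] False that by simp
    qed
    have "S i d = v i * v d" "S d j = v d * v j"
      using vd[of i] vd[of j] vdd that Suc.prems(1)[of d j] by (auto simp: mult.commute)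
    then show ?thesis using sum by (auto simp: A'_def S'_def)
  qed
  then show ?case by blast
qed simp

section \<open>The normal law as a linear image of independent standard normals\<close>

definition std_normals :: "nat \<Rightarrow> (nat \<Rightarrow> real) measure" where
  "std_normals m = Pi\<^sub>M {..m} (\<lambda>_. std_normal_distribution)"

definition normal_map :: "nat \<Rightarrow> (nat \<Rightarrow> nat \<Rightarrow> real) \<Rightarrow> (nat \<Rightarrow> real) \<Rightarrow> nat \<Rightarrow> real" where
  "normal_map m A z i = (if i \<le> m then \<Sum>l\<le>m. A i l * z l else 0)"

lemma component_measurable: "l \<le> m \<Longrightarrow> (\<lambda>z. z l) \<in> borel_measurable (std_normals m)"
  unfolding std_normals_def
  using measurable_component_singleton[of l "{..m}" "\<lambda>_. std_normal_distribution"]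
  by (simp add: measurable_def)

lemma normal_map_measurable: "normal_map m A \<in> measurable (std_normals m) borel"
proof (rule measurable_coordinatewise_then_product)
  fix i
  show "(\<lambda>z. normal_map m A z i) \<in> borel_measurable (std_normals m)"
    unfolding normal_map_def by (cases "i \<le> m") (auto intro!: borel_measurable_sum borel_measurable_times component_measurable)
qed

lemma std_normals_char:
  "(CLINT z|std_normals m. cis (\<Sum>l\<le>m. c l * z l)) = complex_of_real (exp (- (\<Sum>l\<le>m. (c l)\<^sup>2) / 2))"
proof -
  interpret product_sigma_finite "\<lambda>_ :: nat. std_normal_distribution"
    by (intro product_sigma_finite.intro prob_space_imp_sigma_finite prob_space_normal_density) simp
  interpret prob_space std_normal_distribution by (rule prob_space_normal_density) simp
  have int: "integrable std_normal_distribution (\<lambda>x. cis (c l * x))" for l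
  proof -
    have "(\<lambda>x. cis (c l * x)) \<in> borel_measurable borel"
      by (intro borel_measurable_continuous_onI continuous_intros)
    then show ?thesis by (intro integrable_const_bound[where B = 1]) auto
  qed
  have "(CLINT z|std_normals m. cis (\<Sum>l\<le>m. c l * z l)) = (CLINT z|std_normals m. \<Prod>l\<le>m. cis (c l * z l))"
    by (intro Bochner_Integration.integral_cong refl) (simp add: cis_conv_exp exp_sum sum_distrib_left)
  also have "... = (\<Prod>l\<le>m. CLINT x|std_normal_distribution. cis (c l * x))"
    unfolding std_normals_def by (rule product_integral_prod) (use int in auto)
  also have "... = (\<Prod>l\<le>m. complex_of_real (exp (- (c l)\<^sup>2 / 2)))"
  proof (intro prod.cong refl)
    fix l
    show "(CLINT x|std_normal_distribution. cis (c l * x)) = complex_of_real (exp (- (c l)\<^sup>2 / 2))"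
      using fun_cong[OF char_std_normal_distribution, of "c l"] by (simp add: char_def cis_conv_exp mult.commute)
  qed
  also have "... = complex_of_real (exp (\<Sum>l\<le>m. - (c l)\<^sup>2 / 2))" by (simp add: exp_sum)
  also have "(\<Sum>l\<le>m. - (c l)\<^sup>2 / 2) = - (\<Sum>l\<le>m. (c l)\<^sup>2) / 2"
    by (simp add: sum_divide_distrib sum_negf)
  finally show ?thesis .
qed

lemma prob_space_std_normals: "prob_space (std_normals m)"
  unfolding std_normals_def by (intro prob_space_PiM prob_space_normal_density) simp

lemma std_normals_square: "l \<le> m \<Longrightarrow> integrable (std_normals m) (\<lambda>z. (z l)\<^sup>2)"
proof -
  assume l: "l \<le> m"
  interpret product_prob_space "\<lambda>_ :: nat. std_normal_distribution" "{..m}"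
    by (intro product_prob_spaceI prob_space_normal_density) simp
  have "distr (std_normals m) std_normal_distribution (\<lambda>\<omega>. \<omega> l) = std_normal_distribution"
    unfolding std_normals_def using l by (intro PiM_component) auto
  moreover have "integrable std_normal_distribution (\<lambda>x. x\<^sup>2)"
    by (rule integrable_std_normal_distribution_moment)
  ultimately have "integrable (distr (std_normals m) std_normal_distribution (\<lambda>\<omega>. \<omega> l)) (\<lambda>x. x\<^sup>2)" by simp
  then show ?thesis
    using measurable_component_singleton[of l "{..m}" "\<lambda>_. std_normal_distribution"] l
    by (subst (asm) integrable_distr_eq) (auto simp: std_normals_def)
qed

lemma sum_squared_le:
  fixes a :: "'i \<Rightarrow> real"
  shows "finite I \<Longrightarrow> (\<Sum>l\<in>I. a l)\<^sup>2 \<le> real (card I) * (\<Sum>l\<in>I. (a l)\<^sup>2)"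
  using Cauchy_Schwarz_ineq_sum[of a "\<lambda>_. 1" I] by (simp add: mult.commute)

text \<open>With S = A A^T, the image of a standard normal vector under A has the required
  characteristic function even when S is singular; its second moments are finite, so it also
  qualifies for the convergence criterion.\<close>

lemma centered_normal_exists:
  assumes "covariance_matrix m S"
  shows "\<exists>\<mu> C. centered_normal m S \<mu> \<and> moment_bounded m C \<mu>"
proof -
  obtain A where A: "\<And>i j. i \<le> m \<Longrightarrow> j \<le> m \<Longrightarrow> S i j = (\<Sum>l\<le>m. A i l * A j l)"
    using cholesky[of "Suc m" S] assms
    unfolding covariance_matrix_def by (auto simp: less_Suc_eq_le lessThan_Suc_atMost)
  interpret N: prob_space "std_normals m" by (rule prob_space_std_normals)
  define \<mu> where "\<mu> = distr (std_normals m) borel (normal_map m A)"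
  have ps: "prob_space \<mu>" unfolding \<mu>_def by (rule N.prob_space_distr[OF normal_map_measurable])
  have meas: "f \<in> borel_measurable \<mu>" if "continuous_on UNIV f" for f :: "(nat \<Rightarrow> real) \<Rightarrow> real"
    using that unfolding \<mu>_def by (simp add: borel_measurable_continuous_onI)
  have coord: "(\<lambda>x :: nat \<Rightarrow> real. x i) \<in> borel_measurable borel" for i
    by (intro borel_measurable_continuous_onI continuous_on_product_coordinates)
  have ae: "AE x in \<mu>. \<forall>i>m. x i = 0"
  proof -
    have "{x :: nat \<Rightarrow> real. \<forall>i>m. x i = 0} \<in> sets borel"
    proof -
      have "{x :: nat \<Rightarrow> real. \<forall>i>m. x i = 0} = (\<Inter>i\<in>{m<..}. {x. x i = 0})" by auto
      moreover have "closed {x :: nat \<Rightarrow> real. x i = 0}" for i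
        by (intro closed_Collect_eq continuous_on_const continuous_on_product_coordinates)
      ultimately have "closed {x :: nat \<Rightarrow> real. \<forall>i>m. x i = 0}" by auto
      then show ?thesis by (rule borel_closed)
    qed
    then show ?thesis unfolding \<mu>_def
      by (subst AE_distr_iff[OF normal_map_measurable]) (auto simp: normal_map_def)
  qed
  have char: "(CLINT x|\<mu>. cis (\<Sum>i\<le>m. t i * x i)) =
      complex_of_real (exp (- (\<Sum>i\<le>m. \<Sum>j\<le>m. t i * S i j * t j) / 2))" for t
  proof -
    define c where "c = (\<lambda>l. \<Sum>i\<le>m. t i * A i l)"
    have "continuous_on UNIV (\<lambda>x :: nat \<Rightarrow> real. cis (\<Sum>i\<le>m. t i * x i))"
      by (intro continuous_intros continuous_on_product_coordinates)
    then have "(CLINT x|\<mu>. cis (\<Sum>i\<le>m. t i * x i)) =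
        (CLINT z|std_normals m. cis (\<Sum>i\<le>m. t i * normal_map m A z i))"
      unfolding \<mu>_def by (intro integral_distr normal_map_measurable borel_measurable_continuous_onI)
    also have "(\<lambda>z. \<Sum>i\<le>m. t i * normal_map m A z i) = (\<lambda>z. \<Sum>l\<le>m. c l * z l)"
    proof
      fix z
      have "(\<Sum>i\<le>m. t i * normal_map m A z i) = (\<Sum>i\<le>m. \<Sum>l\<le>m. t i * A i l * z l)"
        by (intro sum.cong) (auto simp: normal_map_def sum_distrib_left mult.assoc)
      also have "... = (\<Sum>l\<le>m. c l * z l)"
        unfolding c_def sum_distrib_right by (rule sum.swap)
      finally show "(\<Sum>i\<le>m. t i * normal_map m A z i) = (\<Sum>l\<le>m. c l * z l)" .
    qed
    then have "(CLINT z|std_normals m. cis (\<Sum>i\<le>m. t i * normal_map m A z i)) =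
       (CLINT z|std_normals m. cis (\<Sum>l\<le>m. c l * z l))" by metis
    also have "... = complex_of_real (exp (- (\<Sum>l\<le>m. (c l)\<^sup>2) / 2))" by (rule std_normals_char)
    also have "(\<Sum>l\<le>m. (c l)\<^sup>2) = (\<Sum>i\<le>m. \<Sum>j\<le>m. t i * S i j * t j)"
    proof -
      have "(\<Sum>l\<le>m. (c l)\<^sup>2) = (\<Sum>l\<le>m. \<Sum>i\<le>m. \<Sum>j\<le>m. t i * (A i l * A j l) * t j)"
        unfolding c_def power2_eq_square sum_product by (simp add: mult_ac)
      also have "... = (\<Sum>i\<le>m. \<Sum>l\<le>m. \<Sum>j\<le>m. t i * (A i l * A j l) * t j)" by (rule sum.swap)
      also have "... = (\<Sum>i\<le>m. \<Sum>j\<le>m. \<Sum>l\<le>m. t i * (A i l * A j l) * t j)"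
        by (rule sum.cong[OF refl], rule sum.swap)
      also have "... = (\<Sum>i\<le>m. \<Sum>j\<le>m. t i * S i j * t j)"
        by (intro sum.cong refl) (simp add: A sum_distrib_left sum_distrib_right)
      finally show ?thesis .
    qed
    finally show ?thesis .
  qed
  have sq: "integrable \<mu> (\<lambda>x. (x i)\<^sup>2)" if "i \<le> m" for i
  proof -
    have "integrable (std_normals m) (\<lambda>z. (\<Sum>l\<le>m. A i l * z l)\<^sup>2)"
    proof (rule Bochner_Integration.integrable_bound)
      show "integrable (std_normals m) (\<lambda>z. real (card {..m}) * (\<Sum>l\<le>m. (A i l)\<^sup>2 * (z l)\<^sup>2))"
        using std_normals_square
        by (intro integrable_mult_right Bochner_Integration.integrable_sum) auto
      show "(\<lambda>z. (\<Sum>l\<le>m. A i l * z l)\<^sup>2) \<in> borel_measurable (std_normals m)"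
        by (intro borel_measurable_power borel_measurable_sum borel_measurable_times component_measurable) auto
      show "AE z in std_normals m. norm ((\<Sum>l\<le>m. A i l * z l)\<^sup>2) \<le>
          norm (real (card {..m}) * (\<Sum>l\<le>m. (A i l)\<^sup>2 * (z l)\<^sup>2))"
      proof (rule AE_I2)
        fix z
        have "(\<Sum>l\<le>m. A i l * z l)\<^sup>2 \<le> real (card {..m}) * (\<Sum>l\<le>m. (A i l * z l)\<^sup>2)"
          by (rule sum_squared_le) simp
        also have "... = real (card {..m}) * (\<Sum>l\<le>m. (A i l)\<^sup>2 * (z l)\<^sup>2)"
          by (simp add: power_mult_distrib)
        finally show "norm ((\<Sum>l\<le>m. A i l * z l)\<^sup>2) \<le>
          norm (real (card {..m}) * (\<Sum>l\<le>m. (A i l)\<^sup>2 * (z l)\<^sup>2))" by simp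
      qed
    qed
    then have "integrable (std_normals m) (\<lambda>z. (normal_map m A z i)\<^sup>2)"
      using that by (simp add: normal_map_def)
    then show ?thesis unfolding \<mu>_def
      by (subst integrable_distr_eq[OF normal_map_measurable]) (auto intro: borel_measurable_power coord)
  qed
  define C where "C = (\<Sum>i\<le>m. \<integral>x. (x i)\<^sup>2 \<partial>\<mu>)"
  have "(\<integral>x. (x i)\<^sup>2 \<partial>\<mu>) \<le> C" if "i \<le> m" for i
    unfolding C_def using that by (intro member_le_sum) auto
  then have "moment_bounded m C \<mu>"
    unfolding moment_bounded_def using ps meas ae sq by auto
  moreover have "centered_normal m S \<mu>"
    unfolding centered_normal_def using ps ae char by (auto simp: \<mu>_def)
  ultimately show ?thesis by blast
qed

section \<open>The limit theorem\<close>

lemma scaled_law_integral: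
  fixes f :: "(nat \<Rightarrow> real) \<Rightarrow> 'b::{banach,second_countable_topology,real_normed_field}"
  shows "integral\<^sup>L (scaled_law m n) f = avg {1..n} (\<lambda>xs. f (\<lambda>k. if k \<le> m
     then (real (deg_count m k (build m xs)) - real n * vstar m k) / sqrt (real n) else 0))"
proof -
  define P where "P = permutations_of_set {1..n}"
  have P: "finite P" "P \<noteq> {}" "card P = fact n" by (simp_all add: P_def)
  show ?thesis
    unfolding scaled_law_def rand_perm_def integral_map_pmf avg_def P_def[symmetric]
    by (subst integral_measure_pmf[of P])
       (use P in \<open>auto simp: scaleR_conv_of_real sum_divide_distrib\<close>)
qed

lemma vec_linear:
  "(\<Sum>i\<le>m. t i * (if i \<le> m then (real (deg_count m i (build m xs)) - real n * vstar m i) / sqrt (real n) else 0)) =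
    1 / sqrt (real n) * (stat m t xs - drift m t * real n)"
proof -
  have "(\<Sum>i\<le>m. t i * (if i \<le> m then (real (deg_count m i (build m xs)) - real n * vstar m i) / sqrt (real n) else 0)) =
      (\<Sum>i\<le>m. (t i * real (deg_count m i (build m xs)) - t i * vstar m i * real n) / sqrt (real n))"
    by (intro sum.cong) (auto simp: algebra_simps)
  then show ?thesis
    by (simp add: stat_def drift_def sum_divide_distrib[symmetric] sum_subtractf sum_distrib_right)
qed

lemma drift_unit_weight: "k \<le> m \<Longrightarrow> drift m (unit_weight k) = vstar m k"
  unfolding drift_def unit_weight_def by (simp add: if_distrib[of "\<lambda>u. u * _"] cong: if_cong)

context search_tree
begin

lemma char_scaled_law:
  "(CLINT x|scaled_law m n. cis (\<Sum>i\<le>m. t i * x i)) = stat_char n (1 / sqrt (real n))"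
  unfolding scaled_law_integral vec_linear stat_char_def stat_mean_def c_def by simp

text \<open>The drift drops out against the bias, which exhibits the variance as a quadratic form in
  t whose coefficients are the covariances of the outdegree counts.\<close>

lemma stat_var_centered:
  "stat_var n = avg {1..n} (\<lambda>xs. (\<Sum>i\<le>m. t i * (stat m (unit_weight i) xs - stat_mean m (unit_weight i) n (\<lambda>x. x)))\<^sup>2)"
proof -
  have "bias n = stat_mean m t n (\<lambda>x. x) - c * real n" unfolding bias_def by (simp add: stat_mean_diff)
  then have "stat m t xs - c * real n - bias n = (\<Sum>i\<le>m. t i * (stat m (unit_weight i) xs - stat_mean m (unit_weight i) n (\<lambda>x. x)))" for xs
    using stat_linear[of m t xs] stat_mean_linear[of m t n] by (simp add: right_diff_distrib sum_subtractf)
  then show ?thesis unfolding stat_var_def stat_mean_def[of m t n "\<lambda>x. (x - c * real n - bias n)\<^sup>2"] by (simp only:)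
qed

end

lemma moment_bounded_mono: "moment_bounded m C N \<Longrightarrow> C \<le> C' \<Longrightarrow> moment_bounded m C' N"
  unfolding moment_bounded_def by fastforce

lemma moment_bounded_scaled_law:
  assumes "\<And>k. k \<le> m \<Longrightarrow> stat_mean m (unit_weight k) n (\<lambda>x. ((x - vstar m k * real n) / sqrt (real n))\<^sup>2) \<le> C"
  shows "moment_bounded m C (scaled_law m n)"
proof -
  have fin: "finite (set_pmf (map_pmf f (rand_perm n)))" for f :: "nat list \<Rightarrow> nat \<Rightarrow> real"
    by (simp add: rand_perm_def)
  have "(\<integral>x. (x k)\<^sup>2 \<partial>scaled_law m n) \<le> C" if "k \<le> m" for k
    using assms[OF that] that unfolding scaled_law_integral
    by (simp add: stat_mean_def stat_unit_weight mult.commute)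
  moreover have "integrable (scaled_law m n) (\<lambda>x. (x k)\<^sup>2)" for k
    unfolding scaled_law_def by (intro integrable_measure_pmf_finite fin)
  moreover have "AE x in scaled_law m n. \<forall>i>m. x i = 0"
    unfolding scaled_law_def by (auto simp: AE_measure_pmf_iff)
  moreover have "prob_space (scaled_law m n)"
    unfolding scaled_law_def by (rule prob_space_measure_pmf)
  moreover have "f \<in> borel_measurable (scaled_law m n)" for f :: "(nat \<Rightarrow> real) \<Rightarrow> real"
    by (simp add: scaled_law_def)
  ultimately show ?thesis unfolding moment_bounded_def by blast
qed

definition cov :: "nat \<Rightarrow> nat \<Rightarrow> nat \<Rightarrow> nat \<Rightarrow> real" where
  "cov m n i j = avg {1..n} (\<lambda>xs. (stat m (unit_weight i) xs - stat_mean m (unit_weight i) n (\<lambda>x. x)) *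
     (stat m (unit_weight j) xs - stat_mean m (unit_weight j) n (\<lambda>x. x)))"

theorem theorem2:
  fixes m :: nat
  assumes "3 \<le> m" and "m \<le> 26"
  shows "\<exists>S \<mu>. covariance_matrix m S \<and> centered_normal m S \<mu> \<and>
           conv_in_distr (scaled_law m) \<mu>"
proof -
  obtain \<alpha> where \<alpha>: "1 / 3 < \<alpha>" "\<alpha> < 1 / 2" "rate m \<alpha>" using rate_exists[OF assms] .
  have st: "search_tree m \<alpha>" using assms \<alpha> by unfold_locales auto
  define V where "V = (\<lambda>t. search_tree.stat_var m t)"
  define \<sigma> where "\<sigma> = (\<lambda>t. lim (\<lambda>n. V t n / real n))"
  have lim: "(\<lambda>n. V t n / real n) \<longlonglongrightarrow> \<sigma> t" for t
  proof -
    obtain s where "(\<lambda>n. V t n / real n) \<longlonglongrightarrow> s"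
      using search_tree.variance_limit[OF st] unfolding V_def by blast
    then show ?thesis unfolding \<sigma>_def by (simp add: limI)
  qed
  have Vc: "V t n = avg {1..n} (\<lambda>xs. (\<Sum>i\<le>m. t i * (stat m (unit_weight i) xs - stat_mean m (unit_weight i) n (\<lambda>x. x)))\<^sup>2)" for t n
    unfolding V_def by (rule search_tree.stat_var_centered[OF st])
  have V_quad: "V t n = (\<Sum>i\<le>m. \<Sum>j\<le>m. t i * cov m n i j * t j)" for t n
    unfolding Vc cov_def power2_eq_square sum_product avg_sum
    by (intro sum.cong refl) (simp add: avg_cmult[symmetric] mult_ac)
  have unit_sum: "(\<Sum>k\<le>m. unit_weight i k * z k) = z i" if "i \<le> m" for i and z :: "nat \<Rightarrow> real"
    using that unfolding unit_weight_def by (simp add: if_distrib[of "\<lambda>u. u * _"] cong: if_cong)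
  \<comment> \<open>Polarisation: the limit variances are known for every weight vector, so the
    limit of each covariance is read off from unit vectors and sums of two of them.\<close>
  define S where "S = (\<lambda>i j. (\<sigma> (\<lambda>k. unit_weight i k + unit_weight j k) - \<sigma> (unit_weight i) - \<sigma> (unit_weight j)) / 2)"
  have cov_polar: "cov m n i j = (V (\<lambda>k. unit_weight i k + unit_weight j k) n - V (unit_weight i) n - V (unit_weight j) n) / 2"
    if "i \<le> m" "j \<le> m" for i j n
  proof -
    have "avg X (\<lambda>xs. (f xs + g xs)\<^sup>2) = avg X (\<lambda>xs. (f xs)\<^sup>2) + avg X (\<lambda>xs. (g xs)\<^sup>2) +
        2 * avg X (\<lambda>xs. f xs * g xs)" for X and f g :: "nat list \<Rightarrow> real"
      by (simp only: power2_sum avg_add mult.assoc avg_cmult)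
    then show ?thesis
      unfolding Vc cov_def distrib_right sum.distrib unit_sum[OF that(1)] unit_sum[OF that(2)] by simp
  qed
  have cov_lim: "(\<lambda>n. cov m n i j / real n) \<longlonglongrightarrow> S i j" if "i \<le> m" "j \<le> m" for i j
  proof -
    have "cov m n i j / real n = (V (\<lambda>k. unit_weight i k + unit_weight j k) n / real n - V (unit_weight i) n / real n - V (unit_weight j) n / real n) / 2" for n
      unfolding cov_polar[OF that] by (simp add: diff_divide_distrib)
    then show ?thesis unfolding S_def by (simp only:) (intro tendsto_intros lim, simp)
  qed
  have \<sigma>_quad: "\<sigma> t = (\<Sum>i\<le>m. \<Sum>j\<le>m. t i * S i j * t j)" for t
  proof (rule LIMSEQ_unique[OF lim])
    have "V t n / real n = (\<Sum>i\<le>m. \<Sum>j\<le>m. t i * (cov m n i j / real n) * t j)" for n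
      unfolding V_quad by (simp add: sum_divide_distrib)
    then show "(\<lambda>n. V t n / real n) \<longlonglongrightarrow> (\<Sum>i\<le>m. \<Sum>j\<le>m. t i * S i j * t j)"
      by (simp only:) (intro tendsto_sum tendsto_mult tendsto_const cov_lim, auto)
  qed
  have "\<sigma> t \<ge> 0" for t
    using search_tree.stat_var_nonneg[OF st] unfolding V_def[symmetric]
    by (intro LIMSEQ_le_const[OF lim[of t]]) (auto simp: V_def)
  then have cm: "covariance_matrix m S"
    unfolding covariance_matrix_def \<sigma>_quad[symmetric] by (auto simp: S_def add.commute)
  then obtain \<mu> C where \<mu>: "centered_normal m S \<mu>" "moment_bounded m C \<mu>"
    using centered_normal_exists by blast
  \<comment> \<open>One constant for all measures: C serves the limit law, and the sum with an extra
    1 lies strictly above each limiting second moment, hence eventually above the second moments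
    themselves.\<close>
  define C' where "C' = max C ((\<Sum>k\<le>m. \<bar>\<sigma> (unit_weight k)\<bar>) + 1)"
  have \<mu>': "moment_bounded m C' \<mu>" by (rule moment_bounded_mono[OF \<mu>(2)]) (simp add: C'_def)
  have "\<forall>k\<in>{..m}. \<forall>\<^sub>F n in sequentially.
      stat_mean m (unit_weight k) n (\<lambda>x. ((x - vstar m k * real n) / sqrt (real n))\<^sup>2) < C'"
  proof
    fix k assume k: "k \<in> {..m}"
    have "(\<lambda>n. stat_mean m (unit_weight k) n (\<lambda>x. ((x - vstar m k * real n) / sqrt (real n))\<^sup>2)) \<longlonglongrightarrow> \<sigma> (unit_weight k)"
      using search_tree.second_moment_limit[OF st, where t = "unit_weight k" and \<sigma> = "\<sigma> (unit_weight k)"] lim[of "unit_weight k"] k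
      unfolding V_def search_tree.c_def[OF st] by (simp add: drift_unit_weight)
    moreover have "\<bar>\<sigma> (unit_weight k)\<bar> \<le> (\<Sum>k\<le>m. \<bar>\<sigma> (unit_weight k)\<bar>)" using k by (intro member_le_sum) auto
    then have "\<sigma> (unit_weight k) < C'" unfolding C'_def by linarith
    ultimately show "\<forall>\<^sub>F n in sequentially. stat_mean m (unit_weight k) n (\<lambda>x. ((x - vstar m k * real n) / sqrt (real n))\<^sup>2) < C'"
      by (rule order_tendstoD(2))
  qed
  then have "\<forall>\<^sub>F n in sequentially. \<forall>k\<in>{..m}.
      stat_mean m (unit_weight k) n (\<lambda>x. ((x - vstar m k * real n) / sqrt (real n))\<^sup>2) < C'"
    by (intro eventually_ball_finite) auto
  then have mb: "\<forall>\<^sub>F n in sequentially. moment_bounded m C' (scaled_law m n)"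
    by eventually_elim (intro moment_bounded_scaled_law, auto intro: less_imp_le)
  have char: "(\<lambda>n. CLINT x|scaled_law m n. cis (\<Sum>i\<le>m. t i * x i)) \<longlonglongrightarrow>
      (CLINT x|\<mu>. cis (\<Sum>i\<le>m. t i * x i))" for t
  proof -
    have "(\<lambda>n. CLINT x|scaled_law m n. cis (\<Sum>i\<le>m. t i * x i)) \<longlonglongrightarrow> complex_of_real (exp (- \<sigma> t / 2))"
      unfolding search_tree.char_scaled_law[OF st]
      by (rule search_tree.stat_char_limit[OF st]) (use lim[of t] in \<open>simp add: V_def\<close>)
    then show ?thesis using \<mu>(1) unfolding centered_normal_def \<sigma>_quad by simp
  qed
  have "conv_in_distr (scaled_law m) \<mu>"
    unfolding conv_in_distr_def using weak_conv_from_char[OF mb \<mu>' char] by blast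
  then show ?thesis using cm \<mu>(1) by blast
qed

end
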